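(* Let $0<R_{\mathrm{in}}<R_{\mathrm{out}}<\infty$ and let $\Omega=\{x\in\mathbb{R}^2:R_{\mathrm{in}}<|x|<R_{\mathrm{out}}\}$. Let $$\widetilde{C_T}:=\sup_{u\in H^1(\Omega)\setminus\{0\}}\frac{\|u\|_{H^{1/2}(\partial\Omega)}}{\|u\|_{H^1(\Omega)}}$$ be the optimal trace constant, with the $H^{1/2}(\partial\Omega)$-norm defined by Fourier series as in the context. Then $$\widetilde{C_T}^2=\sup_{q\in\mathbb{Z}}\Lambda_q(R_{\mathrm{in}},R_{\mathrm{out}}),$$ where, for each $q\in\mathbb{Z}$, $\Lambda_q(R_{\mathrm{in}},R_{\mathrm{out}}):=\sup_{v\ne0}\mathcal{B}_q[v]/\mathcal{E}_q[v]$ is equal to the largest root $\Lambda$ of the equation $$\begin{vmatrix}\sqrt{R_{\mathrm{in}}^2+q^2}\,I_\alpha(R_{\mathrm{in}})+\Lambda R_{\mathrm{in}}I_\alpha'(R_{\mathrm{in}})&\sqrt{R_{\mathrm{in}}^2+q^2}\,K_\alpha(R_{\mathrm{in}})+\Lambda R_{\mathrm{in}}K_\alpha'(R_{\mathrm{in}})\\ \sqrt{R_{\mathrm{out}}^2+q^2}\,I_\alpha(R_{\mathrm{out}})-\Lambda R_{\mathrm{out}}I_\alpha'(R_{\mathrm{out}})&\sqrt{R_{\mathrm{out}}^2+q^2}\,K_\alpha(R_{\mathrm{out}})-\Lambda R_{\mathrm{out}}K_\alpha'(R_{\mathrm{out}})\end{vmatrix}=0,\qquad \alpha=|q|,$$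 with $I_\alpha,K_\alpha$ the modified Bessel functions of the first and second kind.
   Context: Functions are complex-valued. In polar coordinates write $u(r,\theta)=\sum_{q\in\mathbb{Z}}u_q(r)e^{\mathrm{i}q\theta}$ with $u_q(r)=\frac1{2\pi}\int_0^{2\pi}u(r,\theta)e^{-\mathrm{i}q\theta}\,\mathrm{d}\theta$. The norm on $H^1(\Omega)$ is $\|u\|_{H^1(\Omega)}^2=\int_\Omega(|\nabla u|^2+|u|^2)\,\mathrm{d}x$. The norm used for traces on $\partial\Omega=\{|x|=R_{\mathrm{in}}\}\cup\{|x|=R_{\mathrm{out}}\}$ is $$\|u\|_{H^{1/2}(\partial\Omega)}^2=2\pi\sum_{q\in\mathbb{Z}}\Bigl(\sqrt{R_{\mathrm{in}}^2+q^2}\,|u_q(R_{\mathrm{in}})|^2+\sqrt{R_{\mathrm{out}}^2+q^2}\,|u_q(R_{\mathrm{out}})|^2\Bigr).$$ For $v\in H^1(R_{\mathrm{in}},R_{\mathrm{out}})$ (one-dimensional Sobolev space) and $q\in\mathbb{Z}$, $$\mathcal{B}_q[v]=2\pi\Bigl(\sqrt{R_{\mathrm{in}}^2+q^2}\,|v(R_{\mathrm{in}})|^2+\sqrt{R_{\mathrm{out}}^2+q^2}\,|v(R_{\mathrm{out}})|^2\Bigr),$$ $$\mathcal{E}_q[v]=2\pi\int_{R_{\mathrm{in}}}^{R_{\mathrm{out}}}\Bigl(|v'|^2+\frac{q^2}{r^2}|v|^2+|v|^2\Bigr)r\,\mathrm{d}r,$$ and the supremum defining $\Lambda_q$ is over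 nonzero $v\in H^1(R_{\mathrm{in}},R_{\mathrm{out}})$. *)

theory Defs
  imports "HOL-Analysis.Analysis"
begin

section \<open>Sobolev spaces of order one\<close>

text \<open>
  Functions are complex-valued and only their values on \<open>\<Omega>\<close> matter. An element of a Lebesgue or
  Sobolev space is given by a Borel measurable representative; equality to zero is almost
  everywhere equality on \<open>\<Omega>\<close>. The same definitions serve \<open>\<Omega> \<subseteq> \<real>\<^sup>2\<close> and intervals (where \<open>Basis = {1}\<close>).
\<close>

definition L2 :: "'a::euclidean_space set \<Rightarrow> ('a \<Rightarrow> complex) \<Rightarrow> bool" where
  "L2 \<Omega> u \<longleftrightarrow> set_borel_measurable lborel \<Omega> u \<and> set_integrable lborel \<Omega> (\<lambda>x. (cmod (u x))\<^sup>2)"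

definition ae_zero :: "'a::euclidean_space set \<Rightarrow> ('a \<Rightarrow> complex) \<Rightarrow> bool" where
  "ae_zero \<Omega> u \<longleftrightarrow> (AE x in lborel. x \<in> \<Omega> \<longrightarrow> u x = 0)"

definition partial_deriv :: "'a::euclidean_space \<Rightarrow> ('a \<Rightarrow> complex) \<Rightarrow> 'a \<Rightarrow> complex" where
  "partial_deriv i \<phi> x = frechet_derivative \<phi> (at x) i"

text \<open>
  Test functions form \<open>C\<^sub>c\<^sup>1(\<Omega>)\<close>, as in Gilbarg and Trudinger's definition of first-order weak
  derivatives.
\<close>

definition test_function :: "'a::euclidean_space set \<Rightarrow> ('a \<Rightarrow> complex) \<Rightarrow> bool" where
  "test_function \<Omega> \<phi> \<longleftrightarrow>
     \<phi> differentiable_on UNIV \<and> (\<forall>i\<in>Basis. continuous_on UNIV (partial_deriv i \<phi>)) \<and>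
     (\<exists>K. compact K \<and> K \<subseteq> \<Omega> \<and> (\<forall>x. x \<notin> K \<longrightarrow> \<phi> x = 0))"

definition is_L2_weak_deriv ::
    "'a::euclidean_space set \<Rightarrow> 'a \<Rightarrow> ('a \<Rightarrow> complex) \<Rightarrow> ('a \<Rightarrow> complex) \<Rightarrow> bool" where
  "is_L2_weak_deriv \<Omega> i u g \<longleftrightarrow> L2 \<Omega> g \<and>
     (\<forall>\<phi>. test_function \<Omega> \<phi> \<longrightarrow>
        (LINT x:\<Omega>|lborel. u x * partial_deriv i \<phi> x) = - (LINT x:\<Omega>|lborel. g x * \<phi> x))"

definition H1 :: "'a::euclidean_space set \<Rightarrow> ('a \<Rightarrow> complex) \<Rightarrow> bool" where
  "H1 \<Omega> u \<longleftrightarrow> L2 \<Omega> u \<and> (\<forall>i\<in>Basis. \<exists>g. is_L2_weak_deriv \<Omega> i u g)"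

text \<open>Determined up to almost everywhere equality on open \<open>\<Omega>\<close>.\<close>

definition weak_deriv :: "'a::euclidean_space set \<Rightarrow> 'a \<Rightarrow> ('a \<Rightarrow> complex) \<Rightarrow> 'a \<Rightarrow> complex" where
  "weak_deriv \<Omega> i u = (SOME g. is_L2_weak_deriv \<Omega> i u g)"

definition H1_norm :: "'a::euclidean_space set \<Rightarrow> ('a \<Rightarrow> complex) \<Rightarrow> real" where
  "H1_norm \<Omega> u =
     sqrt (LINT x:\<Omega>|lborel. (\<Sum>i\<in>Basis. (cmod (weak_deriv \<Omega> i u x))\<^sup>2) + (cmod (u x))\<^sup>2)"

text \<open>
  \<open>cont_rep a b v\<close> is, on \<open>{a..b}\<close>, the continuous representative of a function \<open>v\<close> on \<open>(a, b)\<close>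
  (which exists for every \<open>v \<in> H\<^sup>1(a, b)\<close>); it gives the meaning of \<open>v(a)\<close> and \<open>v(b)\<close>.
\<close>

definition is_cont_rep :: "real \<Rightarrow> real \<Rightarrow> (real \<Rightarrow> complex) \<Rightarrow> (real \<Rightarrow> complex) \<Rightarrow> bool" where
  "is_cont_rep a b v g \<longleftrightarrow>
     continuous_on {a..b} g \<and> (AE r in lborel. r \<in> {a<..<b} \<longrightarrow> g r = v r)"

definition cont_rep :: "real \<Rightarrow> real \<Rightarrow> (real \<Rightarrow> complex) \<Rightarrow> real \<Rightarrow> complex" where
  "cont_rep a b v = (SOME g. is_cont_rep a b v g)"

lemma is_cont_rep_unique:
  assumes "a < b" "is_cont_rep a b v g" "is_cont_rep a b v h" "r \<in> {a..b}"
  shows "g r = h r"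
proof -
  have c: "continuous_on {a..b} (\<lambda>x. g x - h x)"
    using assms by (auto simp: is_cont_rep_def intro!: continuous_intros)
  have ae: "AE x in lborel. x \<in> {a<..<b} \<longrightarrow> g x - h x = 0"
    using assms(2,3) unfolding is_cont_rep_def by (auto elim: AE_mp)
  have "x \<in> {a..b} \<inter> (\<lambda>x. g x - h x) -` {0}" if "x \<in> {a<..<b}" for x
  proof (rule mem_closed_if_AE_lebesgue_open[OF open_greaterThanLessThan _ _ that])
    show "closed ({a..b} \<inter> (\<lambda>x. g x - h x) -` {0})"
      using c by (intro continuous_closed_preimage) auto
    have "AE x in lborel. x \<in> {a<..<b} \<longrightarrow> x \<in> {a..b} \<inter> (\<lambda>x. g x - h x) -` {0}"
      using ae by eventually_elim auto
    then show "AE x\<in>{a<..<b} in lebesgue. x \<in> {a..b} \<inter> (\<lambda>x. g x - h x) -` {0}"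
      by (rule AE_completion)
  qed
  then have "\<And>x. x \<in> {a<..<b} \<Longrightarrow> g x - h x = 0" by auto
  moreover have "closure {a<..<b} = {a..b}"
    using assms(1) by simp
  ultimately have "g r - h r = 0"
    using continuous_constant_on_closure[of "{a<..<b}" "\<lambda>x. g x - h x" 0 r] c assms(4) by simp
  then show ?thesis by simp
qed

lemma cont_rep_eq:
  assumes "a < b" "is_cont_rep a b v g" "r \<in> {a..b}"
  shows "cont_rep a b v r = g r"
  using assms is_cont_rep_unique someI[of "is_cont_rep a b v", OF assms(2)]
  unfolding cont_rep_def by blast


section \<open>The trace norm on the boundary of an annulus\<close>

definition annulus :: "real \<Rightarrow> real \<Rightarrow> (real^2) set" where
  "annulus Rin Rout = {x. Rin < norm x \<and> norm x < Rout}"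

definition polar :: "real \<Rightarrow> real \<Rightarrow> real^2" where
  "polar r \<theta> = vector [r * cos \<theta>, r * sin \<theta>]"

definition fourier_coeff :: "(real^2 \<Rightarrow> complex) \<Rightarrow> int \<Rightarrow> real \<Rightarrow> complex" where
  "fourier_coeff u q r =
     (1 / (2 * pi)) * (LINT \<theta>:{0..2*pi}|lborel. u (polar r \<theta>) * exp (- \<i> * of_int q * of_real \<theta>))"

text \<open>
  For \<open>u \<in> H\<^sup>1(\<Omega>)\<close> the function \<open>r \<mapsto> u\<^sub>q(r)\<close> belongs to the one-dimensional space
  \<open>H\<^sup>1(Rin, Rout)\<close>. Its boundary values \<open>u\<^sub>q(Rin)\<close>, \<open>u\<^sub>q(Rout)\<close>, which are the Fourier coefficients of
  the trace of \<open>u\<close> on the two circles, are therefore those of its continuous representative. For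
  \<open>u\<close> continuous up to the boundary they are the Fourier coefficients of the restriction of \<open>u\<close> to
  the circles, see \<open>trace_coeff_continuous\<close> below.
\<close>

definition trace_coeff :: "real \<Rightarrow> real \<Rightarrow> (real^2 \<Rightarrow> complex) \<Rightarrow> int \<Rightarrow> real \<Rightarrow> complex" where
  "trace_coeff Rin Rout u q = cont_rep Rin Rout (fourier_coeff u q)"

lemma trace_coeff_continuous:
  assumes "0 < Rin" "Rin < Rout" "R \<in> {Rin..Rout}"
    and u: "continuous_on {x. Rin \<le> norm x \<and> norm x \<le> Rout} u"
  shows "trace_coeff Rin Rout u q R = fourier_coeff u q R"
proof -
  define F where "F = (\<lambda>r \<theta>. u (polar r \<theta>) * exp (- \<i> * of_int q * of_real \<theta>))"
  have nrm: "norm (polar r \<theta>) = \<bar>r\<bar>" for r \<theta>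
    by (simp add: polar_def norm_vec_def L2_set_def UNIV_2 power_mult_distrib flip: distrib_left)
  have pol: "continuous_on UNIV (\<lambda>(r, \<theta>). polar r \<theta>)"
    unfolding polar_def case_prod_unfold
    by (subst continuous_on_componentwise)
       (auto simp: Basis_vec_def inner_axis forall_2 intro!: continuous_intros)
  have pol': "continuous_on ({Rin..Rout} \<times> {0..2*pi}) (\<lambda>x. polar (fst x) (snd x))"
    using continuous_on_subset[OF pol] by (auto simp: case_prod_unfold)
  have cu: "continuous_on ({Rin..Rout} \<times> {0..2*pi}) (\<lambda>x. u (polar (fst x) (snd x)))"
    by (rule continuous_on_compose2[OF u pol']) (use assms(1) in \<open>auto simp: nrm\<close>)
  have c: "continuous_on ({Rin..Rout} \<times> cbox 0 (2*pi)) (\<lambda>(r, \<theta>). F r \<theta>)"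
    unfolding F_def case_prod_unfold box_real by (intro continuous_intros cu)
  have ci: "continuous_on {Rin..Rout} (\<lambda>r. integral (cbox 0 (2*pi)) (F r))"
    by (rule integral_continuous_on_param[OF c])
  have eq: "(LINT \<theta>:{0..2*pi}|lborel. F r \<theta>) = integral (cbox 0 (2*pi)) (F r)"
    if "r \<in> {Rin..Rout}" for r
  proof -
    have "continuous_on {0..2*pi} (\<lambda>\<theta>. case (r, \<theta>) of (r, \<theta>) \<Rightarrow> F r \<theta>)"
      by (rule continuous_on_compose2[OF c]) (use that in \<open>auto intro!: continuous_intros\<close>)
    then have cF: "continuous_on {0..2*pi} (F r)" by simp
    have "set_integrable lborel {0..2*pi} (F r)"
      unfolding set_integrable_def by (rule borel_integrable_compact[OF compact_Icc cF])
    then show ?thesis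
      unfolding box_real by (rule set_borel_integral_eq_integral)
  qed
  have "continuous_on {Rin..Rout} (\<lambda>r. LINT \<theta>:{0..2*pi}|lborel. F r \<theta>)"
    by (rule continuous_on_eq[OF ci]) (rule eq[symmetric])
  moreover have "fourier_coeff u q = (\<lambda>r. (1 / (2 * pi)) * (LINT \<theta>:{0..2*pi}|lborel. F r \<theta>))"
    by (rule ext) (simp only: fourier_coeff_def F_def)
  ultimately have "continuous_on {Rin..Rout} (fourier_coeff u q)"
    by (simp only:) (rule continuous_on_mult_left)
  then have "is_cont_rep Rin Rout (fourier_coeff u q) (fourier_coeff u q)"
    by (simp add: is_cont_rep_def)
  from cont_rep_eq[OF assms(2) this assms(3)] show ?thesis
    by (simp add: trace_coeff_def)
qed

text \<open>
  Squares of trace norms are taken in \<open>[0, \<infinity>]\<close>, so that neither the series nor the suprema below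
  presuppose convergence or boundedness.
\<close>

definition Hhalf_norm_sq :: "real \<Rightarrow> real \<Rightarrow> (real^2 \<Rightarrow> complex) \<Rightarrow> ennreal" where
  "Hhalf_norm_sq Rin Rout u =
     ennreal (2 * pi) * (\<Sum>\<^sub>\<infinity>q\<in>UNIV. ennreal (
         sqrt (Rin\<^sup>2 + (of_int q)\<^sup>2) * (cmod (trace_coeff Rin Rout u q Rin))\<^sup>2
       + sqrt (Rout\<^sup>2 + (of_int q)\<^sup>2) * (cmod (trace_coeff Rin Rout u q Rout))\<^sup>2))"

definition ennreal_sqrt :: "ennreal \<Rightarrow> ennreal" where
  "ennreal_sqrt x = (if x = top then top else ennreal (sqrt (enn2real x)))"

definition Hhalf_norm :: "real \<Rightarrow> real \<Rightarrow> (real^2 \<Rightarrow> complex) \<Rightarrow> ennreal" where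
  "Hhalf_norm Rin Rout u = ennreal_sqrt (Hhalf_norm_sq Rin Rout u)"

definition trace_const :: "real \<Rightarrow> real \<Rightarrow> ennreal" where
  "trace_const Rin Rout =
     (SUP u\<in>{u. H1 (annulus Rin Rout) u \<and> \<not> ae_zero (annulus Rin Rout) u}.
        Hhalf_norm Rin Rout u / ennreal (H1_norm (annulus Rin Rout) u))"


section \<open>The one-dimensional quotients\<close>

definition bdry_form :: "real \<Rightarrow> real \<Rightarrow> int \<Rightarrow> (real \<Rightarrow> complex) \<Rightarrow> real" where
  "bdry_form Rin Rout q v =
     2 * pi * (sqrt (Rin\<^sup>2 + (of_int q)\<^sup>2) * (cmod (cont_rep Rin Rout v Rin))\<^sup>2
             + sqrt (Rout\<^sup>2 + (of_int q)\<^sup>2) * (cmod (cont_rep Rin Rout v Rout))\<^sup>2)"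

definition energy_form :: "real \<Rightarrow> real \<Rightarrow> int \<Rightarrow> (real \<Rightarrow> complex) \<Rightarrow> real" where
  "energy_form Rin Rout q v =
     2 * pi * (LINT r:{Rin<..<Rout}|lborel.
       ((cmod (weak_deriv {Rin<..<Rout} 1 v r))\<^sup>2
        + (of_int q)\<^sup>2 / r\<^sup>2 * (cmod (v r))\<^sup>2 + (cmod (v r))\<^sup>2) * r)"

definition Lambda :: "real \<Rightarrow> real \<Rightarrow> int \<Rightarrow> ennreal" where
  "Lambda Rin Rout q =
     (SUP v\<in>{v. H1 {Rin<..<Rout} v \<and> \<not> ae_zero {Rin<..<Rout} v}.
        ennreal (bdry_form Rin Rout q v / energy_form Rin Rout q v))"


section \<open>Modified Bessel functions of integer order\<close>

definition bessel_I :: "nat \<Rightarrow> real \<Rightarrow> real" where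
  "bessel_I n x = (\<Sum>k. (x / 2) ^ (2 * k + n) / (fact k * fact (k + n)))"

text \<open>The classical integral definition of \<open>K\<^sub>n(x)\<close>, for \<open>x > 0\<close>.\<close>

definition bessel_K :: "nat \<Rightarrow> real \<Rightarrow> real" where
  "bessel_K n x = (LINT t:{0..}|lborel. exp (- x * cosh t) * cosh (real n * t))"

definition bessel_matrix :: "real \<Rightarrow> real \<Rightarrow> int \<Rightarrow> real \<Rightarrow> real^2^2" where
  "bessel_matrix Rin Rout q L = (let n = nat \<bar>q\<bar> in
     vector [
       vector [sqrt (Rin\<^sup>2 + (of_int q)\<^sup>2) * bessel_I n Rin + L * Rin * deriv (bessel_I n) Rin,
               sqrt (Rin\<^sup>2 + (of_int q)\<^sup>2) * bessel_K n Rin + L * Rin * deriv (bessel_K n) Rin],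
       vector [sqrt (Rout\<^sup>2 + (of_int q)\<^sup>2) * bessel_I n Rout - L * Rout * deriv (bessel_I n) Rout,
               sqrt (Rout\<^sup>2 + (of_int q)\<^sup>2) * bessel_K n Rout - L * Rout * deriv (bessel_K n) Rout]])"

end

theory Submission
  imports Defs
begin

text \<open>
  Testing with the vector fields \<open>\<kappa>(|x|) e\<^sup>-\<^sup>i\<^sup>q\<^sup>\<theta> x\<close> and \<open>\<kappa>(|x|) e\<^sup>-\<^sup>i\<^sup>q\<^sup>\<theta> x\<^sup>\<bottom>\<close> shows that the Fourier coefficients of
  \<open>u \<in> H\<^sup>1(\<Omega>)\<close> lie in the one-dimensional space \<open>H\<^sup>1\<close>; Bessel's inequality on every circle then bounds the sum of
  their energies by \<open>\<parallel>u\<parallel>\<^sup>2\<close>, so the trace constant is at most the supremum of the \<open>\<Lambda>\<^sub>q\<close>. Conversely the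
  separated functions \<open>w(r) e\<^sup>i\<^sup>q\<^sup>\<theta>\<close> attain \<open>\<Lambda>\<^sub>q\<close>.

  In one dimension a solution \<open>w\<close> of the Bessel equation minimizes the energy for its boundary values, and its energy
  is the boundary term \<open>[r w' w]\<close>. Hence \<open>\<Lambda>\<^sub>q\<close> is the maximum of a quotient of two real quadratic forms in the two
  coefficients of \<open>w = c I + d K\<close>. At a maximizer the gradient condition is the pair of Robin conditions whose
  solvability is the vanishing of the determinant, and any root \<open>\<Lambda>\<close> of the determinant is a value of the quotient.
\<close>

section \<open>Test functions and weak derivatives\<close>

text \<open>Functions are bare measurable representatives, so traces are reached only through the
  coefficients \<open>u_q\<close> of single circles. Boundary values come from testing: on an
  interval, integration by parts against C^1 functions that may be nonzero at the endpoints
  determines them from the weak derivative.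

  The reduction to one dimension is sharp because the q-th coefficient of the angular derivative,
  taken with its factor 1/r, is i q u_q / r. The term q^2/r^2 |u_q|^2 of the radial energy is
  therefore itself a squared Fourier coefficient, and Bessel's inequality applies to the radial
  derivative, the angular derivative and \<open>u\<close> simultaneously.

  In one dimension the maximizer comes from compactness of the unit circle in the plane of
  coefficients (c, d). This plane represents all pairs of real boundary values because
  \<open>I\<close> increases and \<open>K\<close> decreases; complex values are split into real and
  imaginary parts. The flux form is positive definite, which lets a root of the determinant be
  compared with the maximum.\<close>

lemma partial_deriv_eq:
  assumes "(f has_derivative f') (at x)"
  shows "partial_deriv i f x = f' i"
  using frechet_derivative_at[OF assms] by (simp add: partial_deriv_def)

lemma partial_deriv_eq_0:
  assumes "open S" "x \<in> S" "\<And>y. y \<in> S \<Longrightarrow> f y = 0"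
  shows "(f has_derivative (\<lambda>_. 0)) (at x)" "partial_deriv i f x = 0"
proof -
  show d: "(f has_derivative (\<lambda>_. 0)) (at x)"
    by (rule has_derivative_transform_within_open[OF has_derivative_const[of 0] assms(1,2)])
       (simp add: assms(3))
  show "partial_deriv i f x = 0" using partial_deriv_eq[OF d] by simp
qed

text \<open>The complement of the support is open and the function is zero on it, so the same
  compact set also carries every partial derivative.\<close>

lemma test_functionE:
  assumes "test_function \<Omega> \<phi>"
  obtains K where "compact K" "K \<subseteq> \<Omega>" "\<And>x. x \<notin> K \<Longrightarrow> \<phi> x = 0"
    "\<And>i x. x \<notin> K \<Longrightarrow> partial_deriv i \<phi> x = 0"
proof -
  obtain K where K: "compact K" "K \<subseteq> \<Omega>" "\<forall>x. x \<notin> K \<longrightarrow> \<phi> x = 0"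
    using assms by (auto simp: test_function_def)
  have "partial_deriv i \<phi> x = 0" if "x \<notin> K" for i x
    by (rule partial_deriv_eq_0(2)[of "- K"]) (use K that in \<open>auto simp: compact_imp_closed open_Compl\<close>)
  then show ?thesis using K that by blast
qed

lemma test_function_differentiable:
  assumes "test_function \<Omega> \<phi>"
  shows "\<phi> differentiable (at x)"
  using assms by (auto simp: test_function_def differentiable_on_def)

lemma test_function_has_derivative:
  assumes "test_function \<Omega> \<phi>"
  shows "(\<phi> has_derivative (\<lambda>h. partial_deriv h \<phi> x)) (at x)"
  using test_function_differentiable[OF assms, of x]
  by (simp add: partial_deriv_def frechet_derivative_works)

lemma test_function_continuous:
  assumes "test_function \<Omega> \<phi>"
  shows "continuous_on UNIV \<phi>"
  using assms by (auto simp: test_function_def intro: differentiable_imp_continuous_on)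

lemma test_function_mono:
  assumes "test_function \<Omega> \<phi>" "\<Omega> \<subseteq> \<Omega>'"
  shows "test_function \<Omega>' \<phi>"
  using assms by (auto simp: test_function_def)

lemma bounded_if_compact_support:
  fixes f :: "'a::topological_space \<Rightarrow> complex"
  assumes "continuous_on UNIV f" "compact K" "\<And>x. x \<notin> K \<Longrightarrow> f x = 0"
  obtains B where "B > 0" "\<And>x. norm (f x) \<le> B"
proof -
  have "bounded (f ` K)"
    using assms by (intro compact_imp_bounded compact_continuous_image) (auto intro: continuous_on_subset)
  then obtain B where B: "B > 0" "\<forall>x\<in>K. norm (f x) \<le> B" by (auto simp: bounded_pos)
  then show ?thesis using assms(3) by (intro that[of B]) (metis less_imp_le norm_zero, metis norm_zero less_imp_le)
qed

lemma integrable_if_compact_support: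
  fixes f :: "'a::euclidean_space \<Rightarrow> complex"
  assumes "continuous_on UNIV f" "compact K" "\<And>x. x \<notin> K \<Longrightarrow> f x = 0"
  shows "integrable lborel f"
proof -
  have "integrable lborel (\<lambda>x. indicator K x *\<^sub>R f x)"
    using assms by (intro borel_integrable_compact) (auto intro: continuous_on_subset)
  also have "(\<lambda>x. indicator K x *\<^sub>R f x) = f"
    using assms(3) by (auto simp: indicator_def fun_eq_iff)
  finally show ?thesis .
qed

text \<open>By translation invariance all difference quotients have integral zero.\<close>

lemma integral_partial_deriv_eq_0:
  fixes \<psi> :: "'a::euclidean_space \<Rightarrow> complex"
  assumes \<psi>: "test_function UNIV \<psi>" and i: "i \<in> Basis"
  shows "(LINT x|lborel. partial_deriv i \<psi> x) = 0"
proof -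
  obtain K where K: "compact K" "\<And>x. x \<notin> K \<Longrightarrow> \<psi> x = 0" "\<And>x. x \<notin> K \<Longrightarrow> partial_deriv i \<psi> x = 0"
    using test_functionE[OF \<psi>] by metis
  have c: "continuous_on UNIV \<psi>" by (rule test_function_continuous[OF \<psi>])
  have cd: "continuous_on UNIV (partial_deriv i \<psi>)"
    using \<psi> i by (auto simp: test_function_def)
  obtain B where B: "B > 0" "\<And>x. norm (partial_deriv i \<psi> x) \<le> B"
    using bounded_if_compact_support[OF cd K(1) K(3)] by blast
  obtain R where R: "K \<subseteq> cball 0 R"
    using compact_imp_bounded[OF K(1)] by (metis bounded_iff mem_cball_0 subsetI)
  have intg: "integrable lborel \<psi>" by (rule integrable_if_compact_support[OF c K(1,2)])
  have shift: "has_bochner_integral lborel (\<lambda>x. \<psi> (c + x)) (LINT x|lborel. \<psi> x)" for c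
  proof -
    have m: "\<psi> \<in> borel_measurable borel"
      using c by (rule borel_measurable_continuous_onI)
    have "has_bochner_integral (distr lborel borel ((+) c)) \<psi> (LINT x|lborel. \<psi> x)"
      unfolding lborel_distr_plus using intg by (rule has_bochner_integral_integrable)
    then show ?thesis
      using m by (simp add: has_bochner_integral_iff integrable_distr_eq integral_distr)
  qed
  define t where "t = (\<lambda>n::nat. 1 / real (Suc n))"
  have tpos: "0 < t n" "t n \<le> 1" for n by (auto simp: t_def)
  have der: "((\<lambda>s. \<psi> (x + s *\<^sub>R i)) has_vector_derivative partial_deriv i \<psi> (x + s *\<^sub>R i)) (at s)" for x s
  proof -
    have l: "linear (\<lambda>h. partial_deriv h \<psi> (x + s *\<^sub>R i))"
      using test_function_has_derivative[OF \<psi>] has_derivative_linear by blast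
    have "((\<lambda>s. \<psi> (x + s *\<^sub>R i)) has_derivative (\<lambda>h. partial_deriv (h *\<^sub>R i) \<psi> (x + s *\<^sub>R i))) (at s)"
      by (rule has_derivative_compose[OF _ test_function_has_derivative[OF \<psi>], where f = "\<lambda>s. x + s *\<^sub>R i"])
         (auto intro!: derivative_eq_intros)
    then show ?thesis
      using linear_scale[OF l] by (simp add: has_vector_derivative_def)
  qed
  \<comment> \<open>Difference quotients in direction \<open>i\<close>. Their integrals vanish by
    translation invariance, and dominated convergence passes this on to the derivative.\<close>
  define D where "D = (\<lambda>n x. (\<psi> (t n *\<^sub>R i + x) - \<psi> x) /\<^sub>R t n)"
  have D0: "(LINT x|lborel. D n x) = 0" for n
    unfolding D_def using shift[of "t n *\<^sub>R i"] intg
    by (simp add: has_bochner_integral_iff)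
  have Dm: "D n \<in> borel_measurable lborel" for n
    unfolding D_def using shift[of "t n *\<^sub>R i"] intg
    by (auto simp: has_bochner_integral_iff intro!: borel_measurable_scaleR borel_measurable_diff)
  \<comment> \<open>The mean value inequality bounds the quotient by \<open>B\<close>. The radius
    \<open>R + 1\<close> suffices because the shift has length at most 1: further out, both
    evaluation points lie outside \<open>K\<close>.\<close>
  have bound: "norm (D n x) \<le> B * indicator (cball 0 (R + 1)) x" for n x
  proof (cases "x \<in> cball 0 (R + 1)")
    case True
    have "norm (\<psi> (x + t n *\<^sub>R i) - \<psi> (x + 0 *\<^sub>R i)) \<le> B * norm (t n - 0)"
    proof (rule differentiable_bound[of UNIV "\<lambda>s. \<psi> (x + s *\<^sub>R i)" "\<lambda>s h. h *\<^sub>R partial_deriv i \<psi> (x + s *\<^sub>R i)"])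
      show "onorm (\<lambda>h. h *\<^sub>R partial_deriv i \<psi> (x + s *\<^sub>R i)) \<le> B" for s
        using B(2)[of "x + s *\<^sub>R i"]
        by (intro onorm_bound) (auto intro!: mult_left_mono simp: mult.commute[of B] B(1) less_imp_le)
    qed (use der in \<open>auto simp: has_vector_derivative_def\<close>)
    then show ?thesis using True tpos[of n] by (simp add: D_def add.commute divide_simps mult.commute)
  next
    case False
    have "norm x \<le> norm (t n *\<^sub>R i + x) + norm (t n *\<^sub>R i)"
      by (metis add_diff_cancel_left' norm_triangle_ineq4 norm_minus_commute add.commute)
    then have "x \<notin> K" "t n *\<^sub>R i + x \<notin> K"
      using R False tpos[of n] i by (auto simp: subset_eq)
    then show ?thesis using K(2) False by (simp add: D_def)
  qed
  have lim: "(\<lambda>n. D n x) \<longlonglongrightarrow> partial_deriv i \<psi> x" for x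
  proof -
    have "((\<lambda>s. (\<psi> (x + s *\<^sub>R i) - \<psi> (x + 0 *\<^sub>R i)) /\<^sub>R (s - 0)) \<longlongrightarrow> partial_deriv i \<psi> (x + 0 *\<^sub>R i)) (at 0)"
    proof -
      have "((\<lambda>s. (\<psi> (x + s *\<^sub>R i) - \<psi> (x + 0 *\<^sub>R i) - (s - 0) *\<^sub>R partial_deriv i \<psi> (x + 0 *\<^sub>R i)) /\<^sub>R norm (s - 0)) \<longlongrightarrow> 0) (at 0)"
        using der[of x 0] unfolding has_vector_derivative_def has_derivative_def
        by (auto simp: netlimit_at)
      from tendsto_norm_zero[OF this]
      have "((\<lambda>s. norm ((\<psi> (x + s *\<^sub>R i) - \<psi> (x + 0 *\<^sub>R i)) /\<^sub>R (s - 0) - partial_deriv i \<psi> (x + 0 *\<^sub>R i))) \<longlongrightarrow> 0) (at 0)"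
      proof (rule Lim_transform_eventually)
        have "norm ((a - s *\<^sub>R b) /\<^sub>R norm s) = norm (a /\<^sub>R s - b)" if "s \<noteq> 0" for s :: real and a b :: complex
        proof -
          have "a /\<^sub>R s - b = (a - s *\<^sub>R b) /\<^sub>R s" using that by (simp add: algebra_simps)
          then show ?thesis by simp
        qed
        then show "\<forall>\<^sub>F s in at 0. norm ((\<psi> (x + s *\<^sub>R i) - \<psi> (x + 0 *\<^sub>R i) - (s - 0) *\<^sub>R partial_deriv i \<psi> (x + 0 *\<^sub>R i)) /\<^sub>R norm (s - 0)) =
          norm ((\<psi> (x + s *\<^sub>R i) - \<psi> (x + 0 *\<^sub>R i)) /\<^sub>R (s - 0) - partial_deriv i \<psi> (x + 0 *\<^sub>R i))"
          by (simp add: eventually_at_filter)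
      qed
      then show ?thesis by (simp add: tendsto_norm_zero_iff LIM_zero_iff)
    qed
    moreover have "filterlim t (at 0) sequentially"
      unfolding filterlim_at t_def
      using LIMSEQ_Suc[OF lim_1_over_n] by auto
    ultimately have "(\<lambda>n. (\<psi> (x + t n *\<^sub>R i) - \<psi> (x + 0 *\<^sub>R i)) /\<^sub>R (t n - 0)) \<longlonglongrightarrow> partial_deriv i \<psi> (x + 0 *\<^sub>R i)"
      by (rule filterlim_compose)
    then show ?thesis by (simp add: D_def add.commute)
  qed
  have "(\<lambda>n. LINT x|lborel. D n x) \<longlonglongrightarrow> (LINT x|lborel. partial_deriv i \<psi> x)"
  proof (rule integral_dominated_convergence[where w = "\<lambda>x. B * indicator (cball 0 (R + 1)) x"])
    show "partial_deriv i \<psi> \<in> borel_measurable lborel"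
      using borel_measurable_continuous_onI[OF cd] by simp
    show "integrable lborel (\<lambda>x::'a. B * indicator (cball 0 (R + 1)) x :: real)"
      using emeasure_lborel_cball_finite[of "0::'a" "R + 1"]
      by (intro integrable_mult_right integrable_real_indicator) auto
  qed (use Dm bound lim in auto)
  then show ?thesis by (simp add: D0 LIMSEQ_const_iff)
qed

text \<open>The factor \<open>u\<close> is controlled only on \<Omega>. The product is still C^1 on
  the whole space, since \<Omega> and the complement of the support of \<phi> are open, cover
  everything, and the product is zero on the second set.\<close>

lemma test_function_mult:
  assumes \<Omega>: "open \<Omega>" and \<phi>: "test_function \<Omega> \<phi>"
    and u: "\<And>x. x \<in> \<Omega> \<Longrightarrow> u differentiable (at x)"
      "\<And>i. i \<in> Basis \<Longrightarrow> continuous_on \<Omega> (partial_deriv i u)"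
  shows "test_function \<Omega> (\<lambda>x. u x * \<phi> x)"
    and "x \<in> \<Omega> \<Longrightarrow> partial_deriv i (\<lambda>x. u x * \<phi> x) x = u x * partial_deriv i \<phi> x + partial_deriv i u x * \<phi> x"
    and "x \<notin> \<Omega> \<Longrightarrow> partial_deriv i (\<lambda>x. u x * \<phi> x) x = 0"
proof -
  obtain K where K: "compact K" "K \<subseteq> \<Omega>" "\<And>x. x \<notin> K \<Longrightarrow> \<phi> x = 0"
    using test_functionE[OF \<phi>] by metis
  have oK: "open (- K)" using K(1) by (simp add: compact_imp_closed open_Compl)
  have UN: "UNIV = \<Omega> \<union> - K" using K(2) by auto
  have d: "((\<lambda>x. u x * \<phi> x) has_derivative
      (\<lambda>h. u x * partial_deriv h \<phi> x + partial_deriv h u x * \<phi> x)) (at x)" if "x \<in> \<Omega>" for x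
    using has_derivative_mult[OF u(1)[OF that, unfolded frechet_derivative_works] test_function_has_derivative[OF \<phi>, of x]]
    by (simp add: partial_deriv_def)
  have p1: "partial_deriv i (\<lambda>x. u x * \<phi> x) x = u x * partial_deriv i \<phi> x + partial_deriv i u x * \<phi> x"
    if "x \<in> \<Omega>" for x i
    using partial_deriv_eq[OF d[OF that]] .
  have p0: "((\<lambda>x. u x * \<phi> x) has_derivative (\<lambda>h. 0)) (at x)" "partial_deriv i (\<lambda>x. u x * \<phi> x) x = 0"
    if "x \<in> - K" for x i
    using partial_deriv_eq_0[OF oK that, of "\<lambda>x. u x * \<phi> x"] K(3) by auto
  show "x \<in> \<Omega> \<Longrightarrow> partial_deriv i (\<lambda>x. u x * \<phi> x) x = u x * partial_deriv i \<phi> x + partial_deriv i u x * \<phi> x"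
    by (rule p1)
  show "x \<notin> \<Omega> \<Longrightarrow> partial_deriv i (\<lambda>x. u x * \<phi> x) x = 0"
    using p0 K(2) by blast
  have "(\<lambda>x. u x * \<phi> x) differentiable_on UNIV"
    unfolding differentiable_on_def differentiable_def using d p0(1) UN by auto blast
  moreover have "continuous_on UNIV (partial_deriv i (\<lambda>x. u x * \<phi> x))" if i: "i \<in> Basis" for i
    unfolding UN
  proof (rule continuous_on_open_Un[OF \<Omega> oK])
    have cu: "continuous_on \<Omega> u"
      using u(1) by (auto intro!: continuous_at_imp_continuous_on differentiable_imp_continuous_within)
    have c\<phi>: "continuous_on \<Omega> \<phi>" "continuous_on \<Omega> (partial_deriv i \<phi>)"
      using test_function_continuous[OF \<phi>] \<phi> i continuous_on_subset unfolding test_function_def by blast+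
    show "continuous_on \<Omega> (partial_deriv i (\<lambda>x. u x * \<phi> x))"
      using p1 cu c\<phi> u(2)[OF i] by (subst continuous_on_cong[OF refl p1]) (auto intro!: continuous_intros)
    show "continuous_on (- K) (partial_deriv i (\<lambda>x. u x * \<phi> x))"
      by (subst continuous_on_cong[OF refl p0(2)]) auto
  qed
  ultimately show "test_function \<Omega> (\<lambda>x. u x * \<phi> x)"
    unfolding test_function_def using K by (metis mult_zero_right)
qed

lemma test_function_add:
  assumes "test_function \<Omega> \<phi>" "test_function \<Omega> \<psi>"
  shows "test_function \<Omega> (\<lambda>x. \<phi> x + \<psi> x)"
    and "partial_deriv i (\<lambda>x. \<phi> x + \<psi> x) x = partial_deriv i \<phi> x + partial_deriv i \<psi> x"
proof -
  have d: "((\<lambda>x. \<phi> x + \<psi> x) has_derivative (\<lambda>h. partial_deriv h \<phi> x + partial_deriv h \<psi> x)) (at x)" for x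
    using assms by (intro has_derivative_add test_function_has_derivative)
  have p: "partial_deriv i (\<lambda>x. \<phi> x + \<psi> x) = (\<lambda>x. partial_deriv i \<phi> x + partial_deriv i \<psi> x)" for i
    using partial_deriv_eq[OF d] by blast
  then show "partial_deriv i (\<lambda>x. \<phi> x + \<psi> x) x = partial_deriv i \<phi> x + partial_deriv i \<psi> x" by simp
  obtain K L where K: "compact K" "K \<subseteq> \<Omega>" "\<And>x. x \<notin> K \<Longrightarrow> \<phi> x = 0"
    and L: "compact L" "L \<subseteq> \<Omega>" "\<And>x. x \<notin> L \<Longrightarrow> \<psi> x = 0"
    using test_functionE[OF assms(1)] test_functionE[OF assms(2)] by metis
  have "\<exists>K. compact K \<and> K \<subseteq> \<Omega> \<and> (\<forall>x. x \<notin> K \<longrightarrow> \<phi> x + \<psi> x = 0)"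
    using K L by (intro exI[of _ "K \<union> L"]) (auto intro: compact_Un)
  moreover have "(\<lambda>x. \<phi> x + \<psi> x) differentiable_on UNIV"
    unfolding differentiable_on_def differentiable_def using d by auto
  moreover have "\<forall>i\<in>Basis. continuous_on UNIV (partial_deriv i (\<lambda>x. \<phi> x + \<psi> x))"
    using assms unfolding p by (auto simp: test_function_def intro!: continuous_intros)
  ultimately show "test_function \<Omega> (\<lambda>x. \<phi> x + \<psi> x)"
    by (simp add: test_function_def)
qed

lemma test_function_cmult:
  assumes "test_function \<Omega> \<phi>"
  shows "test_function \<Omega> (\<lambda>x. c * \<phi> x)"
    and "partial_deriv i (\<lambda>x. c * \<phi> x) x = c * partial_deriv i \<phi> x"
proof -
  have d: "((\<lambda>x. c * \<phi> x) has_derivative (\<lambda>h. c * partial_deriv h \<phi> x)) (at x)" for x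
    using test_function_has_derivative[OF assms] by (intro has_derivative_mult_right)
  have p: "partial_deriv i (\<lambda>x. c * \<phi> x) = (\<lambda>x. c * partial_deriv i \<phi> x)" for i
    using partial_deriv_eq[OF d] by blast
  then show "partial_deriv i (\<lambda>x. c * \<phi> x) x = c * partial_deriv i \<phi> x" by simp
  have "(\<lambda>x. c * \<phi> x) differentiable_on UNIV"
    unfolding differentiable_on_def differentiable_def using d by auto
  then show "test_function \<Omega> (\<lambda>x. c * \<phi> x)"
    using assms unfolding test_function_def p
    by (auto intro!: continuous_intros)
qed

text \<open>On a set of finite measure |u| is dominated by the integrable function 1 +
  |u|^2.\<close>

lemma set_integrable_L2:
  assumes "L2 \<Omega> u" "\<Omega> \<in> sets lborel" "emeasure lborel \<Omega> < \<infinity>"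
  shows "set_integrable lborel \<Omega> u"
proof -
  have 1: "integrable lborel (\<lambda>x. indicator \<Omega> x + indicator \<Omega> x *\<^sub>R (cmod (u x))\<^sup>2 :: real)"
    using assms by (auto simp: L2_def set_integrable_def intro!: Bochner_Integration.integrable_add)
  have m: "(\<lambda>x. indicator \<Omega> x *\<^sub>R u x) \<in> borel_measurable lborel"
    using assms by (auto simp: L2_def set_borel_measurable_def)
  have "t \<le> 1 + t\<^sup>2" for t :: real
    using zero_le_power2[of "t - 1/2"] by (simp add: power2_eq_square algebra_simps)
  then have "norm (indicator \<Omega> x *\<^sub>R u x) \<le> norm (indicator \<Omega> x + indicator \<Omega> x *\<^sub>R (cmod (u x))\<^sup>2 :: real)" for x
    by (auto simp: indicator_def)
  then show ?thesis
    unfolding set_integrable_def by (intro Bochner_Integration.integrable_bound[OF 1 m]) auto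
qed

lemma set_integrable_mult_bounded:
  fixes f g :: "'a::euclidean_space \<Rightarrow> complex"
  assumes "set_integrable lborel \<Omega> f" "g \<in> borel_measurable borel" "\<And>x. norm (g x) \<le> B"
  shows "set_integrable lborel \<Omega> (\<lambda>x. f x * g x)"
  unfolding set_integrable_def
proof (rule Bochner_Integration.integrable_bound)
  show "integrable lborel (\<lambda>x. B * norm (indicator \<Omega> x *\<^sub>R f x))"
    using assms(1) unfolding set_integrable_def by (intro integrable_mult_right integrable_norm)
  have "(\<lambda>x. (indicator \<Omega> x *\<^sub>R f x) * g x) \<in> borel_measurable lborel"
    using assms(1,2) unfolding set_integrable_def by (intro borel_measurable_times) (auto dest: borel_measurable_integrable)
  then show "(\<lambda>x. indicator \<Omega> x *\<^sub>R (f x * g x)) \<in> borel_measurable lborel"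
    by (simp add: scaleR_conv_of_real mult.assoc)
  have B: "0 \<le> B" using assms(3) norm_ge_zero order_trans by blast
  have "norm (indicator \<Omega> x *\<^sub>R (f x * g x)) \<le> norm (B * norm (indicator \<Omega> x *\<^sub>R f x))" for x
    using mult_right_mono[OF assms(3)[of x] norm_ge_zero[of "f x"]] B
    by (auto simp: indicator_def norm_mult mult.commute)
  then show "AE x in lborel. norm (indicator \<Omega> x *\<^sub>R (f x * g x)) \<le> norm (B * norm (indicator \<Omega> x *\<^sub>R f x))"
    by simp
qed

lemma set_integrable_mult_test_function:
  assumes "set_integrable lborel \<Omega> f" "test_function \<Omega>' \<phi>"
  shows "set_integrable lborel \<Omega> (\<lambda>x. f x * \<phi> x)"
    and "i \<in> Basis \<Longrightarrow> set_integrable lborel \<Omega> (\<lambda>x. f x * partial_deriv i \<phi> x)"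
proof -
  obtain K where K: "compact K" "\<And>x. x \<notin> K \<Longrightarrow> \<phi> x = 0" "\<And>i x. x \<notin> K \<Longrightarrow> partial_deriv i \<phi> x = 0"
    using test_functionE[OF assms(2)] by metis
  have *: "set_integrable lborel \<Omega> (\<lambda>x. f x * \<psi> x)"
    if c: "continuous_on UNIV \<psi>" and z: "\<And>x. x \<notin> K \<Longrightarrow> \<psi> x = 0" for \<psi> :: "'a \<Rightarrow> complex"
  proof -
    obtain B where "\<And>x. norm (\<psi> x) \<le> B"
      using bounded_if_compact_support[OF c K(1) z] by blast
    then show ?thesis
      using assms(1) borel_measurable_continuous_onI[OF c]
      by (intro set_integrable_mult_bounded) auto
  qed
  show "set_integrable lborel \<Omega> (\<lambda>x. f x * \<phi> x)"
    using test_function_continuous[OF assms(2)] K by (intro *) auto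
  show "set_integrable lborel \<Omega> (\<lambda>x. f x * partial_deriv i \<phi> x)" if "i \<in> Basis"
    using assms(2) that K by (intro *) (auto simp: test_function_def)
qed

text \<open>The product of \<open>u\<close> with a test function is a test function on the whole
  space, so its partial derivative integrates to zero; the Leibniz rule splits this integral into
  the two sides.\<close>

lemma weak_deriv_classical:
  fixes u :: "'a::euclidean_space \<Rightarrow> complex"
  assumes \<Omega>: "open \<Omega>" "emeasure lborel \<Omega> < \<infinity>"
    and u: "\<And>x. x \<in> \<Omega> \<Longrightarrow> u differentiable (at x)"
      "\<And>i. i \<in> Basis \<Longrightarrow> continuous_on \<Omega> (partial_deriv i u)"
    and L: "L2 \<Omega> u" "L2 \<Omega> (partial_deriv i u)" and i: "i \<in> Basis"
  shows "is_L2_weak_deriv \<Omega> i u (partial_deriv i u)"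
  unfolding is_L2_weak_deriv_def
proof (intro conjI allI impI)
  fix \<phi> :: "'a \<Rightarrow> complex" assume \<phi>: "test_function \<Omega> \<phi>"
  have si: "set_integrable lborel \<Omega> u" "set_integrable lborel \<Omega> (partial_deriv i u)"
    using L \<Omega> by (auto intro: set_integrable_L2)
  note m = test_function_mult[OF \<Omega>(1) \<phi> u]
  have "0 = (LINT x|lborel. partial_deriv i (\<lambda>x. u x * \<phi> x) x)"
    using integral_partial_deriv_eq_0[OF test_function_mono[OF m(1)] i] by simp
  also have "\<dots> = (LINT x:\<Omega>|lborel. u x * partial_deriv i \<phi> x + partial_deriv i u x * \<phi> x)"
    unfolding set_lebesgue_integral_def
  proof (rule Bochner_Integration.integral_cong)
    show "partial_deriv i (\<lambda>x. u x * \<phi> x) x =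
        indicator \<Omega> x *\<^sub>R (u x * partial_deriv i \<phi> x + partial_deriv i u x * \<phi> x)" for x
      using m(2)[of x i] m(3)[of x i] by (cases "x \<in> \<Omega>") auto
  qed simp
  also have "\<dots> = (LINT x:\<Omega>|lborel. u x * partial_deriv i \<phi> x) + (LINT x:\<Omega>|lborel. partial_deriv i u x * \<phi> x)"
    using si \<phi> i by (intro set_integral_add set_integrable_mult_test_function)
  finally show "(LINT x:\<Omega>|lborel. u x * partial_deriv i \<phi> x) = - (LINT x:\<Omega>|lborel. partial_deriv i u x * \<phi> x)"
    by (simp add: eq_neg_iff_add_eq_0)
qed (rule L(2))

section \<open>The fundamental lemma of the calculus of variations\<close>

text \<open>The squared positive part is C^1 on the line, which is all the smoothness a test
  function must have. Composing it with 1 - |x - c|^2 / \<rho>^2 gives a bump whose positivity set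
  is exactly the ball.\<close>

lemma test_function_ball:
  fixes c :: "'a::euclidean_space"
  assumes "0 < \<rho>" "cball c \<rho> \<subseteq> \<Omega>"
  obtains f :: "'a \<Rightarrow> real" where "test_function \<Omega> (\<lambda>x. of_real (f x))"
    "\<And>x. 0 \<le> f x" "\<And>x. f x \<le> 1" "{x. 0 < f x} = ball c \<rho>"
proof -
  define m where "m = (\<lambda>s::real. (max 0 s)\<^sup>2)"
  have m': "(m has_real_derivative 2 * max 0 s) (at s)" for s
  proof (cases s "0::real" rule: linorder_cases)
    case less
    have "((\<lambda>_. 0) has_real_derivative 2 * max 0 s) (at s)" using less by simp
    then show ?thesis
      by (rule has_field_derivative_transform_within_open[of _ _ _ "{..<0}"])
         (use less in \<open>auto simp: m_def\<close>)
  next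
    case equal
    have "((\<lambda>h. max 0 h) \<longlongrightarrow> max 0 (0::real)) (at 0)"
      by (intro tendsto_intros)
    then have "((\<lambda>h. (m (0 + h) - m 0) / h) \<longlongrightarrow> max 0 0) (at 0)"
      by (rule Lim_transform_eventually) (auto simp: eventually_at_filter m_def max_def power2_eq_square)
    then show ?thesis
      using equal by (simp add: DERIV_def)
  next
    case greater
    have "((\<lambda>s. s\<^sup>2) has_real_derivative 2 * max 0 s) (at s)"
      using greater by (auto intro!: derivative_eq_intros)
    then show ?thesis
      by (rule has_field_derivative_transform_within_open[of _ _ _ "{0<..}"])
         (use greater in \<open>auto simp: m_def\<close>)
  qed
  have mpos: "0 < m s \<longleftrightarrow> 0 < s" for s by (auto simp: m_def max_def)
  define k where "k = 1 / \<rho>\<^sup>2"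
  define g where "g = (\<lambda>x. 1 - k * ((x - c) \<bullet> (x - c)))"
  define f where "f = (\<lambda>x. m (g x))"
  have g': "(g has_derivative (\<lambda>h. - (k * (2 * ((x - c) \<bullet> h))))) (at x)" for x
    unfolding g_def by (auto intro!: derivative_eq_intros simp: inner_commute)
  have f': "(f has_derivative (\<lambda>h. - (k * (2 * ((x - c) \<bullet> h))) * (2 * max 0 (g x)))) (at x)" for x
    unfolding f_def by (rule DERIV_compose_FDERIV[OF m' g'])
  have d: "((\<lambda>x. of_real (f x) :: complex) has_derivative
      (\<lambda>h. of_real (- (k * (2 * ((x - c) \<bullet> h))) * (2 * max 0 (g x))))) (at x)" for x
    by (rule has_derivative_of_real[OF f'])
  have cg: "continuous_on UNIV g" unfolding g_def by (intro continuous_intros)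
  have gle: "g x \<le> 1" for x by (simp add: g_def k_def)
  have gpos: "0 < g x \<longleftrightarrow> x \<in> ball c \<rho>" for x
  proof -
    have "0 < g x \<longleftrightarrow> (norm (x - c))\<^sup>2 < \<rho>\<^sup>2"
      using assms(1) by (simp add: g_def k_def divide_simps flip: power2_norm_eq_inner)
    also have "\<dots> \<longleftrightarrow> norm (x - c) < \<rho>"
      using assms(1) by (smt (verit) norm_ge_zero power2_le_imp_le power_mono)
    finally show ?thesis by (simp add: dist_norm norm_minus_commute)
  qed
  show thesis
  proof (rule that)
    show "test_function \<Omega> (\<lambda>x. of_real (f x))"
      unfolding test_function_def
    proof (intro conjI ballI exI[of _ "cball c \<rho>"] allI impI)
      show "(\<lambda>x. complex_of_real (f x)) differentiable_on UNIV"
        using d unfolding differentiable_on_def differentiable_def by auto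
      show "continuous_on UNIV (partial_deriv i (\<lambda>x. complex_of_real (f x)))" for i
      proof -
        have "partial_deriv i (\<lambda>x. complex_of_real (f x)) =
            (\<lambda>x. of_real (- (k * (2 * ((x - c) \<bullet> i))) * (2 * max 0 (g x))))"
          using partial_deriv_eq[OF d] by blast
        then show ?thesis using assms cg by (auto intro!: continuous_intros)
      qed
      show "complex_of_real (f x) = 0" if "x \<notin> cball c \<rho>" for x
        using that gpos[of x] by (auto simp: f_def m_def max_def)
    qed (use assms in auto)
    show "{x. 0 < f x} = ball c \<rho>"
      using gpos mpos by (auto simp: f_def)
    show "f x \<le> 1" for x
      using gle[of x] by (auto simp: f_def m_def max_def power_le_one)
  qed (simp add: f_def m_def)
qed

text \<open>For a test function f with values in [0, 1], the functions 1 - (1 - f)^k increase to the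
  indicator of {f > 0}, so \<open>d\<close> integrates to zero over every such positivity set. These
  sets are closed under finite unions and contain all small balls, and by the Lindelof property
  countably many of them exhaust \<open>U\<close>.\<close>

lemma set_integral_open_eq_0:
  fixes d :: "'a::euclidean_space \<Rightarrow> complex"
  assumes d: "set_integrable lborel \<Omega> d"
    and 0: "\<And>\<phi>. test_function \<Omega> \<phi> \<Longrightarrow> (LINT x:\<Omega>|lborel. d x * \<phi> x) = 0"
    and U: "open U" "U \<subseteq> \<Omega>"
  shows "(LINT x:U|lborel. d x) = 0"
proof -
  define d' where "d' = (\<lambda>x. indicator \<Omega> x *\<^sub>R d x)"
  have d': "integrable lborel d'" using d by (simp add: d'_def set_integrable_def)
  have 0: "(LINT x|lborel. d' x * \<phi> x) = 0" if "test_function \<Omega> \<phi>" for \<phi>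
    using 0[OF that] by (simp add: set_lebesgue_integral_def d'_def)
  define T where "T = {f :: 'a \<Rightarrow> real. test_function \<Omega> (\<lambda>x. of_real (f x)) \<and> (\<forall>x. 0 \<le> f x \<and> f x \<le> 1)}"
  have diff: "(\<lambda>x. of_real (f x) :: complex) differentiable (at x)"
    "i \<in> Basis \<Longrightarrow> continuous_on \<Omega> (partial_deriv i (\<lambda>x. of_real (f x)))" if "f \<in> T" for f i x
    using that test_function_differentiable continuous_on_subset[OF _ subset_UNIV]
    unfolding T_def test_function_def by (blast intro: test_function_differentiable, blast)
  \<comment> \<open>This combination stays in [0, 1] and is positive exactly where \<open>f\<close>
    or \<open>g\<close> is. Iterated with \<open>f\<close> itself it produces the powers 1 - (1 -
    f)^k.\<close>
  have tn: "(\<lambda>x. 1 - (1 - f x) * (1 - g x)) \<in> T" if f: "f \<in> T" and g: "g \<in> T" for f g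
  proof -
    have f1: "test_function UNIV (\<lambda>x. of_real (f x))" and g1: "test_function \<Omega> (\<lambda>x. of_real (g x))"
      "test_function UNIV (\<lambda>x. of_real (g x))" "test_function \<Omega> (\<lambda>x. of_real (f x))"
      using f g by (auto simp: T_def intro: test_function_mono)
    obtain K where K: "compact K" "K \<subseteq> \<Omega>" "\<And>x. x \<notin> K \<Longrightarrow> complex_of_real (g x) = 0"
      using test_functionE[OF g1(1)] by metis
    have "test_function UNIV (\<lambda>x. of_real (f x) * of_real (g x) :: complex)"
      using g1 f1 by (intro test_function_mult(1)) (auto simp: test_function_def intro: test_function_differentiable[OF f1])
    then have "test_function \<Omega> (\<lambda>x. of_real (f x) * of_real (g x) :: complex)"
      unfolding test_function_def using K by (metis mult_zero_right)
    then have "test_function \<Omega> (\<lambda>x. of_real (f x) + of_real (g x) + (- 1) * (of_real (f x) * of_real (g x)))"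
      using g1 by (intro test_function_add test_function_cmult)
    also have "(\<lambda>x. of_real (f x) + of_real (g x) + (- 1) * (of_real (f x) * of_real (g x))) =
       (\<lambda>x. complex_of_real (1 - (1 - f x) * (1 - g x)))"
      by (auto simp: algebra_simps)
    finally show ?thesis
      using f g by (auto simp: T_def mult_le_one)
  qed
  have pos: "(LINT x|lborel. indicator {x. 0 < f x} x *\<^sub>R d' x) = 0" if f: "f \<in> T" for f
  proof -
    have fk: "(\<lambda>x. 1 - (1 - f x) ^ Suc k) \<in> T" for k
    proof (induction k)
      case (Suc k)
      from tn[OF f this] show ?case by simp
    qed (use f in simp)
    have fc: "continuous_on UNIV f"
      using f test_function_continuous[of \<Omega> "\<lambda>x. of_real (f x)"] by (auto simp: T_def)
    then have fm: "f \<in> borel_measurable borel"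
      by (rule borel_measurable_continuous_onI)
    have "(\<lambda>k. LINT x|lborel. d' x * of_real (1 - (1 - f x) ^ Suc k)) \<longlonglongrightarrow>
        (LINT x|lborel. indicator {x. 0 < f x} x *\<^sub>R d' x)"
    proof (rule integral_dominated_convergence[where w = "\<lambda>x. norm (d' x)"])
      have *: "d' \<in> borel_measurable lborel" using d' by auto
      show "(\<lambda>x. indicator {x. 0 < f x} x *\<^sub>R d' x) \<in> borel_measurable lborel"
        "(\<lambda>x. d' x * of_real (1 - (1 - f x) ^ Suc k)) \<in> borel_measurable lborel" for k
        using * fm by auto
      have f01: "0 \<le> f x" "f x \<le> 1" for x using f by (auto simp: T_def)
      show "AE x in lborel. (\<lambda>k. d' x * of_real (1 - (1 - f x) ^ Suc k)) \<longlonglongrightarrow> indicator {x. 0 < f x} x *\<^sub>R d' x"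
      proof (rule AE_I2)
        fix x
        have "(\<lambda>k. 1 - (1 - f x) ^ Suc k) \<longlonglongrightarrow> indicator {x. 0 < f x} x"
        proof (cases "0 < f x")
          case True
          then have "(\<lambda>k. (1 - f x) ^ k) \<longlonglongrightarrow> 0" using f01[of x] by (intro LIMSEQ_power_zero) auto
          from tendsto_diff[OF tendsto_const LIMSEQ_Suc[OF this], of 1] show ?thesis using True by simp
        next
          case False
          then have "f x = 0" using f01[of x] by simp
          then show ?thesis by simp
        qed
        from tendsto_mult[OF tendsto_const tendsto_of_real[OF this], of "d' x"]
        show "(\<lambda>k. d' x * of_real (1 - (1 - f x) ^ Suc k)) \<longlonglongrightarrow> indicator {x. 0 < f x} x *\<^sub>R d' x"
          by (simp add: scaleR_conv_of_real mult.commute)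
      qed
      show "AE x in lborel. norm (d' x * of_real (1 - (1 - f x) ^ Suc k)) \<le> norm (d' x)" for k
      proof (rule AE_I2)
        fix x
        have "0 \<le> 1 - (1 - f x) ^ Suc k" "1 - (1 - f x) ^ Suc k \<le> 1"
          using fk[of k] by (auto simp: T_def)
        then have "cmod (of_real (1 - (1 - f x) ^ Suc k)) \<le> 1" unfolding norm_of_real by linarith
        then show "norm (d' x * of_real (1 - (1 - f x) ^ Suc k)) \<le> norm (d' x)"
          unfolding norm_mult by (metis mult_left_le norm_ge_zero)
      qed
    qed (use d' in auto)
    moreover have "(LINT x|lborel. d' x * of_real (1 - (1 - f x) ^ Suc k)) = 0" for k
      using fk[of k] unfolding T_def by (intro 0) blast
    ultimately show ?thesis by (simp only: LIMSEQ_const_iff)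
  qed
  define \<F> where "\<F> = {{x. 0 < f x} | f. f \<in> T \<and> {x. 0 < f x} \<subseteq> U}"
  have "\<exists>S\<in>\<F>. x \<in> S" if x: "x \<in> U" for x
  proof -
    obtain \<rho> where \<rho>: "0 < \<rho>" "cball x \<rho> \<subseteq> U" using U(1) x open_contains_cball by blast
    then obtain f where "test_function \<Omega> (\<lambda>x. of_real (f x))"
      "\<And>x. 0 \<le> f x" "\<And>x. f x \<le> 1" "{x. 0 < f x} = ball x \<rho>"
      using test_function_ball[OF \<rho>(1), of x \<Omega>] U(2) by (metis subset_trans)
    moreover have "ball x \<rho> \<subseteq> U" using \<rho>(2) ball_subset_cball by blast
    ultimately show ?thesis using \<rho>(1) unfolding \<F>_def T_def by (intro bexI[of _ "ball x \<rho>"]) (auto intro!: exI[of _ f])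
  qed
  then have UF: "U = \<Union>\<F>" by (auto simp: \<F>_def)
  have op: "open S" if S: "S \<in> \<F>" for S
  proof -
    obtain f where f: "f \<in> T" "S = {x. 0 < f x}" using S by (auto simp: \<F>_def)
    have "continuous_on UNIV f"
      using f(1) test_function_continuous[of \<Omega> "\<lambda>x. of_real (f x)"] by (auto simp: T_def)
    then show ?thesis
      unfolding f(2) by (intro open_Collect_less) auto
  qed
  obtain \<G> where G: "\<G> \<subseteq> \<F>" "countable \<G>" "\<Union>\<G> = \<Union>\<F>"
    using Lindelof[of \<F>] op by blast
  show ?thesis
  proof (cases "U = {}")
    case False
    then have "\<G> \<noteq> {}" using G UF by auto
    then obtain S where S: "\<G> = range (S :: nat \<Rightarrow> 'a set)"
      using range_from_nat_into[OF _ G(2)] by metis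
    \<comment> \<open>Finite unions are again positivity sets of members of \<open>T\<close>, so the
      integral over each \<open>V n\<close> vanishes; the sets increase to \<open>U\<close>.\<close>
    define V where "V = (\<lambda>n. \<Union>k\<le>n. S k)"
    have "\<exists>f\<in>T. V n = {x. 0 < f x}" for n
    proof (induction n)
      case 0
      have "S 0 \<in> \<F>" using G(1) S by blast
      then show ?case by (auto simp: \<F>_def V_def)
    next
      case (Suc n)
      then obtain f where f: "f \<in> T" "V n = {x. 0 < f x}" by blast
      have "S (Suc n) \<in> \<F>" using G(1) S by blast
      then obtain g where g: "g \<in> T" "S (Suc n) = {x. 0 < g x}" by (auto simp: \<F>_def)
      have "0 < 1 - (1 - f x) * (1 - g x) \<longleftrightarrow> 0 < f x \<or> 0 < g x" for x
      proof -
        have "0 \<le> f x" "f x \<le> 1" "0 \<le> g x" "g x \<le> 1" using f g by (auto simp: T_def)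
        then show ?thesis
          by (smt (verit) mult_le_one mult_left_le mult_nonneg_nonneg mult_right_le_one_le mult_cancel_left1)
      qed
      then have "V (Suc n) = {x. 0 < 1 - (1 - f x) * (1 - g x)}"
        using f(2) g(2) by (auto simp: V_def atMost_Suc)
      then show ?case using tn[OF f(1) g(1)] by (rule bexI)
    qed
    then have V0: "(LINT x|lborel. indicator (V n) x *\<^sub>R d' x) = 0" for n
      using pos by metis
    have "(\<Union>n. V n) = (\<Union>n. S n)" by (fastforce simp: V_def)
    then have VU: "(\<Union>n. V n) = U" using UF G S by simp
    have Vm: "V n \<in> sets borel" for n
      using G(1) S op by (auto simp: V_def intro!: borel_open)
    have "(\<lambda>n. LINT x|lborel. indicator (V n) x *\<^sub>R d' x) \<longlonglongrightarrow> (LINT x|lborel. indicator U x *\<^sub>R d' x)"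
    proof (rule integral_dominated_convergence[where w = "\<lambda>x. norm (d' x)"])
      have *: "d' \<in> borel_measurable lborel" using d' by auto
      show "(\<lambda>x. indicator U x *\<^sub>R d' x) \<in> borel_measurable lborel"
        "(\<lambda>x. indicator (V n) x *\<^sub>R d' x) \<in> borel_measurable lborel" for n
        using * Vm U(1) by auto
      have inc: "incseq V"
        unfolding V_def incseq_def using order_trans by fastforce
      show "AE x in lborel. (\<lambda>n. indicator (V n) x *\<^sub>R d' x) \<longlonglongrightarrow> indicator U x *\<^sub>R d' x"
        by (intro AE_I2 tendsto_scaleR tendsto_const LIMSEQ_indicator_incseq[OF inc, unfolded VU])
    qed (use d' in \<open>auto simp: indicator_def\<close>)
    then have "(LINT x|lborel. indicator U x *\<^sub>R d' x) = 0"
      by (simp add: V0 LIMSEQ_const_iff)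
    moreover have "indicator U x *\<^sub>R d' x = indicator U x *\<^sub>R d x" for x
      using U(2) by (auto simp: d'_def indicator_def)
    ultimately show ?thesis by (simp add: set_lebesgue_integral_def)
  qed (simp add: set_lebesgue_integral_def)
qed

text \<open>The integral of \<open>d\<close> vanishes over open sets. Open sets are stable under
  intersection and generate the Borel sets, so disjoint-union induction gives vanishing over all
  Borel sets, and a density with this property is zero almost everywhere.\<close>

lemma fundamental_lemma:
  fixes d :: "'a::euclidean_space \<Rightarrow> complex"
  assumes \<Omega>: "open \<Omega>" and d: "set_integrable lborel \<Omega> d"
    and 0: "\<And>\<phi>. test_function \<Omega> \<phi> \<Longrightarrow> (LINT x:\<Omega>|lborel. d x * \<phi> x) = 0"
  shows "AE x in lborel. x \<in> \<Omega> \<longrightarrow> d x = 0"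
proof -
  define d' where "d' = (\<lambda>x. indicator \<Omega> x *\<^sub>R d x)"
  have d': "integrable lborel d'" using d by (simp add: d'_def set_integrable_def)
  have d's: "set_integrable lborel A d'" if "A \<in> sets lborel" for A
    using d' that unfolding set_integrable_def by (intro integrable_mult_indicator)
  have op: "(LINT x:U|lborel. d' x) = 0" if "open U" for U
  proof -
    have "(LINT x:U|lborel. d' x) = (LINT x:(U \<inter> \<Omega>)|lborel. d x)"
      unfolding set_lebesgue_integral_def d'_def
      by (intro Bochner_Integration.integral_cong) (auto simp: indicator_def)
    also have "\<dots> = 0" using that \<Omega> by (intro set_integral_open_eq_0[OF d 0]) auto
    finally show ?thesis .
  qed
  have tot: "(LINT x|lborel. d' x) = 0"
    using op[of UNIV] by (simp add: set_lebesgue_integral_def)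
  have "(LINT x:A|lborel. d' x) = 0" if "A \<in> sets lborel" for A
  proof -
    have *: "Int_stable {S. open (S :: 'a set)}" "{S. open (S :: 'a set)} \<subseteq> Pow UNIV"
      by (auto simp: Int_stable_def)
    have "A \<in> sigma_sets UNIV {S. open S}" using that by (simp add: borel_def)
    with * show ?thesis
    proof (induction rule: sigma_sets_induct_disjoint)
      case (compl A)
      then have A: "A \<in> sets lborel" by (simp add: borel_def)
      have "(LINT x:UNIV|lborel. d' x) = (LINT x:(UNIV - A)|lborel. d' x) + (LINT x:A|lborel. d' x)"
        using set_integral_Un[of "UNIV - A" A lborel d'] d's[of A] d's[of "UNIV - A"] A by (simp add: Un_commute Int_commute)
      then show ?case using compl tot by (simp add: set_lebesgue_integral_def)
    next
      case (union A)
      then have "range A \<subseteq> sets lborel" by (simp add: borel_def)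
      then have "(LINT x:(\<Union>i. A i)|lborel. d' x) = (\<Sum>i. LINT x:A i|lborel. d' x)"
        using union(1) d's by (intro lebesgue_integral_countable_add) (auto simp: disjoint_family_on_def)
      then show ?case using union by simp
    qed (use op in \<open>auto simp: set_lebesgue_integral_def\<close>)
  qed
  then have "AE x in lborel. d' x = 0"
    by (intro sigma_finite_measure.density_zero[OF sigma_finite_lborel d'])
  then show ?thesis
    by eventually_elim (auto simp: d'_def)
qed

lemma weak_deriv_unique:
  assumes \<Omega>: "open \<Omega>" "emeasure lborel \<Omega> < \<infinity>"
    and "is_L2_weak_deriv \<Omega> i u g" "is_L2_weak_deriv \<Omega> i u h"
  shows "AE x in lborel. x \<in> \<Omega> \<longrightarrow> g x = h x"
proof -
  have si: "set_integrable lborel \<Omega> g" "set_integrable lborel \<Omega> h"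
    using assms by (auto simp: is_L2_weak_deriv_def intro!: set_integrable_L2)
  have "AE x in lborel. x \<in> \<Omega> \<longrightarrow> g x - h x = 0"
  proof (rule fundamental_lemma[OF \<Omega>(1)])
    fix \<phi> assume \<phi>: "test_function \<Omega> \<phi>"
    have "(LINT x:\<Omega>|lborel. (g x - h x) * \<phi> x) =
        (LINT x:\<Omega>|lborel. g x * \<phi> x) - (LINT x:\<Omega>|lborel. h x * \<phi> x)"
      using si \<phi> unfolding left_diff_distrib
      by (intro set_integral_diff set_integrable_mult_test_function)
    moreover have "- (LINT x:\<Omega>|lborel. g x * \<phi> x) = - (LINT x:\<Omega>|lborel. h x * \<phi> x)"
      using assms(3,4) \<phi> unfolding is_L2_weak_deriv_def by simp
    ultimately show "(LINT x:\<Omega>|lborel. (g x - h x) * \<phi> x) = 0" by simp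
  qed (rule set_integral_diff(1)[OF si])
  then show ?thesis by eventually_elim auto
qed

text \<open>\<open>weak_deriv\<close> is an arbitrary choice; this is how it gets replaced by a
  concrete derivative inside integrals.\<close>

lemma weak_deriv_AE_eq:
  assumes "open \<Omega>" "emeasure lborel \<Omega> < \<infinity>" "is_L2_weak_deriv \<Omega> i u g"
  shows "AE x in lborel. x \<in> \<Omega> \<longrightarrow> weak_deriv \<Omega> i u x = g x"
  using assms someI[of "is_L2_weak_deriv \<Omega> i u", OF assms(3)] unfolding weak_deriv_def
  by (intro weak_deriv_unique[of \<Omega> i u])

section \<open>One-dimensional Sobolev functions\<close>

lemma set_borel_measurable_mult:
  fixes f g :: "'a \<Rightarrow> 'b::{real_normed_algebra, second_countable_topology}"
  assumes "set_borel_measurable M A f" "set_borel_measurable M A g"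
  shows "set_borel_measurable M A (\<lambda>x. f x * g x)"
proof -
  have "(\<lambda>x. (indicator A x *\<^sub>R f x) * (indicator A x *\<^sub>R g x)) \<in> borel_measurable M"
    using assms unfolding set_borel_measurable_def by (rule borel_measurable_times)
  also have "(\<lambda>x. (indicator A x *\<^sub>R f x) * (indicator A x *\<^sub>R g x)) = (\<lambda>x. indicator A x *\<^sub>R (f x * g x))"
    by (auto simp: indicator_def)
  finally show ?thesis by (simp add: set_borel_measurable_def)
qed

lemma set_integral_cong_AE_borel:
  assumes "set_borel_measurable M A f" "set_borel_measurable M A g" "AE x in M. x \<in> A \<longrightarrow> f x = g x"
  shows "(LINT x:A|M. f x) = (LINT x:A|M. g x)"
  unfolding set_lebesgue_integral_def
proof (rule integral_cong_AE)
  show "AE x in M. indicator A x *\<^sub>R f x = indicator A x *\<^sub>R g x"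
    using assms(3) by eventually_elim (auto simp: indicator_def)
qed (use assms in \<open>auto simp: set_borel_measurable_def\<close>)

section \<open>Primitives of integrable functions and integration by parts on an interval\<close>

lemma integrable_product_lborel:
  fixes f g :: "real \<Rightarrow> complex"
  assumes "integrable lborel f" "integrable lborel g"
  shows "integrable (lborel \<Otimes>\<^sub>M lborel) (\<lambda>(x, y). f x * g y)"
proof (rule lborel_pair.Fubini_integrable)
  have [measurable]: "f \<in> borel_measurable borel" "g \<in> borel_measurable borel"
    using assms by (auto dest: borel_measurable_integrable)
  show "(\<lambda>(x, y). f x * g y) \<in> borel_measurable (lborel \<Otimes>\<^sub>M lborel)" by measurable
  have "integrable lborel (\<lambda>x. norm (f x) * (LINT y|lborel. norm (g y)))"
    using assms by (intro integrable_mult_left) auto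
  then show "integrable lborel (\<lambda>x. LINT y|lborel. norm (case (x, y) of (x, y) \<Rightarrow> f x * g y))"
    by (simp add: norm_mult)
  show "AE x in lborel. integrable lborel (\<lambda>y. case (x, y) of (x, y) \<Rightarrow> f x * g y)"
    using assms by auto
qed

text \<open>The integral starts at minus infinity. It is applied to functions that vanish to the
  left of some point, where it is the usual primitive.\<close>

definition primitive :: "(real \<Rightarrow> complex) \<Rightarrow> real \<Rightarrow> complex" where
  "primitive f x = (LINT t|lborel. indicator {..x} t *\<^sub>R f t)"

lemma primitive_eq_integral:
  assumes f: "integrable lborel f" and "\<And>t. t < a \<Longrightarrow> f t = 0"
  shows "primitive f x = integral {a..x} f"
proof -
  have "primitive f x = (LINT t:{a..x}|lborel. f t)"
    unfolding primitive_def set_lebesgue_integral_def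
    by (rule Bochner_Integration.integral_cong) (use assms(2) in \<open>auto simp: indicator_def not_le[symmetric]\<close>)
  also have "\<dots> = integral {a..x} f"
    by (rule set_borel_integral_eq_integral)
       (use integrable_mult_indicator[OF _ f, of "{a..x}"] in \<open>auto simp: set_integrable_def\<close>)
  finally show ?thesis .
qed

lemma continuous_on_primitive:
  assumes f: "integrable lborel f" and "\<And>t. t < a \<Longrightarrow> f t = 0"
  shows "continuous_on {a..b} (primitive f)"
proof -
  have "f integrable_on {a..b}"
    using f integrable_mult_indicator[of "{a..b}" lborel f]
    by (intro set_borel_integral_eq_integral) (auto simp: set_integrable_def)
  then have "continuous_on {a..b} (\<lambda>x. integral {a..x} f)"
    by (rule indefinite_integral_continuous_1)
  then show ?thesis using primitive_eq_integral[OF assms] by simp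
qed

text \<open>Since \<open>g\<close> is merely integrable, the product rule is replaced by Fubini's
  theorem for g(t) \<psi>'(s) on the half-plane t \<le> s. There is no boundary term at
  \<open>a\<close> because the primitive vanishes there.\<close>

lemma primitive_by_parts:
  fixes g \<psi> :: "real \<Rightarrow> complex"
  assumes ab: "a < b" and g: "integrable lborel g" "\<And>t. t \<notin> {a<..<b} \<Longrightarrow> g t = 0"
    and \<psi>: "\<And>x. x \<in> {a..b} \<Longrightarrow> (\<psi> has_vector_derivative \<psi>' x) (at x within {a..b})"
      "continuous_on {a..b} \<psi>'"
  shows "(LINT x|lborel. g x * \<psi> x) + (LINT x:{a<..<b}|lborel. primitive g x * \<psi>' x) = primitive g b * \<psi> b"
proof -
  define h where "h = (\<lambda>x. indicator {a..b} x *\<^sub>R \<psi>' x)"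
  have h: "integrable lborel h"
    unfolding h_def by (rule borel_integrable_compact) (use \<psi> in auto)
  have [measurable]: "g \<in> borel_measurable borel" "h \<in> borel_measurable borel"
    using g h by (auto dest: borel_measurable_integrable)
  have ftc: "(LINT s|lborel. indicator {t..} s *\<^sub>R h s) = \<psi> b - \<psi> t" if t: "t \<in> {a<..<b}" for t
  proof -
    have sub: "{t..b} \<subseteq> {a..b}" using t by auto
    have "(LINT s|lborel. indicator {t..} s *\<^sub>R h s) = (LINT s:{t..b}|lborel. \<psi>' s)"
      unfolding set_lebesgue_integral_def h_def
      by (rule Bochner_Integration.integral_cong) (use t in \<open>auto simp: indicator_def\<close>)
    also have "\<dots> = integral {t..b} \<psi>'"
      using continuous_on_subset[OF \<psi>(2) sub] unfolding set_integrable_def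
      by (intro set_borel_integral_eq_integral) (auto simp: set_integrable_def intro: borel_integrable_compact)
    also have "\<dots> = \<psi> b - \<psi> t"
    proof (rule integral_unique, rule fundamental_theorem_of_calculus)
      show "(\<psi> has_vector_derivative \<psi>' x) (at x within {t..b})" if "x \<in> {t..b}" for x
        using \<psi>(1)[of x] that sub has_vector_derivative_within_subset by blast
    qed (use t in auto)
    finally show ?thesis .
  qed
  \<comment> \<open>Integrating out \<open>t\<close> produces the primitive of \<open>g\<close> at
    s; integrating out \<open>s\<close> produces \<psi>(b) - \<psi>(t).\<close>
  define F where "F = (\<lambda>t s. indicator {(t, s). t \<le> s} (t, s) *\<^sub>R (g t * h s))"
  have ms: "{(t::real, s). t \<le> s} \<in> sets (lborel \<Otimes>\<^sub>M lborel)"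
  proof -
    have "{x :: real \<times> real. fst x \<le> snd x} \<in> sets borel"
      by (intro borel_closed closed_Collect_le continuous_intros)
    also have "{x :: real \<times> real. fst x \<le> snd x} = {(t, s). t \<le> s}" by auto
    finally show ?thesis unfolding lborel_prod by simp
  qed
  have Fi: "integrable (lborel \<Otimes>\<^sub>M lborel) (case_prod F)"
    using integrable_mult_indicator[OF ms integrable_product_lborel[OF g(1) h]]
    by (simp add: F_def case_prod_unfold)
  have "(LINT s|lborel. LINT t|lborel. F t s) = (LINT t|lborel. LINT s|lborel. F t s)"
    by (rule lborel_pair.Fubini_integral[OF Fi])
  moreover have "(LINT t|lborel. F t s) = indicator {a..b} s *\<^sub>R (primitive g s * \<psi>' s)" for s
  proof -
    have "F t s = (indicator {..s} t *\<^sub>R g t) * h s" for t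
      by (simp add: F_def indicator_def)
    then have "(LINT t|lborel. F t s) = primitive g s * h s"
      unfolding primitive_def by (simp only: integral_mult_left_zero)
    then show ?thesis by (simp add: h_def)
  qed
  moreover have "(LINT s|lborel. F t s) = g t * (\<psi> b - \<psi> t)" for t
  proof (cases "t \<in> {a<..<b}")
    case True
    have "F t s = g t * (indicator {t..} s *\<^sub>R h s)" for s
      by (simp add: F_def indicator_def)
    then have "(LINT s|lborel. F t s) = g t * (LINT s|lborel. indicator {t..} s *\<^sub>R h s)"
      by (simp only: integral_mult_right_zero)
    then show ?thesis by (simp only: ftc[OF True])
  next
    case False
    then show ?thesis using g(2) by (simp add: F_def)
  qed
  ultimately have "(LINT s:{a..b}|lborel. primitive g s * \<psi>' s) = (LINT t|lborel. g t * (\<psi> b - \<psi> t))"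
    by (simp add: set_lebesgue_integral_def)
  moreover have "(LINT s:{a..b}|lborel. primitive g s * \<psi>' s) = (LINT s:{a<..<b}|lborel. primitive g s * \<psi>' s)"
    unfolding set_lebesgue_integral_def
  proof (rule integral_cong_AE)
    have "continuous_on {a..b} (\<lambda>s. primitive g s * \<psi>' s)"
      using g \<psi> by (intro continuous_intros continuous_on_primitive) auto
    then have m: "set_borel_measurable lborel {a..b} (\<lambda>s. primitive g s * \<psi>' s)"
      unfolding set_borel_measurable_def
      using borel_measurable_continuous_on_indicator[of "{a..b}"] by simp
    then show "(\<lambda>x. indicator {a..b} x *\<^sub>R (primitive g x * \<psi>' x)) \<in> borel_measurable lborel"
      by (simp add: set_borel_measurable_def)
    show "(\<lambda>x. indicator {a<..<b} x *\<^sub>R (primitive g x * \<psi>' x)) \<in> borel_measurable lborel"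
    proof -
      have "{a<..<b} \<subseteq> {a..b}" by auto
      from set_borel_measurable_subset[OF m _ this] show ?thesis by (simp add: set_borel_measurable_def)
    qed
    have "AE x in lborel. x \<noteq> a \<and> x \<noteq> b"
      by (intro AE_conjI AE_lborel_singleton)
    then show "AE x in lborel. indicator {a..b} x *\<^sub>R (primitive g x * \<psi>' x) =
        indicator {a<..<b} x *\<^sub>R (primitive g x * \<psi>' x)"
      by eventually_elim (auto simp: indicator_def)
  qed
  moreover have "(LINT t|lborel. g t * (\<psi> b - \<psi> t)) = primitive g b * \<psi> b - (LINT t|lborel. g t * \<psi> t)"
  proof -
    have c\<psi>: "continuous_on {a..b} \<psi>"
      unfolding continuous_on_eq_continuous_within using has_vector_derivative_continuous[OF \<psi>(1)] by blast
    have "integrable lborel (\<lambda>x. indicator {a..b} x *\<^sub>R \<psi> x)"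
      by (rule borel_integrable_compact) (use c\<psi> in auto)
    then have [measurable]: "(\<lambda>x. indicator {a..b} x *\<^sub>R \<psi> x) \<in> borel_measurable borel"
      by (auto dest: borel_measurable_integrable)
    obtain B where B: "\<And>x. x \<in> {a..b} \<Longrightarrow> norm (\<psi> x) \<le> B"
      using compact_imp_bounded[OF compact_continuous_image[OF c\<psi> compact_Icc]]
      unfolding bounded_iff by blast
    have "integrable lborel (\<lambda>t. g t * \<psi> t)"
    proof (rule Bochner_Integration.integrable_bound)
      show "integrable lborel (\<lambda>t. g t * of_real B)" using g(1) by simp
      have "(\<lambda>t. g t * (indicator {a..b} t *\<^sub>R \<psi> t)) \<in> borel_measurable borel" by measurable
      also have "(\<lambda>t. g t * (indicator {a..b} t *\<^sub>R \<psi> t)) = (\<lambda>t. g t * \<psi> t)"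
        using g(2) by (auto simp: indicator_def fun_eq_iff)
      finally show "(\<lambda>t. g t * \<psi> t) \<in> borel_measurable lborel" by simp
      have "norm (g t * \<psi> t) \<le> norm (g t * of_real B)" for t
      proof (cases "t \<in> {a<..<b}")
        case True
        then have "norm (\<psi> t) \<le> \<bar>B\<bar>" using B[of t] by auto
        then show ?thesis by (simp add: norm_mult mult_left_mono)
      qed (simp add: g)
      then show "AE t in lborel. norm (g t * \<psi> t) \<le> norm (g t * of_real B)" by simp
    qed
    moreover have "primitive g b = (LINT t|lborel. g t)"
      unfolding primitive_def
      by (rule Bochner_Integration.integral_cong) (use g(2) in \<open>auto simp: indicator_def\<close>)
    ultimately show ?thesis using g(1) by (simp add: right_diff_distrib)
  qed
  ultimately show ?thesis by simp
qed

text \<open>The mean-zero condition makes the primitive vanish to the right of the support as well,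
  hence compactly supported.\<close>

lemma primitive_test_function:
  fixes f :: "real \<Rightarrow> complex"
  assumes f: "continuous_on UNIV f" and K: "compact K" "K \<subseteq> {a<..<b}" "\<And>x. x \<notin> K \<Longrightarrow> f x = 0"
    and 0: "(LINT x|lborel. f x) = 0"
  shows "test_function {a<..<b} (primitive f)" "partial_deriv 1 (primitive f) x = f x"
proof -
  have fi: "integrable lborel f" by (rule integrable_if_compact_support[OF f K(1,3)])
  obtain c d where cd: "a < c" "d < b" "K \<subseteq> {c..d}"
  proof (cases "K = {}")
    case True
    then show ?thesis using that[of "a+1" "b-1"] by simp
  next
    case False
    obtain c where "c \<in> K" "\<And>x. x \<in> K \<Longrightarrow> c \<le> x" using compact_attains_inf[OF K(1) False] by blast
    moreover obtain d where "d \<in> K" "\<And>x. x \<in> K \<Longrightarrow> x \<le> d" using compact_attains_sup[OF K(1) False] by blast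
    ultimately show ?thesis using K(2) that[of c d] by (auto simp: subset_eq)
  qed
  have f0: "f t = 0" if "t < c \<or> d < t" for t using K(3) cd(3) that by fastforce
  have der: "(primitive f has_vector_derivative f x) (at x)" for x
  proof -
    \<comment> \<open>Starting below both the support and \<open>x\<close> leaves the primitive
      unchanged and makes the interval from \<open>A\<close> to \<open>x + 1\<close> a two-sided
      neighbourhood of \<open>x\<close>.\<close>
    define A where "A = min c x - 1"
    have "((\<lambda>u. integral {A..u} f) has_vector_derivative f x) (at x within {A..x+1})"
      by (rule integral_has_vector_derivative) (use f in \<open>auto simp: A_def intro: continuous_on_subset\<close>)
    then have "((\<lambda>u. integral {A..u} f) has_vector_derivative f x) (at x)"
      by (simp add: at_within_Icc_at A_def)
    moreover have "primitive f = (\<lambda>u. integral {A..u} f)"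
      by (rule ext, rule primitive_eq_integral[OF fi]) (auto simp: A_def intro!: f0)
    ultimately show ?thesis by simp
  qed
  then have der': "(primitive f has_derivative (\<lambda>h. h *\<^sub>R f x)) (at x)" for x
    by (simp add: has_vector_derivative_def)
  have pd: "partial_deriv 1 (primitive f) = f"
    using partial_deriv_eq[OF der', of 1] by auto
  then show "partial_deriv 1 (primitive f) x = f x" by simp
  have "primitive f x = 0" if "x \<notin> {c..d}" for x
  proof (cases "x < c")
    case True
    then have "(\<lambda>t. indicator {..x} t *\<^sub>R f t) = (\<lambda>_. 0)" using f0 by (auto simp: indicator_def)
    then show ?thesis by (simp add: primitive_def)
  next
    case False
    then have "(\<lambda>t. indicator {..x} t *\<^sub>R f t) = f" using f0 that by (auto simp: indicator_def)
    then show ?thesis using 0 by (simp add: primitive_def)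
  qed
  moreover have "primitive f differentiable_on UNIV"
    unfolding differentiable_on_def differentiable_def using der' by auto
  ultimately show "test_function {a<..<b} (primitive f)"
    unfolding test_function_def using f cd by (auto simp: pd intro!: exI[of _ "{c..d}"])
qed

lemma test_function_has_vector_derivative:
  fixes \<phi> :: "real \<Rightarrow> complex"
  assumes "test_function \<Omega> \<phi>"
  shows "(\<phi> has_vector_derivative partial_deriv 1 \<phi> x) (at x within S)"
proof -
  note d = test_function_has_derivative[OF assms, of x]
  have "(\<lambda>h. partial_deriv h \<phi> x) = (\<lambda>h. h *\<^sub>R partial_deriv 1 \<phi> x)"
  proof
    fix h :: real
    from linear_scale[OF has_derivative_linear[OF d], of h 1]
    show "partial_deriv h \<phi> x = h *\<^sub>R partial_deriv 1 \<phi> x"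
      unfolding real_scaleR_def mult_1_right .
  qed
  with d show ?thesis
    unfolding has_vector_derivative_def by (metis has_derivative_at_withinI)
qed

text \<open>Derivatives of test functions are the test functions of mean zero. Subtracting a
  multiple of a fixed bump \<eta> from any test function gives it mean zero, so \<open>d\<close>
  minus its \<eta>-weighted average annihilates all test functions.\<close>

lemma du_Bois_Reymond:
  fixes d :: "real \<Rightarrow> complex"
  assumes ab: "a < b" and d: "set_integrable lborel {a<..<b} d"
    and 0: "\<And>\<phi>. test_function {a<..<b} \<phi> \<Longrightarrow> (LINT x:{a<..<b}|lborel. d x * partial_deriv 1 \<phi> x) = 0"
  shows "\<exists>C. AE x in lborel. x \<in> {a<..<b} \<longrightarrow> d x = C"
proof -
  define m \<rho> where "m = (a + b) / 2" and "\<rho> = (b - a) / 4"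
  have \<rho>: "0 < \<rho>" "cball m \<rho> \<subseteq> {a<..<b}"
    using ab by (auto simp: \<rho>_def m_def cball_eq_atLeastAtMost field_simps)
  obtain e :: "real \<Rightarrow> real" where e: "test_function {a<..<b} (\<lambda>x. of_real (e x))"
    "\<And>x. 0 \<le> e x" "\<And>x. e x \<le> 1" "{x. 0 < e x} = ball m \<rho>"
    using test_function_ball[OF \<rho>] by metis
  define \<eta> where "\<eta> = (\<lambda>x. complex_of_real (e x))"
  have \<eta>: "test_function {a<..<b} \<eta>" using e(1) by (simp add: \<eta>_def)
  have ti: "integrable lborel \<psi>" if t: "test_function {a<..<b} \<psi>" for \<psi>
  proof -
    obtain K where "compact K" "\<And>x. x \<notin> K \<Longrightarrow> \<psi> x = 0" using test_functionE[OF t] by metis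
    then show ?thesis using test_function_continuous[OF t] by (intro integrable_if_compact_support)
  qed
  define J where "J = (LINT x|lborel. \<eta> x)"
  \<comment> \<open>A nonnegative bump of integral zero would vanish almost everywhere, although it
    is positive on a ball of positive measure.\<close>
  have "J \<noteq> 0"
  proof
    assume "J = 0"
    then have "complex_of_real (LINT x|lborel. e x) = 0" by (simp add: J_def \<eta>_def)
    then have "(LINT x|lborel. e x) = 0" by (simp only: of_real_eq_0_iff)
    moreover have ei: "integrable lborel e"
      using integrable_Re[OF ti[OF \<eta>]] by (simp add: \<eta>_def)
    ultimately have "AE x in lborel. e x = 0"
      using integral_nonneg_eq_0_iff_AE[OF ei] e(2) by simp
    then have "AE x in lborel. x \<notin> ball m \<rho>"
      by eventually_elim (metis e(4) less_irrefl mem_Collect_eq)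
    then have "ball m \<rho> \<in> null_sets lborel" by (subst (asm) AE_iff_null_sets[symmetric]) auto
    then have "emeasure lborel {m - \<rho><..<m + \<rho>} = 0" by (simp add: ball_eq_greaterThanLessThan null_sets_def)
    then show False using \<rho>(1) by simp
  qed
  define C where "C = (LINT x:{a<..<b}|lborel. d x * \<eta> x) / J"
  have "AE x in lborel. x \<in> {a<..<b} \<longrightarrow> d x - C = 0"
  proof (rule fundamental_lemma)
    have cint: "set_integrable lborel {a<..<b} (\<lambda>_. C)"
      unfolding set_integrable_def using ab by (intro integrable_scaleR_left integrable_real_indicator) auto
    then show "set_integrable lborel {a<..<b} (\<lambda>x. d x - C)" using d by (rule set_integral_diff(1)[rotated])
    fix \<psi> assume \<psi>: "test_function {a<..<b} \<psi>"
    \<comment> \<open>Chosen so that \<open>\<psi> - k \<eta>\<close> has integral zero and is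
      therefore the derivative of a test function.\<close>
    define k where "k = (LINT x|lborel. \<psi> x) / J"
    define f where "f = (\<lambda>x. \<psi> x + (- k) * \<eta> x)"
    have tf: "test_function {a<..<b} f" unfolding f_def by (intro test_function_add test_function_cmult \<psi> \<eta>)
    have f0: "(LINT x|lborel. f x) = 0"
      using ti[OF \<psi>] ti[OF \<eta>] \<open>J \<noteq> 0\<close> by (simp add: f_def k_def J_def[symmetric])
    obtain K where K: "compact K" "K \<subseteq> {a<..<b}" "\<And>x. x \<notin> K \<Longrightarrow> f x = 0" using test_functionE[OF tf] by metis
    note p = primitive_test_function[OF test_function_continuous[OF tf] K f0]
    have "0 = (LINT x:{a<..<b}|lborel. d x * f x)" using 0[OF p(1)] by (simp add: p(2))
    also have "\<dots> = (LINT x:{a<..<b}|lborel. d x * \<psi> x - k * (d x * \<eta> x))"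
      by (simp add: f_def algebra_simps)
    also have "\<dots> = (LINT x:{a<..<b}|lborel. d x * \<psi> x) - k * (LINT x:{a<..<b}|lborel. d x * \<eta> x)"
      using set_integrable_mult_test_function(1)[OF d \<psi>] set_integrable_mult_test_function(1)[OF d \<eta>] by simp
    also have "k * (LINT x:{a<..<b}|lborel. d x * \<eta> x) = C * (LINT x|lborel. \<psi> x)"
      by (simp add: k_def C_def)
    also have "(LINT x|lborel. \<psi> x) = (LINT x:{a<..<b}|lborel. \<psi> x)"
      unfolding set_lebesgue_integral_def
    proof (rule Bochner_Integration.integral_cong[OF refl])
      obtain K where "K \<subseteq> {a<..<b}" "\<And>x. x \<notin> K \<Longrightarrow> \<psi> x = 0" using test_functionE[OF \<psi>] by metis
      then show "\<psi> x = indicator {a<..<b} x *\<^sub>R \<psi> x" for x by (cases "x \<in> K") auto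
    qed
    also have "(LINT x:{a<..<b}|lborel. d x * \<psi> x) - C * (LINT x:{a<..<b}|lborel. \<psi> x) =
        (LINT x:{a<..<b}|lborel. d x * \<psi> x - C * \<psi> x)"
      using set_integrable_mult_test_function(1)[OF d \<psi>] set_integrable_mult_test_function(1)[OF cint \<psi>] by simp
    finally show "(LINT x:{a<..<b}|lborel. (d x - C) * \<psi> x) = 0" by (simp add: left_diff_distrib)
  qed simp
  then have "AE x in lborel. x \<in> {a<..<b} \<longrightarrow> d x = C" by eventually_elim auto
  then show ?thesis by blast
qed

text \<open>By du Bois-Reymond, \<open>v\<close> minus the primitive of its weak derivative is
  constant, so primitive plus constant is the continuous representative. The second conclusion
  allows test functions that are nonzero at the endpoints; through it the boundary values enter the
  energy estimates.\<close>

lemma H1_interval_cont_rep: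
  fixes v g :: "real \<Rightarrow> complex"
  assumes ab: "a < b" and v: "L2 {a<..<b} v" and g: "is_L2_weak_deriv {a<..<b} 1 v g"
  obtains V where "is_cont_rep a b v V"
    "\<And>\<psi> \<psi>'. (\<And>x. x \<in> {a..b} \<Longrightarrow> (\<psi> has_vector_derivative \<psi>' x) (at x within {a..b})) \<Longrightarrow>
      continuous_on {a..b} \<psi>' \<Longrightarrow>
      (LINT x:{a<..<b}|lborel. g x * \<psi> x) + (LINT x:{a<..<b}|lborel. v x * \<psi>' x) = V b * \<psi> b - V a * \<psi> a"
proof -
  let ?I = "{a<..<b}"
  have si: "set_integrable lborel ?I v" "set_integrable lborel ?I g"
    using v g ab by (auto simp: is_L2_weak_deriv_def intro!: set_integrable_L2)
  define g' where "g' = (\<lambda>x. indicator ?I x *\<^sub>R g x)"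
  have g': "integrable lborel g'" "\<And>t. t \<notin> ?I \<Longrightarrow> g' t = 0" "\<And>t. t < a \<Longrightarrow> g' t = 0"
    using si by (auto simp: g'_def set_integrable_def)
  define G where "G = primitive g'"
  have cG: "continuous_on {a..b} G" unfolding G_def by (rule continuous_on_primitive[OF g'(1,3)])
  have Ga: "G a = 0"
  proof -
    have "(\<lambda>t. indicator {..a} t *\<^sub>R g' t) = (\<lambda>_. 0)" using g'(2) by (auto simp: indicator_def)
    then show ?thesis by (simp add: G_def primitive_def)
  qed
  have gg': "(LINT x|lborel. g' x * \<psi> x) = (LINT x:?I|lborel. g x * \<psi> x)" for \<psi>
    unfolding set_lebesgue_integral_def g'_def by (simp add: scaleR_conv_of_real mult.assoc)
  have Gp: "(LINT x:?I|lborel. g x * \<psi> x) + (LINT x:?I|lborel. G x * \<psi>' x) = G b * \<psi> b"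
    if "\<And>x. x \<in> {a..b} \<Longrightarrow> (\<psi> has_vector_derivative \<psi>' x) (at x within {a..b})"
      "continuous_on {a..b} \<psi>'" for \<psi> \<psi>'
    using primitive_by_parts[OF ab g'(1,2) that] by (simp add: gg' G_def)
  have cint: "set_integrable lborel ?I f" if "continuous_on {a..b} f" for f :: "real \<Rightarrow> complex"
    by (rule set_integrable_subset[of _ "{a..b}"])
       (use borel_integrable_compact[OF compact_Icc that] in \<open>auto simp: set_integrable_def\<close>)
  have "\<exists>C. AE x in lborel. x \<in> ?I \<longrightarrow> v x - G x = C"
  proof (rule du_Bois_Reymond[OF ab])
    show "set_integrable lborel ?I (\<lambda>x. v x - G x)" using si cint[OF cG] by auto
    fix \<phi> assume \<phi>: "test_function ?I \<phi>"
    have c: "continuous_on UNIV (partial_deriv 1 \<phi>)" using \<phi> by (simp add: test_function_def)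
    obtain K where "K \<subseteq> ?I" "\<And>x. x \<notin> K \<Longrightarrow> \<phi> x = 0" using test_functionE[OF \<phi>] by metis
    then have b0: "\<phi> b = 0" by (metis greaterThanLessThan_iff less_irrefl subsetD)
    note hv = test_function_has_vector_derivative[OF \<phi>]
    have "(LINT x:?I|lborel. g x * \<phi> x) + (LINT x:?I|lborel. G x * partial_deriv 1 \<phi> x) = 0"
      using Gp[OF hv continuous_on_subset[OF c]] b0 by simp
    moreover have "(LINT x:?I|lborel. v x * partial_deriv 1 \<phi> x) = - (LINT x:?I|lborel. g x * \<phi> x)"
      using g \<phi> by (simp add: is_L2_weak_deriv_def)
    moreover have "(LINT x:?I|lborel. (v x - G x) * partial_deriv 1 \<phi> x) =
       (LINT x:?I|lborel. v x * partial_deriv 1 \<phi> x) - (LINT x:?I|lborel. G x * partial_deriv 1 \<phi> x)"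
      unfolding left_diff_distrib
      using si cint[OF cG] \<phi> by (intro set_integral_diff set_integrable_mult_test_function) auto
    ultimately show "(LINT x:?I|lborel. (v x - G x) * partial_deriv 1 \<phi> x) = 0"
      by (simp add: add_eq_0_iff)
  qed
  then obtain C where C: "AE x in lborel. x \<in> ?I \<longrightarrow> v x - G x = C" by blast
  define V where "V = (\<lambda>x. G x + C)"
  have Vv: "AE x in lborel. x \<in> ?I \<longrightarrow> V x = v x" using C by eventually_elim (auto simp: V_def)
  have cV: "continuous_on {a..b} V" unfolding V_def by (intro continuous_intros cG)
  show thesis
  proof (rule that)
    show "is_cont_rep a b v V" using Vv cV by (simp add: is_cont_rep_def)
    fix \<psi> \<psi>' :: "real \<Rightarrow> complex"
    assume \<psi>: "\<And>x. x \<in> {a..b} \<Longrightarrow> (\<psi> has_vector_derivative \<psi>' x) (at x within {a..b})"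
      and c\<psi>': "continuous_on {a..b} \<psi>'"
    have "(LINT x:?I|lborel. v x * \<psi>' x) = (LINT x:?I|lborel. V x * \<psi>' x)"
    proof (rule set_integral_cong_AE_borel)
      have "set_borel_measurable lborel ?I v" "set_borel_measurable lborel ?I V" "set_borel_measurable lborel ?I \<psi>'"
        using si cint[OF cV] cint[OF c\<psi>'] unfolding set_integrable_def set_borel_measurable_def by auto
      then show "set_borel_measurable lborel ?I (\<lambda>x. v x * \<psi>' x)" "set_borel_measurable lborel ?I (\<lambda>x. V x * \<psi>' x)"
        by (auto intro: set_borel_measurable_mult)
      show "AE x in lborel. x \<in> ?I \<longrightarrow> v x * \<psi>' x = V x * \<psi>' x" using Vv by eventually_elim auto
    qed
    also have "\<dots> = (LINT x:?I|lborel. G x * \<psi>' x) + C * (LINT x:?I|lborel. \<psi>' x)"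
      using cint[OF c\<psi>'] cint[OF continuous_on_mult[OF cG c\<psi>']]
      unfolding V_def distrib_right by (subst set_integral_add) auto
    also have "(LINT x:?I|lborel. \<psi>' x) = \<psi> b - \<psi> a"
    proof -
      have "(LINT x:?I|lborel. \<psi>' x) = integral ?I \<psi>'"
        by (rule set_borel_integral_eq_integral[OF cint[OF c\<psi>']])
      also have "\<dots> = integral {a..b} \<psi>'"
        by (rule integral_open_interval_real[symmetric])
      also have "\<dots> = \<psi> b - \<psi> a"
        by (rule integral_unique, rule fundamental_theorem_of_calculus) (use ab \<psi> in auto)
      finally show ?thesis .
    qed
    finally have e: "(LINT x:?I|lborel. v x * \<psi>' x) = (LINT x:?I|lborel. G x * \<psi>' x) + C * (\<psi> b - \<psi> a)" .
    have "(LINT x:?I|lborel. g x * \<psi> x) + (LINT x:?I|lborel. v x * \<psi>' x) = G b * \<psi> b + C * (\<psi> b - \<psi> a)"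
      using Gp[OF \<psi> c\<psi>'] unfolding e by (simp only: add.assoc[symmetric])
    then show "(LINT x:?I|lborel. g x * \<psi> x) + (LINT x:?I|lborel. v x * \<psi>' x) = V b * \<psi> b - V a * \<psi> a"
      by (simp add: V_def Ga algebra_simps)
  qed
qed

section \<open>Modified Bessel functions\<close>

text \<open>
  The Bessel equation \<open>(x w')' = (n\<^sup>2/x + x) w\<close> as a first-order system for \<open>w\<close> and \<open>W = x w'\<close>.
\<close>

definition bessel_system :: "nat \<Rightarrow> (real \<Rightarrow> real) \<Rightarrow> (real \<Rightarrow> real) \<Rightarrow> bool" where
  "bessel_system n w W \<longleftrightarrow> (\<forall>x>0. (w has_real_derivative W x / x) (at x) \<and>
     (W has_real_derivative ((real n)\<^sup>2 / x + x) * w x) (at x))"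

lemma bessel_systemD:
  assumes "bessel_system n w W" "x > 0"
  shows "(w has_real_derivative W x / x) (at x)"
    "(W has_real_derivative ((real n)\<^sup>2 / x + x) * w x) (at x)"
    "x * deriv w x = W x"
  using assms DERIV_imp_deriv[of w "W x / x" x] by (auto simp: bessel_system_def)

lemma bessel_system_linear:
  assumes "bessel_system n v V" "bessel_system n w W"
  shows "bessel_system n (\<lambda>x. c * v x + d * w x) (\<lambda>x. c * V x + d * W x)"
  unfolding bessel_system_def
proof (intro allI impI conjI)
  fix x :: real assume x: "x > 0"
  note D = bessel_systemD[OF assms(1) x] bessel_systemD[OF assms(2) x]
  show "((\<lambda>x. c * v x + d * w x) has_real_derivative (c * V x + d * W x) / x) (at x)"
    using x by (auto intro!: derivative_eq_intros D(1,4) simp: add_divide_distrib mult.commute)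
  show "((\<lambda>x. c * V x + d * W x) has_real_derivative ((real n)\<^sup>2 / x + x) * (c * v x + d * w x)) (at x)"
    using x by (auto intro!: derivative_eq_intros D(2,5) simp: algebra_simps)
qed

subsection \<open>The first kind\<close>

text \<open>Write the function as (x/2)^n p(x^2/4) with the entire series p(y) = sum of y^k / (k!
  (k+n)!). Bessel's equation becomes y p'' + (n+1) p' = p, and positive coefficients give the
  signs.\<close>

lemma bessel_I_pair:
  fixes n :: nat
  obtains W where "bessel_system n (bessel_I n) W"
    "\<And>x. x > 0 \<Longrightarrow> 0 < bessel_I n x" "\<And>x. x > 0 \<Longrightarrow> 0 < W x"
proof -
  define c where "c = (\<lambda>k. 1 / (fact k * fact (k + n)) :: real)"
  define p p1 p2 where "p = (\<lambda>y. \<Sum>k. c k * y ^ k)" and "p1 = (\<lambda>y. \<Sum>k. diffs c k * y ^ k)"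
    and "p2 = (\<lambda>y. \<Sum>k. diffs (diffs c) k * y ^ k)"
  have sum0: "summable (\<lambda>k. c k * y ^ k)" for y
  proof (rule summable_comparison_test'[OF summable_norm_exp[of y]])
    fix k :: nat
    have "1 \<le> (fact (k + n) :: real)" by (rule fact_ge_1)
    then have "\<bar>y\<bar> ^ k / (fact k * fact (k + n)) \<le> \<bar>y\<bar> ^ k / (fact k * 1)"
      by (intro divide_left_mono mult_left_mono) auto
    then show "norm (c k * y ^ k) \<le> norm (y ^ k /\<^sub>R fact k)"
      by (simp add: c_def abs_mult power_abs divide_inverse mult_ac)
  qed
  have sum1: "summable (\<lambda>k. diffs c k * y ^ k)" for y
    by (rule termdiff_converges_all) (rule sum0)
  have sum2: "summable (\<lambda>k. diffs (diffs c) k * y ^ k)" for y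
    by (rule termdiff_converges_all) (rule sum1)
  have dp: "(p has_real_derivative p1 y) (at y)" and dp1: "(p1 has_real_derivative p2 y) (at y)" for y
    unfolding p_def p1_def p2_def
    by (intro termdiffs_strong_converges_everywhere sum0 sum1)+
  \<comment> \<open>Comparison of coefficients: \<open>diffs c k\<close> is (k+1) c_(k+1), and
    (k+n+1) (k+1) c_(k+1) = c_k.\<close>
  have ode: "y * p2 y + (real n + 1) * p1 y = p y" for y
  proof -
    have "(\<lambda>k. of_nat k * diffs c k * y ^ (k - Suc 0)) sums p2 y"
      unfolding p2_def by (rule diffs_equiv[OF sum2])
    from sums_mult[OF this, of y] have "(\<lambda>k. of_nat k * diffs c k * y ^ k) sums (y * p2 y)"
    proof (rule sums_cong[THEN iffD1, rotated])
      show "y * (real k * diffs c k * y ^ (k - Suc 0)) = real k * diffs c k * y ^ k" for k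
        by (cases k) auto
    qed
    moreover have "(\<lambda>k. (real n + 1) * (diffs c k * y ^ k)) sums ((real n + 1) * p1 y)"
      unfolding p1_def by (intro sums_mult summable_sums sum1)
    ultimately have "(\<lambda>k. of_nat k * diffs c k * y ^ k + (real n + 1) * (diffs c k * y ^ k)) sums
        (y * p2 y + (real n + 1) * p1 y)"
      by (rule sums_add)
    moreover have "of_nat k * diffs c k * y ^ k + (real n + 1) * (diffs c k * y ^ k) = c k * y ^ k" for k
    proof -
      have "(real k + real n + 1) * diffs c k = c k"
        by (simp add: diffs_def c_def divide_simps)
      then have "(real k + real n + 1) * diffs c k * y ^ k = c k * y ^ k" by simp
      then show ?thesis by (simp add: algebra_simps)
    qed
    ultimately have "(\<lambda>k. c k * y ^ k) sums (y * p2 y + (real n + 1) * p1 y)" by simp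
    then show ?thesis unfolding p_def by (simp add: sums_iff)
  qed
  have pos: "0 < p y" "0 < p1 y" if y: "y > 0" for y
  proof -
    have "0 < c k * y ^ k" "0 < diffs c k * y ^ k" for k using y by (auto simp: c_def diffs_def)
    then show "0 < p y" "0 < p1 y"
      unfolding p_def p1_def using suminf_pos[OF sum0, of y] suminf_pos[OF sum1, of y] by blast+
  qed
  have I: "bessel_I n x = (x / 2) ^ n * p (x\<^sup>2 / 4)" for x
  proof -
    have "(x / 2) ^ n * (c k * (x\<^sup>2 / 4) ^ k) = (x / 2) ^ (2 * k + n) / (fact k * fact (k + n))" for k
    proof -
      have "(x\<^sup>2 / 4) = (x / 2)\<^sup>2" by (simp add: power_divide)
      then have "(x\<^sup>2 / 4) ^ k = (x / 2) ^ (2 * k)" by (simp add: power_mult)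
      then show ?thesis by (simp add: c_def power_add)
    qed
    then show ?thesis
      unfolding bessel_I_def p_def by (subst suminf_mult[OF sum0, symmetric]) simp
  qed
  \<comment> \<open>This is x times the derivative of (x/2)^n p(x^2/4), with the powers of x
    collected.\<close>
  define W where "W = (\<lambda>x. (x / 2) ^ n * (real n * p (x\<^sup>2 / 4) + 2 * (x\<^sup>2 / 4) * p1 (x\<^sup>2 / 4)))"
  show thesis
  proof (rule that)
    show "0 < bessel_I n x" if "x > 0" for x using that pos(1)[of "x\<^sup>2 / 4"] by (simp add: I)
    show "0 < W x" if "x > 0" for x
      using that pos[of "x\<^sup>2 / 4"] by (auto simp: W_def intro!: mult_pos_pos add_nonneg_pos)
    show "bessel_system n (bessel_I n) W"
      unfolding bessel_system_def
    proof (intro allI impI conjI)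
      fix x :: real assume x: "x > 0"
      let ?y = "x\<^sup>2 / 4"
      have y': "((\<lambda>x. x\<^sup>2 / 4) has_real_derivative x / 2) (at x)"
        by (auto intro!: derivative_eq_intros)
      have q': "((\<lambda>x. p (x\<^sup>2 / 4)) has_real_derivative p1 ?y * (x / 2)) (at x)"
        by (rule DERIV_chain2[OF dp y'])
      have q1': "((\<lambda>x. p1 (x\<^sup>2 / 4)) has_real_derivative p2 ?y * (x / 2)) (at x)"
        by (rule DERIV_chain2[OF dp1 y'])
      have pw: "((\<lambda>x. (x / 2) ^ n) has_real_derivative real n / x * (x / 2) ^ n) (at x)"
      proof -
        have "((\<lambda>x. (x / 2) ^ n) has_real_derivative real n * (1 / 2 * (x / 2) ^ (n - Suc 0))) (at x)"
          by (rule DERIV_power) (auto intro!: derivative_eq_intros)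
        then show ?thesis using x by (cases n) (auto simp: mult_ac)
      qed
      have "((\<lambda>x. (x / 2) ^ n * p (x\<^sup>2 / 4)) has_real_derivative
          (real n / x * (x / 2) ^ n) * p ?y + (p1 ?y * (x / 2)) * (x / 2) ^ n) (at x)"
        by (rule DERIV_mult[OF pw q'])
      moreover have "(real n / x * (x / 2) ^ n) * p ?y + (p1 ?y * (x / 2)) * (x / 2) ^ n = W x / x"
        using x by (simp add: W_def field_simps power2_eq_square)
      moreover have "bessel_I n = (\<lambda>x. (x / 2) ^ n * p (x\<^sup>2 / 4))" using I by blast
      ultimately show "(bessel_I n has_real_derivative W x / x) (at x)" by simp
      have "((\<lambda>x. real n * p (x\<^sup>2 / 4) + 2 * (x\<^sup>2 / 4) * p1 (x\<^sup>2 / 4)) has_real_derivative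
          real n * (p1 ?y * (x / 2)) + (x * p1 ?y + 2 * ?y * (p2 ?y * (x / 2)))) (at x)"
        by (auto intro!: derivative_eq_intros q' q1' simp: mult_ac add_divide_distrib)
      from DERIV_mult[OF pw this]
      have "(W has_real_derivative (real n / x * (x / 2) ^ n) * (real n * p ?y + 2 * ?y * p1 ?y) +
          (real n * (p1 ?y * (x / 2)) + (x * p1 ?y + 2 * ?y * (p2 ?y * (x / 2)))) * (x / 2) ^ n) (at x)"
        by (simp only: W_def)
      moreover have "(real n / x * (x / 2) ^ n) * (real n * p ?y + 2 * ?y * p1 ?y) +
          (real n * (p1 ?y * (x / 2)) + (x * p1 ?y + 2 * ?y * (p2 ?y * (x / 2)))) * (x / 2) ^ n
          = ((real n)\<^sup>2 / x + x) * bessel_I n x"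
      proof -
        have "?y * p2 ?y = p ?y - (real n + 1) * p1 ?y" using ode[of ?y] by simp
        then have e: "2 * ?y * (p2 ?y * (x / 2)) = x * (p ?y - (real n + 1) * p1 ?y)" by (simp add: mult_ac)
        have "real n / x * (real n * p ?y + 2 * ?y * p1 ?y) +
          (real n * (p1 ?y * (x / 2)) + (x * p1 ?y + x * (p ?y - (real n + 1) * p1 ?y)))
          = ((real n)\<^sup>2 / x + x) * p ?y"
          using x by (simp add: field_simps power2_eq_square)
        from arg_cong[OF this, of "\<lambda>z. (x / 2) ^ n * z"]
        show ?thesis unfolding e I by (simp only: algebra_simps)
      qed
      ultimately show "(W has_real_derivative ((real n)\<^sup>2 / x + x) * bessel_I n x) (at x)" by simp
    qed
  qed
qed

subsection \<open>The second kind\<close>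

text \<open>Rearranges (1 + s/m)^m \<le> exp s at s = x c. It shows that part of the exponential
  decay absorbs any power of cosh.\<close>

lemma power_mult_exp_bounded:
  fixes x c :: real
  assumes "x > 0" "c \<ge> 0"
  shows "c ^ m * exp (- x * c) \<le> (real m / x) ^ m"
proof (cases "m = 0")
  case False
  have "(x * c / real m) ^ m \<le> (1 + x * c / real m) ^ m"
    using assms by (intro power_mono) auto
  also have "\<dots> \<le> exp (x * c)"
    using assms False by (intro exp_ge_one_plus_x_over_n_power_n) (auto intro: order_trans[of _ 0])
  finally have "(x * c / real m) ^ m * exp (- (x * c)) \<le> exp (x * c) * exp (- (x * c))"
    by (rule mult_right_mono) simp
  then have "(x * c / real m) ^ m * exp (- (x * c)) \<le> 1" by (simp add: exp_minus)
  then have "(real m / x) ^ m * ((x * c / real m) ^ m * exp (- (x * c))) \<le> (real m / x) ^ m * 1"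
    using assms by (intro mult_left_mono) auto
  moreover have "(real m / x) ^ m * (x * c / real m) ^ m = c ^ m"
    using assms False by (simp flip: power_mult_distrib)
  ultimately show ?thesis by (simp add: mult.assoc[symmetric])
qed (use assms in auto)

lemma cosh_ge_self: "t \<le> cosh t" for t :: real
proof (cases "t \<ge> 0")
  case True
  have "2 * t \<le> (1 + t / 2)\<^sup>2"
    using zero_le_power2[of "1 - t / 2"] by (simp add: power2_eq_square algebra_simps)
  also have "\<dots> \<le> exp (t / 2) ^ 2" using True by (intro power_mono) auto
  also have "\<dots> = exp t" by (simp add: exp_double[symmetric])
  also have "\<dots> \<le> 2 * cosh t" by (simp add: cosh_def)
  finally show ?thesis by simp
next
  case False
  then show ?thesis using cosh_real_nonneg[of t] by linarith
qed

text \<open>Each x-derivative of exp (-x cosh t) brings down a factor -cosh t. Up to the sign (-1)^j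
  this is the j-th x-derivative of the integrand of \<open>bessel_K\<close>.\<close>

definition bessel_K_integrand :: "nat \<Rightarrow> nat \<Rightarrow> real \<Rightarrow> real \<Rightarrow> real" where
  "bessel_K_integrand n j x t = cosh t ^ j * exp (- x * cosh t) * cosh (real n * t)"

text \<open>Since cosh (n t) \<le> (2 cosh t)^n, only powers of cosh t occur. Half of the exponent
  absorbs them, and the other half decays at least like exp (-x t / 2) because t \<le> cosh
  t.\<close>

lemma bessel_K_integrand_bound:
  assumes "x > 0"
  obtains M where "M \<ge> 0" "\<And>t. t \<ge> 0 \<Longrightarrow> bessel_K_integrand n j x t \<le> M * exp (- (x / 2) * t)"
proof
  define M where "M = 2 ^ n * (real (j + n) / (x / 2)) ^ (j + n)"
  show "0 \<le> M" using assms by (simp add: M_def)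
  fix t :: real assume t: "t \<ge> 0"
  have "cosh (real n * t) \<le> exp (real n * t)" using t by (simp add: cosh_def)
  also have "\<dots> = exp t ^ n" by (simp add: exp_of_nat_mult)
  also have "\<dots> \<le> (2 * cosh t) ^ n" by (intro power_mono) (auto simp: cosh_def)
  finally have "bessel_K_integrand n j x t \<le> cosh t ^ j * exp (- x * cosh t) * (2 * cosh t) ^ n"
    unfolding bessel_K_integrand_def by (intro mult_left_mono) auto
  also have "\<dots> = 2 ^ n * (cosh t ^ (j + n) * exp (- (x / 2) * cosh t)) * exp (- (x / 2) * cosh t)"
    by (simp add: power_add power_mult_distrib exp_add[symmetric])
  also have "\<dots> \<le> 2 ^ n * (real (j + n) / (x / 2)) ^ (j + n) * exp (- (x / 2) * t)"
    using assms cosh_ge_self[of t]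
    by (intro mult_mono mult_left_mono power_mult_exp_bounded) auto
  finally show "bessel_K_integrand n j x t \<le> M * exp (- (x / 2) * t)" by (simp add: M_def)
qed

lemma set_integrable_exp_minus:
  assumes "a > 0"
  shows "set_integrable lborel {0..} (\<lambda>t::real. exp (- a * t))"
proof -
  have "(\<lambda>t::real. exp (- a * t)) absolutely_integrable_on {0..}"
    using integrable_on_exp_minus_to_infinity[OF assms]
    by (intro nonnegative_absolutely_integrable_1) auto
  then show ?thesis
    unfolding set_integrable_def by (subst (asm) integrable_completion) auto
qed

lemma set_integrable_bessel_K_integrand:
  assumes "x > 0"
  shows "set_integrable lborel {0..} (bessel_K_integrand n j x)"
proof -
  obtain M where M: "M \<ge> 0" "\<And>t. t \<ge> 0 \<Longrightarrow> bessel_K_integrand n j x t \<le> M * exp (- (x / 2) * t)"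
    using bessel_K_integrand_bound[OF assms, of n j] by blast
  have "set_integrable lborel {0..} (\<lambda>t. M * exp (- (x / 2) * t))"
    using set_integrable_exp_minus[of "x / 2"] assms by (intro set_integrable_mult_right) auto
  then show ?thesis
    unfolding set_integrable_def
  proof (rule Bochner_Integration.integrable_bound)
    show "(\<lambda>t. indicator {0..} t *\<^sub>R bessel_K_integrand n j x t) \<in> borel_measurable lborel"
      unfolding bessel_K_integrand_def
      by (intro borel_measurable_scaleR borel_measurable_indicator)
         (auto simp: borel_measurable_continuous_onI intro!: borel_measurable_continuous_onI continuous_intros)
    have "0 \<le> bessel_K_integrand n j x t" for t by (simp add: bessel_K_integrand_def)
    then show "AE t in lborel. norm (indicator {0..} t *\<^sub>R bessel_K_integrand n j x t) \<le>
        norm (indicator {0..} t *\<^sub>R (M * exp (- (x / 2) * t)))"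
      using M by (auto simp: indicator_def)
  qed
qed

definition bessel_Kj :: "nat \<Rightarrow> nat \<Rightarrow> real \<Rightarrow> real" where
  "bessel_Kj n j x = (LINT t:{0..}|lborel. bessel_K_integrand n j x t)"

lemma bessel_K_eq: "bessel_K n = bessel_Kj n 0"
  by (simp add: fun_eq_iff bessel_K_def bessel_Kj_def bessel_K_integrand_def)

text \<open>The first-order Taylor remainder of u -> exp (-u c), estimated by two mean value bounds.
  The common lower bound \<open>d\<close> makes the majorant independent of \<open>y\<close>, as
  differentiation under the integral requires.\<close>

lemma exp_second_order_bound:
  fixes c :: real
  assumes "c \<ge> 0" "d \<le> x" "d \<le> y"
  shows "\<bar>exp (- y * c) - exp (- x * c) + (y - x) * (c * exp (- x * c))\<bar> \<le> (y - x)\<^sup>2 * (c\<^sup>2 * exp (- d * c))"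
proof -
  let ?f = "\<lambda>u. exp (- u * c) + (u - x) * (c * exp (- x * c))"
  have f': "(?f has_real_derivative c * (exp (- x * c) - exp (- u * c))) (at u within S)" for u S
    by (auto intro!: derivative_eq_intros simp: algebra_simps)
  have e': "((\<lambda>u. exp (- u * c)) has_real_derivative - c * exp (- u * c)) (at u within S)" for u S
    by (auto intro!: derivative_eq_intros)
  have seg: "u \<ge> d" if "u \<in> closed_segment x y" for u
    using that assms by (auto simp: closed_segment_eq_real_ivl split: if_splits)
  have b1: "\<bar>exp (- x * c) - exp (- u * c)\<bar> \<le> c * exp (- d * c) * \<bar>y - x\<bar>" if u: "u \<in> closed_segment x y" for u
  proof -
    have "norm (exp (- x * c) - exp (- u * c)) \<le> c * exp (- d * c) * norm (x - u)"
    proof (rule field_differentiable_bound[of "{d..}" "\<lambda>u. exp (- u * c)" "\<lambda>u. - c * exp (- u * c)"])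
      show "norm (- c * exp (- z * c)) \<le> c * exp (- d * c)" if "z \<in> {d..}" for z
        using that assms by (auto simp: abs_mult intro!: mult_left_mono mult_right_mono)
    qed (use e' assms seg[OF u] in auto)
    also have "\<dots> \<le> c * exp (- d * c) * \<bar>y - x\<bar>"
      using u assms by (intro mult_left_mono) (auto simp: closed_segment_eq_real_ivl split: if_splits)
    finally show ?thesis by simp
  qed
  have "norm (?f y - ?f x) \<le> c * (c * exp (- d * c) * \<bar>y - x\<bar>) * norm (y - x)"
  proof (rule field_differentiable_bound[of "closed_segment x y" ?f])
    show "norm (c * (exp (- x * c) - exp (- u * c))) \<le> c * (c * exp (- d * c) * \<bar>y - x\<bar>)"
      if "u \<in> closed_segment x y" for u
      using b1[OF that] assms by (auto simp: abs_mult intro!: mult_left_mono)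
  qed (use f' in auto)
  moreover have "c * (c * exp (- d * c) * \<bar>y - x\<bar>) * norm (y - x) = (y - x)\<^sup>2 * (c\<^sup>2 * exp (- d * c))"
  proof -
    have "c * (c * exp (- d * c) * \<bar>y - x\<bar>) * norm (y - x) = (\<bar>y - x\<bar> * \<bar>y - x\<bar>) * (c\<^sup>2 * exp (- d * c))"
      unfolding real_norm_def power2_eq_square by (simp only: mult_ac)
    then show ?thesis by (simp only: abs_mult_self_eq power2_eq_square)
  qed
  moreover have "?f y - ?f x = exp (- y * c) - exp (- x * c) + (y - x) * (c * exp (- x * c))" by simp
  ultimately show ?thesis by (simp only: real_norm_def)
qed

lemma has_real_derivative_quadratic_bound:
  fixes f :: "real \<Rightarrow> real"
  assumes "e > 0" "\<And>y. \<bar>y - x\<bar> < e \<Longrightarrow> \<bar>f y - f x - (y - x) * D\<bar> \<le> C * (y - x)\<^sup>2"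
  shows "(f has_real_derivative D) (at x)"
  unfolding DERIV_def
proof (rule LIM_offset_zero_cancel[where a = 0, simplified], rule Lim_null[THEN iffD2], rule Lim_null_comparison)
  show "((\<lambda>h. C * \<bar>h\<bar>) \<longlongrightarrow> 0) (at 0)" by (auto intro!: tendsto_eq_intros)
  have "norm ((f (x + h) - f x) / h - D) \<le> C * \<bar>h\<bar>" if "h \<noteq> 0" "\<bar>h\<bar> < e" for h
  proof -
    have "\<bar>f (x + h) - f x - h * D\<bar> \<le> C * h\<^sup>2" using assms(2)[of "x + h"] that by simp
    then have "\<bar>f (x + h) - f x - h * D\<bar> / \<bar>h\<bar> \<le> C * h\<^sup>2 / \<bar>h\<bar>" by (rule divide_right_mono) simp
    moreover have "\<bar>f (x + h) - f x - h * D\<bar> / \<bar>h\<bar> = \<bar>(f (x + h) - f x) / h - D\<bar>"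
      using that by (simp add: abs_divide[symmetric] diff_divide_distrib)
    moreover have "C * h\<^sup>2 / \<bar>h\<bar> = C * \<bar>h\<bar>"
      using that by (cases "h > 0") (auto simp: power2_eq_square)
    ultimately show ?thesis by simp
  qed
  then show "\<forall>\<^sub>F h in at 0. norm ((f (x + h) - f x) / h - D) \<le> C * \<bar>h\<bar>"
    using assms(1) unfolding eventually_at by (intro exI[of _ e]) (auto simp: dist_real_def)
qed

text \<open>Integrating the pointwise Taylor estimate gives a remainder of order (y - x)^2. All
  nearby \<open>y\<close> exceed x/2, so the constant is the convergent integral with two more
  factors cosh t, taken at x/2.\<close>

lemma bessel_Kj_derivative:
  assumes x: "x > 0"
  shows "(bessel_Kj n j has_real_derivative - bessel_Kj n (Suc j) x) (at x)"
proof (rule has_real_derivative_quadratic_bound[of "x / 2" _ _ _ "bessel_Kj n (j + 2) (x / 2)"])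
  fix y assume y: "\<bar>y - x\<bar> < x / 2"
  have yp: "y > 0" "x / 2 \<le> y" "x / 2 > 0" using x y by (auto simp: abs_real_def split: if_splits)
  let ?k = "bessel_K_integrand n"
  note ints [intro] = set_integrable_bessel_K_integrand[OF x] set_integrable_bessel_K_integrand[OF yp(1)]
    set_integrable_bessel_K_integrand[OF yp(3)]
  let ?d = "\<lambda>t. ?k j y t - ?k j x t + (y - x) * ?k (Suc j) x t"
  have di: "set_integrable lborel {0..} ?d" by (intro set_integral_add set_integral_diff set_integrable_mult_right) auto
  have eq: "bessel_Kj n j y - bessel_Kj n j x - (y - x) * (- bessel_Kj n (Suc j) x) = (LINT t:{0..}|lborel. ?d t)"
    unfolding bessel_Kj_def
    by (simp only: set_integral_add(2) set_integral_diff set_integral_mult_right set_integrable_mult_right ints)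
  have "\<bar>LINT t:{0..}|lborel. ?d t\<bar> \<le> (LINT t:{0..}|lborel. \<bar>?d t\<bar>)"
    using set_integral_norm_bound[OF di] by simp
  also have "\<dots> \<le> (LINT t:{0..}|lborel. (y - x)\<^sup>2 * ?k (j + 2) (x / 2) t)"
  proof (rule set_integral_mono)
    fix t :: real
    let ?c = "cosh t"
    have "?d t = ?c ^ j * cosh (real n * t) * (exp (- y * ?c) - exp (- x * ?c) + (y - x) * (?c * exp (- x * ?c)))"
      by (simp add: bessel_K_integrand_def algebra_simps)
    then have "\<bar>?d t\<bar> = ?c ^ j * cosh (real n * t) * \<bar>exp (- y * ?c) - exp (- x * ?c) + (y - x) * (?c * exp (- x * ?c))\<bar>"
      by (simp add: abs_mult)
    also have "\<dots> \<le> ?c ^ j * cosh (real n * t) * ((y - x)\<^sup>2 * (?c\<^sup>2 * exp (- (x / 2) * ?c)))"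
      using x yp by (intro mult_left_mono exp_second_order_bound) auto
    also have "\<dots> = (y - x)\<^sup>2 * ?k (j + 2) (x / 2) t"
      by (simp add: bessel_K_integrand_def power_add power2_eq_square)
    finally show "\<bar>?d t\<bar> \<le> (y - x)\<^sup>2 * ?k (j + 2) (x / 2) t" .
  qed (use set_integrable_abs[OF di] in auto)
  finally show "\<bar>bessel_Kj n j y - bessel_Kj n j x - (y - x) * (- bessel_Kj n (Suc j) x)\<bar> \<le>
      bessel_Kj n (j + 2) (x / 2) * (y - x)\<^sup>2"
    unfolding eq by (simp add: bessel_Kj_def mult.commute)
qed (use x in simp)

text \<open>The integrand is strictly positive, so a zero integral would make the half-line a null
  set.\<close>

lemma bessel_Kj_pos:
  assumes x: "x > 0"
  shows "bessel_Kj n j x > 0"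
proof -
  let ?k = "bessel_K_integrand n j x"
  have k: "?k t > 0" for t by (simp add: bessel_K_integrand_def)
  have i: "integrable lborel (\<lambda>t. indicator {0..} t *\<^sub>R ?k t)"
    using set_integrable_bessel_K_integrand[OF x, of n j] by (simp add: set_integrable_def)
  have "(LINT t|lborel. indicator {0..} t *\<^sub>R ?k t) \<noteq> 0"
  proof
    assume "(LINT t|lborel. indicator {0..} t *\<^sub>R ?k t) = 0"
    then have "AE t in lborel. indicator {0..} t *\<^sub>R ?k t = 0"
      using integral_nonneg_eq_0_iff_AE[OF i] k by (simp add: less_imp_le)
    then have "AE t in lborel. t \<notin> {0..1::real}"
      by eventually_elim (use k in \<open>auto simp: indicator_def less_le\<close>)
    then have "{0..1::real} \<in> null_sets lborel" by (subst (asm) AE_iff_null_sets[symmetric]) auto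
    then show False by (simp add: null_sets_def)
  qed
  moreover have "(LINT t|lborel. indicator {0..} t *\<^sub>R ?k t) \<ge> 0"
    using k by (intro Bochner_Integration.integral_nonneg) (auto simp: less_imp_le)
  ultimately show ?thesis by (simp add: bessel_Kj_def set_lebesgue_integral_def)
qed

text \<open>
  With \<open>E = exp (-x cosh t)\<close> and \<open>C = cosh (n t)\<close>, the Bessel operator applied to the integrand
  \<open>E C\<close> is \<open>\<partial>\<^sub>t(E\<^sub>t C - E C\<^sub>t)\<close>.
\<close>

lemma bessel_Kj_ode:
  assumes x: "x > 0"
  shows "x\<^sup>2 * bessel_Kj n 2 x - x * bessel_Kj n 1 x = (x\<^sup>2 + (real n)\<^sup>2) * bessel_Kj n 0 x"
proof -
  let ?k = "\<lambda>j. bessel_K_integrand n j x"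
  note ints [intro] = set_integrable_bessel_K_integrand[OF x]
  let ?f = "\<lambda>t. x\<^sup>2 * ?k 2 t - x * ?k 1 t - (x\<^sup>2 + (real n)\<^sup>2) * ?k 0 t"
  \<comment> \<open>This is E_t C - E C_t. It vanishes at t = 0 because both terms contain a
    hyperbolic sine.\<close>
  define H where "H = (\<lambda>t. - x * sinh t * exp (- x * cosh t) * cosh (real n * t) -
      exp (- x * cosh t) * (real n * sinh (real n * t)))"
  have fi: "set_integrable lborel {0..} ?f"
    by (intro set_integral_diff set_integrable_mult_right) auto
  have H': "(H has_real_derivative ?f t) (at t within S)" for t S
  proof -
    have "(H has_real_derivative
       ((- x * cosh t) * exp (- x * cosh t) + (- x * sinh t) * (exp (- x * cosh t) * (- x * sinh t))) * cosh (real n * t)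
       + (- x * sinh t * exp (- x * cosh t)) * (sinh (real n * t) * real n)
       - ((exp (- x * cosh t) * (- x * sinh t)) * (real n * sinh (real n * t))
          + exp (- x * cosh t) * (real n * (cosh (real n * t) * real n)))) (at t within S)"
      unfolding H_def by (auto intro!: derivative_eq_intros simp: algebra_simps)
    moreover have "(sinh t)\<^sup>2 = (cosh t)\<^sup>2 - 1" by (simp add: cosh_square_eq)
    then have "sinh t * sinh t = cosh t * cosh t - 1" by (simp add: power2_eq_square)
    then have "((- x * cosh t) * exp (- x * cosh t) + (- x * sinh t) * (exp (- x * cosh t) * (- x * sinh t))) * cosh (real n * t)
       + (- x * sinh t * exp (- x * cosh t)) * (sinh (real n * t) * real n)
       - ((exp (- x * cosh t) * (- x * sinh t)) * (real n * sinh (real n * t))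
          + exp (- x * cosh t) * (real n * (cosh (real n * t) * real n))) = ?f t"
      unfolding bessel_K_integrand_def power2_eq_square by simp algebra
    ultimately show ?thesis by simp
  qed
  have ftc: "(LINT t:{0..b}|lborel. ?f t) = H b" if b: "b \<ge> 0" for b
  proof -
    have "(LINT t:{0..b}|lborel. ?f t) = integral {0..b} ?f"
      by (rule set_borel_integral_eq_integral, rule set_integrable_subset[OF fi]) auto
    also have "\<dots> = H b - H 0"
      by (rule integral_unique, rule fundamental_theorem_of_calculus)
         (use b H' in \<open>auto simp: has_real_derivative_iff_has_vector_derivative[symmetric]\<close>)
    finally show ?thesis by (simp add: H_def)
  qed
  have "((\<lambda>b. LINT t:{0..b}|lborel. ?f t) \<longlongrightarrow> (LINT t:{0..}|lborel. ?f t)) at_top"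
    by (rule tendsto_set_lebesgue_integral_at_top[OF _ fi]) auto
  then have lim: "(H \<longlongrightarrow> (LINT t:{0..}|lborel. ?f t)) at_top"
    by (rule Lim_transform_eventually) (rule eventually_mono[OF eventually_ge_at_top[of 0]], rule ftc)
  obtain M1 where M1: "\<And>t. t \<ge> 0 \<Longrightarrow> ?k 1 t \<le> M1 * exp (- (x / 2) * t)"
    using bessel_K_integrand_bound[OF x, of n 1] by blast
  obtain M0 where M0: "\<And>t. t \<ge> 0 \<Longrightarrow> ?k 0 t \<le> M0 * exp (- (x / 2) * t)"
    using bessel_K_integrand_bound[OF x, of n 0] by blast
  \<comment> \<open>Replacing sinh by cosh bounds \<open>H\<close> by the integrands with j = 1 and
    j = 0, which decay exponentially.\<close>
  have "(H \<longlongrightarrow> 0) at_top"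
  proof (rule Lim_null_comparison)
    have "norm (H t) \<le> (x * M1 + real n * M0) * exp (- (x / 2) * t)" if t: "t \<ge> 0" for t
    proof -
      have s: "\<bar>sinh u\<bar> \<le> cosh u" for u :: real
        using sinh_less_cosh_real[of "\<bar>u\<bar>"] by (simp add: sinh_real_abs less_imp_le)
      have "norm (H t) \<le> x * (\<bar>sinh t\<bar> * exp (- x * cosh t) * cosh (real n * t)) +
          real n * (exp (- x * cosh t) * \<bar>sinh (real n * t)\<bar>)"
        unfolding H_def real_norm_def using x by (intro order_trans[OF abs_triangle_ineq4]) (simp add: abs_mult)
      also have "\<dots> \<le> x * (cosh t * exp (- x * cosh t) * cosh (real n * t)) +
          real n * (exp (- x * cosh t) * cosh (real n * t))"
        using x s by (intro add_mono mult_left_mono mult_right_mono) auto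
      also have "\<dots> = x * ?k 1 t + real n * ?k 0 t" by (simp add: bessel_K_integrand_def)
      also have "\<dots> \<le> x * (M1 * exp (- (x / 2) * t)) + real n * (M0 * exp (- (x / 2) * t))"
        using x M1[OF t] M0[OF t] by (intro add_mono mult_left_mono) auto
      finally show ?thesis by (simp add: algebra_simps)
    qed
    then show "\<forall>\<^sub>F t in at_top. norm (H t) \<le> (x * M1 + real n * M0) * exp (- (x / 2) * t)"
      by (rule eventually_mono[OF eventually_ge_at_top[of 0]])
    have "((\<lambda>t. exp (- (x / 2) * t)) \<longlongrightarrow> 0) at_top"
      using x by real_asymp
    from tendsto_mult_right_zero[OF this]
    show "((\<lambda>t. (x * M1 + real n * M0) * exp (- (x / 2) * t)) \<longlongrightarrow> 0) at_top" .
  qed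
  with lim have "(LINT t:{0..}|lborel. ?f t) = 0"
    using tendsto_unique[OF trivial_limit_at_top_linorder] by blast
  moreover have "(LINT t:{0..}|lborel. ?f t) =
      x\<^sup>2 * bessel_Kj n 2 x - x * bessel_Kj n 1 x - (x\<^sup>2 + (real n)\<^sup>2) * bessel_Kj n 0 x"
    unfolding bessel_Kj_def
    by (simp only: set_integral_diff set_integral_mult_right set_integrable_mult_right ints)
  ultimately show ?thesis by simp
qed

lemma bessel_K_pair:
  fixes n :: nat
  obtains W where "bessel_system n (bessel_K n) W"
    "\<And>x. x > 0 \<Longrightarrow> 0 < bessel_K n x" "\<And>x. x > 0 \<Longrightarrow> W x < 0"
proof
  \<comment> \<open>x times the derivative of \<open>bessel_K n\<close>, because differentiation
    raises j from 0 to 1 with a minus sign.\<close>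
  let ?W = "\<lambda>x. - (x * bessel_Kj n 1 x)"
  show "0 < bessel_K n x" "?W x < 0" if "x > 0" for x
    using bessel_Kj_pos[OF that] that by (auto simp: bessel_K_eq)
  show "bessel_system n (bessel_K n) ?W"
    unfolding bessel_system_def
  proof (intro allI impI conjI)
    fix x :: real assume x: "x > 0"
    show "(bessel_K n has_real_derivative ?W x / x) (at x)"
      using bessel_Kj_derivative[OF x, of n 0] x by (simp add: bessel_K_eq)
    have "(?W has_real_derivative - (1 * bessel_Kj n 1 x + - bessel_Kj n 2 x * x)) (at x)"
      using bessel_Kj_derivative[OF x, of n 1]
      by (intro DERIV_minus DERIV_mult DERIV_ident) (simp add: numeral_2_eq_2)
    moreover have "- (1 * bessel_Kj n 1 x + - bessel_Kj n 2 x * x) = ((real n)\<^sup>2 / x + x) * bessel_K n x"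
      using bessel_Kj_ode[OF x, of n] x by (simp add: bessel_K_eq field_simps power2_eq_square)
    ultimately show "(?W has_real_derivative ((real n)\<^sup>2 / x + x) * bessel_K n x) (at x)" by simp
  qed
qed

section \<open>The one-dimensional optimum\<close>

text \<open>Near t = 0 the linear term dominates. The value t = -b / (|a| + 1) already makes the
  expression negative when b is nonzero.\<close>

lemma affine_nonneg_imp_zero:
  fixes a b :: real
  assumes "\<And>t. 0 \<le> t\<^sup>2 * a + t * b"
  shows "b = 0"
proof (rule ccontr)
  assume b: "b \<noteq> 0"
  define k where "k = \<bar>a\<bar> + 1"
  have k: "k > 0" "a < k" by (auto simp: k_def)
  have "0 \<le> (- b / k)\<^sup>2 * a + (- b / k) * b" by (rule assms)
  also have "\<dots> = b\<^sup>2 / k * (a / k - 1)" using k by (simp add: field_simps power2_eq_square)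
  also have "\<dots> < 0" using b k by (intro mult_pos_neg) auto
  finally show False by simp
qed

text \<open>The quotient attains its maximum \<open>L\<close> on the compact unit circle, and
  homogeneity extends the bound to the plane. The form L G - F is then nonnegative and zero at the
  maximizer, so its gradient vanishes there; the last two conclusions are the halves of its two
  components.\<close>

lemma quadratic_form_quotient_max:
  fixes F G :: "real \<Rightarrow> real \<Rightarrow> real"
  assumes F: "\<And>x y. F x y = f1 * x\<^sup>2 + 2 * f2 * x * y + f3 * y\<^sup>2"
    and G: "\<And>x y. G x y = g1 * x\<^sup>2 + 2 * g2 * x * y + g3 * y\<^sup>2"
    and pos: "\<And>x y. (x, y) \<noteq> (0, 0) \<Longrightarrow> 0 < G x y"
  obtains L x0 y0 where "(x0, y0) \<noteq> (0, 0)" "\<And>x y. F x y \<le> L * G x y" "F x0 y0 = L * G x0 y0"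
    "L * (g1 * x0 + g2 * y0) = f1 * x0 + f2 * y0" "L * (g2 * x0 + g3 * y0) = f2 * x0 + f3 * y0"
proof -
  let ?S = "sphere (0 :: real \<times> real) 1"
  have S0: "p \<noteq> 0" if "p \<in> ?S" for p using that by auto
  have "continuous_on ?S (\<lambda>p. F (fst p) (snd p) / G (fst p) (snd p))"
  proof (intro continuous_on_divide ballI)
    fix p assume "p \<in> ?S"
    then have "(fst p, snd p) \<noteq> (0, 0)" using S0 by (auto simp: zero_prod_def)
    then show "G (fst p) (snd p) \<noteq> 0" using pos[of "fst p" "snd p"] by auto
  qed (unfold F G, (intro continuous_intros)+)
  moreover have "(1, 0) \<in> ?S" by (simp add: norm_prod_def)
  then have "?S \<noteq> {}" by blast
  ultimately obtain p where p: "p \<in> ?S"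
    "\<And>z. z \<in> ?S \<Longrightarrow> F (fst z) (snd z) / G (fst z) (snd z) \<le> F (fst p) (snd p) / G (fst p) (snd p)"
    using continuous_attains_sup[OF compact_sphere, of 0 1] by blast
  define x0 y0 where "x0 = fst p" and "y0 = snd p"
  define L where "L = F x0 y0 / G x0 y0"
  have p0: "(x0, y0) \<noteq> (0, 0)" using S0[OF p(1)] by (auto simp: x0_def y0_def zero_prod_def)
  have eq: "F x0 y0 = L * G x0 y0" using pos[OF p0] by (simp add: L_def)
  have le: "F x y \<le> L * G x y" for x y
  proof (cases "(x, y) = (0, 0)")
    case False
    define s where "s = norm (x, y)"
    have s: "s > 0" using False by (simp add: s_def zero_prod_def[symmetric])
    have e: "(x / s, y / s) = (1 / s) *\<^sub>R (x, y)" by simp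
    have "norm (x / s, y / s) = 1" unfolding e norm_scaleR s_def[symmetric] using s by simp
    then have "(x / s, y / s) \<in> ?S" by simp
    from p(2)[OF this] have "F (x / s) (y / s) / G (x / s) (y / s) \<le> L" by (simp add: L_def x0_def y0_def)
    moreover have "F (x / s) (y / s) = F x y / s\<^sup>2" "G (x / s) (y / s) = G x y / s\<^sup>2"
      using s by (simp_all add: F G field_simps power2_eq_square)
    ultimately have "F x y / G x y \<le> L" using s by simp
    then show ?thesis using pos[OF False] by (simp add: divide_le_eq)
  qed (simp add: F G)
  have "2 * ((L * g1 - f1) * x0 + (L * g2 - f2) * y0) = 0"
  proof (rule affine_nonneg_imp_zero)
    fix t :: real
    have "0 \<le> (L * G (x0 + t) y0 - F (x0 + t) y0) - (L * G x0 y0 - F x0 y0)" using le eq by simp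
    then show "0 \<le> t\<^sup>2 * (L * g1 - f1) + t * (2 * ((L * g1 - f1) * x0 + (L * g2 - f2) * y0))"
      unfolding F G by (simp add: algebra_simps power2_eq_square)
  qed
  moreover have "2 * ((L * g2 - f2) * x0 + (L * g3 - f3) * y0) = 0"
  proof (rule affine_nonneg_imp_zero)
    fix t :: real
    have "0 \<le> (L * G x0 (y0 + t) - F x0 (y0 + t)) - (L * G x0 y0 - F x0 y0)" using le eq by simp
    then show "0 \<le> t\<^sup>2 * (L * g3 - f3) + t * (2 * ((L * g2 - f2) * x0 + (L * g3 - f3) * y0))"
      unfolding F G by (simp add: algebra_simps power2_eq_square)
  qed
  ultimately show thesis
    by (intro that[OF p0 le eq]) algebra+
qed

section \<open>Solutions of the Bessel equation between two radii\<close>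

lemma bessel_system_continuous_on:
  assumes "bessel_system n w W" "0 < a"
  shows "continuous_on {a..b} w" "continuous_on {a..b} W"
  using assms(2) DERIV_isCont[OF bessel_systemD(1)[OF assms(1)]] DERIV_isCont[OF bessel_systemD(2)[OF assms(1)]]
  by (auto intro!: continuous_at_imp_continuous_on)

text \<open>Isolates what the argument uses of the two Bessel functions: the equation and the signs,
  that is, one positive increasing and one positive decreasing solution.\<close>

locale bessel_basis =
  fixes n :: nat and I WI K WK :: "real \<Rightarrow> real"
  assumes I: "bessel_system n I WI" and K: "bessel_system n K WK"
    and I_pos: "\<And>x. x > 0 \<Longrightarrow> 0 < I x" "\<And>x. x > 0 \<Longrightarrow> 0 < WI x"
    and K_pos: "\<And>x. x > 0 \<Longrightarrow> 0 < K x" "\<And>x. x > 0 \<Longrightarrow> WK x < 0"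
begin

text \<open>From the opposite monotonicity of \<open>I\<close> and \<open>K\<close>. The strict
  inequality says that the boundary-value matrix is invertible, hence that any boundary data are
  attained by a solution.\<close>

lemma boundary_values_independent:
  assumes "0 < a" "a < b"
  shows "I a * K b < I b * K a"
proof -
  have "I a < I b"
  proof (rule DERIV_pos_imp_increasing[OF assms(2)])
    show "\<exists>y. (I has_real_derivative y) (at x) \<and> 0 < y" if "a \<le> x" "x \<le> b" for x
      using that assms bessel_systemD(1)[OF I, of x] I_pos(2)[of x] by (intro exI[of _ "WI x / x"]) auto
  qed
  moreover have "K b < K a"
  proof (rule DERIV_neg_imp_decreasing[OF assms(2)])
    show "\<exists>y. (K has_real_derivative y) (at x) \<and> y < 0" if "a \<le> x" "x \<le> b" for x
      using that assms bessel_systemD(1)[OF K, of x] K_pos(2)[of x]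
      by (intro exI[of _ "WK x / x"]) (auto simp: divide_neg_pos)
  qed
  ultimately show ?thesis using I_pos(1)[of a] K_pos(1)[of b] assms
    by (intro mult_strict_mono) auto
qed

text \<open>In the variables w and x w', the two contributions of the equation cancel in the
  derivative. The identity later makes the flux form symmetric.\<close>

lemma wronskian:
  assumes "0 < a" "a < b"
  shows "I b * WK b - K b * WI b = I a * WK a - K a * WI a"
proof (rule DERIV_isconst2[of a b "\<lambda>x. I x * WK x - K x * WI x" b])
  show "continuous_on {a..b} (\<lambda>x. I x * WK x - K x * WI x)"
    using bessel_system_continuous_on[OF I assms(1)] bessel_system_continuous_on[OF K assms(1)]
    by (intro continuous_intros)
  show "((\<lambda>x. I x * WK x - K x * WI x) has_real_derivative 0) (at x)" if "a < x" "x < b" for x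
  proof -
    have x: "x > 0" using that assms by simp
    show ?thesis
      by (rule derivative_eq_intros bessel_systemD(1,2)[OF I x] bessel_systemD(1,2)[OF K x] refl)+
         (simp add: algebra_simps)
  qed
qed (use assms in auto)

definition sol :: "real \<Rightarrow> real \<Rightarrow> real \<Rightarrow> real" where
  "sol c d x = c * I x + d * K x"

definition sol' :: "real \<Rightarrow> real \<Rightarrow> real \<Rightarrow> real" where
  "sol' c d x = c * WI x + d * WK x"

lemma bessel_system_sol: "bessel_system n (sol c d) (sol' c d)"
  unfolding sol_def sol'_def by (rule bessel_system_linear[OF I K])

text \<open>The derivative of w W is W^2/x + (n^2/x + x) w^2, the energy density. It is positive
  because w and W have no common zero; hence the flux difference is a positive definite form in (c,
  d).\<close>

lemma sol_flux_increasing: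
  assumes "0 < a" "a < b" "(c, d) \<noteq> (0, 0)"
  shows "sol c d a * sol' c d a < sol c d b * sol' c d b"
proof (rule DERIV_pos_imp_increasing[OF assms(2)])
  fix x assume "a \<le> x" "x \<le> b"
  then have x: "x > 0" using assms by simp
  let ?w = "sol c d x" and ?W = "sol' c d x"
  \<comment> \<open>A common zero would be a kernel vector of the matrix of \<open>I\<close>,
    \<open>K\<close> and their fluxes, whose determinant is negative by the sign
    assumptions.\<close>
  have nz: "?w \<noteq> 0 \<or> ?W \<noteq> 0"
  proof (rule ccontr)
    assume "\<not> ?thesis"
    then have 0: "c * I x + d * K x = 0" "c * WI x + d * WK x = 0" by (auto simp: sol_def sol'_def)
    have "c * (I x * WK x - K x * WI x) = (c * I x + d * K x) * WK x - (c * WI x + d * WK x) * K x"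
      by (simp add: algebra_simps)
    then have c: "c * (I x * WK x - K x * WI x) = 0" by (simp add: 0)
    have "d * (I x * WK x - K x * WI x) = (c * WI x + d * WK x) * I x - (c * I x + d * K x) * WI x"
      by (simp add: algebra_simps)
    then have d: "d * (I x * WK x - K x * WI x) = 0" by (simp add: 0)
    have "I x * WK x < 0" "0 < K x * WI x"
      using I_pos[OF x] K_pos[OF x] by (auto simp: mult_pos_neg)
    then have "I x * WK x - K x * WI x \<noteq> 0" by simp
    then show False using c d assms(3) by simp
  qed
  have "((\<lambda>x. sol c d x * sol' c d x) has_real_derivative
      ?W / x * ?W + ((real n)\<^sup>2 / x + x) * ?w * ?w) (at x)"
    using DERIV_mult[OF bessel_systemD(1,2)[OF bessel_system_sol x]] .
  moreover have "0 < ?W / x * ?W + ((real n)\<^sup>2 / x + x) * ?w * ?w"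
  proof -
    have "0 \<le> ?W / x * ?W" "0 \<le> ((real n)\<^sup>2 / x + x) * ?w * ?w"
      using x by (auto simp: mult.assoc)
    moreover have "?W / x * ?W > 0 \<or> ((real n)\<^sup>2 / x + x) * ?w * ?w > 0"
    proof (cases "?w = 0")
      case True
      then have "?W * ?W > 0" using nz by (auto simp: zero_less_mult_iff)
      then show ?thesis using x by simp
    next
      case False
      then have "?w * ?w > 0" by (auto simp: zero_less_mult_iff)
      moreover have "(real n)\<^sup>2 / x + x > 0" using x by (intro add_nonneg_pos) auto
      ultimately show ?thesis by (simp add: mult.assoc)
    qed
    ultimately show ?thesis by linarith
  qed
  ultimately show "\<exists>y. ((\<lambda>x. sol c d x * sol' c d x) has_real_derivative y) (at x) \<and> 0 < y" by blast
qed

text \<open>Determinant, in the coefficients (c, d), of the Robin conditions A w + L W = 0 at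
  \<open>a\<close> and C w - L W = 0 at \<open>b\<close>. The opposite signs reflect the outward
  normals.\<close>

definition robin_det :: "real \<Rightarrow> real \<Rightarrow> real \<Rightarrow> real \<Rightarrow> real \<Rightarrow> real" where
  "robin_det a b A C L =
     (A * I a + L * WI a) * (C * K b - L * WK b) - (A * K a + L * WK a) * (C * I b - L * WI b)"

text \<open>The gradient condition at the maximizer is the pair of Robin conditions, seen through
  the invertible matrix of boundary values. Conversely, multiplying the Robin conditions for any
  root L' by w(a) and w(b) gives F = L' G at a nonzero point, so L' is a value of the
  quotient.\<close>

lemma robin_quotient_max:
  assumes ab: "0 < a" "a < b" and AC: "0 \<le> A" "0 \<le> C"
  obtains L c d where "0 \<le> L" "(c, d) \<noteq> (0, 0)"
    "\<And>x y. A * (sol x y a)\<^sup>2 + C * (sol x y b)\<^sup>2 \<le> L * (sol x y b * sol' x y b - sol x y a * sol' x y a)"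
    "A * (sol c d a)\<^sup>2 + C * (sol c d b)\<^sup>2 = L * (sol c d b * sol' c d b - sol c d a * sol' c d a)"
    "robin_det a b A C L = 0" "\<And>L'. robin_det a b A C L' = 0 \<Longrightarrow> L' \<le> L"
proof -
  define F where "F = (\<lambda>x y. A * (sol x y a)\<^sup>2 + C * (sol x y b)\<^sup>2)"
  define G where "G = (\<lambda>x y. sol x y b * sol' x y b - sol x y a * sol' x y a)"
  have Gpos: "0 < G x y" if "(x, y) \<noteq> (0, 0)" for x y
    using sol_flux_increasing[OF ab that] by (simp add: G_def)
  note wr = wronskian[OF ab]
  have F: "F x y = (A * (I a)\<^sup>2 + C * (I b)\<^sup>2) * x\<^sup>2 + 2 * (A * I a * K a + C * I b * K b) * x * y
      + (A * (K a)\<^sup>2 + C * (K b)\<^sup>2) * y\<^sup>2" for x y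
    unfolding F_def sol_def power2_eq_square by algebra
  have G: "G x y = (I b * WI b - I a * WI a) * x\<^sup>2 + 2 * (I b * WK b - I a * WK a) * x * y
      + (K b * WK b - K a * WK a) * y\<^sup>2" for x y
  proof -
    \<comment> \<open>Expanding \<open>G\<close> yields two different mixed coefficients; the
      Wronskian identity says they are equal.\<close>
    have "I b * WK b - I a * WK a = K b * WI b - K a * WI a" using wr by simp
    then have "2 * (I b * WK b - I a * WK a) = (I b * WK b - I a * WK a) + (K b * WI b - K a * WI a)" by simp
    then show ?thesis unfolding G_def sol_def sol'_def power2_eq_square by (simp only:) (simp add: algebra_simps)
  qed
  obtain L c d where L: "(c, d) \<noteq> (0, 0)" "\<And>x y. F x y \<le> L * G x y" "F c d = L * G c d"
    "L * ((I b * WI b - I a * WI a) * c + (I b * WK b - I a * WK a) * d)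
       = (A * (I a)\<^sup>2 + C * (I b)\<^sup>2) * c + (A * I a * K a + C * I b * K b) * d"
    "L * ((I b * WK b - I a * WK a) * c + (K b * WK b - K a * WK a) * d)
       = (A * I a * K a + C * I b * K b) * c + (A * (K a)\<^sup>2 + C * (K b)\<^sup>2) * d"
    by (rule quadratic_form_quotient_max[where F = F and G = G, OF F G Gpos]) (assumption | rule that)+
  \<comment> \<open>\<open>U\<close> and \<open>V\<close> are the defects in the Robin conditions at
    \<open>a\<close> and \<open>b\<close>. The gradient equations become a homogeneous system for
    them with nonzero determinant.\<close>
  define U where "U = A * sol c d a + L * sol' c d a"
  define V where "V = C * sol c d b - L * sol' c d b"
  have 1: "I b * V + I a * U = 0"
    using L(4) unfolding U_def V_def sol_def sol'_def power2_eq_square by algebra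
  have 2: "K b * V + K a * U = 0"
    using L(5) wr unfolding U_def V_def sol_def sol'_def power2_eq_square by algebra
  have ind: "I b * K a - I a * K b \<noteq> 0" using boundary_values_independent[OF ab] by simp
  have "V * (I b * K a - I a * K b) = 0" "U * (I b * K a - I a * K b) = 0"
    using 1 2 by algebra+
  then have UV: "U = 0" "V = 0" using ind by auto
  have det: "robin_det a b A C L = 0"
  proof -
    have u: "(A * I a + L * WI a) * c + (A * K a + L * WK a) * d = 0"
      using UV(1) by (simp add: U_def sol_def sol'_def algebra_simps)
    have v: "(C * I b - L * WI b) * c + (C * K b - L * WK b) * d = 0"
      using UV(2) by (simp add: V_def sol_def sol'_def algebra_simps)
    have "robin_det a b A C L * c = 0" "robin_det a b A C L * d = 0"
      unfolding robin_det_def using u v by algebra+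
    then show ?thesis using L(1) by auto
  qed
  have max: "L' \<le> L" if det: "robin_det a b A C L' = 0" for L'
  proof -
    \<comment> \<open>The rows (p, q) and (r, s) are the Robin conditions for L'. Vanishing of the
      determinant leaves a common kernel vector, read off from whichever row is nonzero.\<close>
    define p q r s where "p = A * I a + L' * WI a" and "q = A * K a + L' * WK a"
      and "r = C * I b - L' * WI b" and "s = C * K b - L' * WK b"
    have ps: "p * s - q * r = 0" using det by (simp add: robin_det_def p_def q_def r_def s_def)
    have "\<exists>x y. (x, y) \<noteq> (0, 0) \<and> p * x + q * y = 0 \<and> r * x + s * y = 0"
    proof (cases "(p, q) = (0, 0)")
      case False
      then show ?thesis using ps by (intro exI[of _ q] exI[of _ "- p"]) (auto simp: algebra_simps)
    next
      case True
      show ?thesis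
      proof (cases "(r, s) = (0, 0)")
        case True
        then show ?thesis using \<open>(p, q) = (0, 0)\<close> by (intro exI[of _ 1]) auto
      next
        case False
        then show ?thesis using True by (intro exI[of _ s] exI[of _ "- r"]) auto
      qed
    qed
    then obtain x y where xy: "(x, y) \<noteq> (0, 0)" "p * x + q * y = 0" "r * x + s * y = 0" by blast
    have "A * sol x y a + L' * sol' x y a = 0" "C * sol x y b - L' * sol' x y b = 0"
      using xy(2,3) by (simp_all add: p_def q_def r_def s_def sol_def sol'_def algebra_simps)
    then have "F x y = L' * G x y"
      unfolding F_def G_def power2_eq_square by algebra
    then have "L' * G x y \<le> L * G x y" using L(2)[of x y] by simp
    then show ?thesis using Gpos[OF xy(1)] by simp
  qed
  have "0 \<le> F c d" using AC by (simp add: F_def)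
  then have "0 \<le> L" using L(3) Gpos[OF L(1)] by (simp add: zero_le_mult_iff)
  then show thesis using L(1-3) det max by (intro that[of L c d]) (auto simp: F_def G_def)
qed

end

lemma bessel_basis_I_K:
  obtains WI WK where "bessel_basis n (bessel_I n) WI (bessel_K n) WK"
  using bessel_I_pair[of n] bessel_K_pair[of n] that unfolding bessel_basis_def by metis

section \<open>Integrals over open intervals and the radial energy\<close>

lemma set_integrable_mult_continuous:
  fixes f h :: "real \<Rightarrow> 'b::{real_normed_field, banach, second_countable_topology}"
  assumes f: "set_integrable lborel {a<..<b} f" and h: "continuous_on {a..b} h"
  shows "set_integrable lborel {a<..<b} (\<lambda>x. f x * h x)"
proof -
  have "integrable lborel (\<lambda>x. indicator {a..b} x *\<^sub>R h x)"
    by (rule borel_integrable_compact[OF compact_Icc h])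
  then have hm: "(\<lambda>x. indicator {a..b} x *\<^sub>R h x) \<in> borel_measurable lborel"
    by (rule borel_measurable_integrable)
  obtain B where B: "\<And>x. x \<in> {a..b} \<Longrightarrow> norm (h x) \<le> B"
    using compact_imp_bounded[OF compact_continuous_image[OF h compact_Icc]]
    unfolding bounded_iff by blast
  let ?f = "\<lambda>x. indicator {a<..<b} x *\<^sub>R f x"
  have fi: "integrable lborel ?f" using f by (simp add: set_integrable_def)
  have eq: "indicator {a<..<b} x *\<^sub>R (f x * h x) = ?f x * (indicator {a..b} x *\<^sub>R h x)" for x
    by (auto simp: indicator_def)
  show ?thesis
    unfolding set_integrable_def eq
  proof (rule Bochner_Integration.integrable_bound)
    show "integrable lborel (\<lambda>x. \<bar>B\<bar> * norm (?f x))" using fi by (intro integrable_mult_right integrable_norm)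
    show "(\<lambda>x. ?f x * (indicator {a..b} x *\<^sub>R h x)) \<in> borel_measurable lborel"
      using fi hm by (intro borel_measurable_times) (auto dest: borel_measurable_integrable)
    have "norm (?f x * (indicator {a..b} x *\<^sub>R h x)) \<le> norm (\<bar>B\<bar> * norm (?f x))" for x
    proof (cases "x \<in> {a<..<b}")
      case True
      then have "norm (h x) \<le> \<bar>B\<bar>" using B[of x] by auto
      then have "norm (f x) * norm (h x) \<le> norm (f x) * \<bar>B\<bar>" by (rule mult_left_mono) simp
      then show ?thesis using True by (simp add: norm_mult mult.commute)
    qed simp
    then show "AE x in lborel. norm (?f x * (indicator {a..b} x *\<^sub>R h x)) \<le> norm (\<bar>B\<bar> * norm (?f x))" by simp
  qed
qed

lemma set_integrable_continuous_Ioo: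
  fixes h :: "real \<Rightarrow> 'b::{banach, second_countable_topology}"
  assumes "continuous_on {a..b} h"
  shows "set_integrable lborel {a<..<b} h"
  by (rule set_integrable_subset[of _ "{a..b}"])
     (use borel_integrable_compact[OF compact_Icc assms] in \<open>auto simp: set_integrable_def\<close>)

lemma integral_Ioo_FTC:
  fixes f :: "real \<Rightarrow> 'b::euclidean_space"
  assumes "a < b" "\<And>x. x \<in> {a..b} \<Longrightarrow> (f has_vector_derivative f' x) (at x within {a..b})"
    "continuous_on {a..b} f'"
  shows "(LINT x:{a<..<b}|lborel. f' x) = f b - f a"
proof -
  have "(LINT x:{a<..<b}|lborel. f' x) = integral {a<..<b} f'"
    by (rule set_borel_integral_eq_integral[OF set_integrable_continuous_Ioo[OF assms(3)]])
  also have "\<dots> = integral {a..b} f'" by (rule integral_open_interval_real[symmetric])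
  also have "\<dots> = f b - f a"
    by (rule integral_unique, rule fundamental_theorem_of_calculus) (use assms in auto)
  finally show ?thesis .
qed

lemma set_borel_measurable_continuous_Ioo:
  fixes h :: "real \<Rightarrow> 'b::{banach, second_countable_topology}"
  assumes "continuous_on {a..b} h"
  shows "set_borel_measurable lborel {a<..<b} h"
  using set_integrable_continuous_Ioo[OF assms]
  by (auto simp: set_integrable_def set_borel_measurable_def)

lemma L2_continuous_Ioo:
  fixes u :: "real \<Rightarrow> complex"
  assumes "continuous_on {a..b} u"
  shows "L2 {a<..<b} u"
  unfolding L2_def
  by (intro conjI set_borel_measurable_continuous_Ioo set_integrable_continuous_Ioo continuous_intros assms)

lemma L2_AE_cong:
  assumes "L2 \<Omega> u" "set_borel_measurable lborel \<Omega> v" "AE x in lborel. x \<in> \<Omega> \<longrightarrow> u x = v x"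
  shows "L2 \<Omega> v"
proof -
  have m: "(\<lambda>x. indicator \<Omega> x *\<^sub>R v x) \<in> borel_measurable lborel"
    using assms(2) by (simp add: set_borel_measurable_def)
  have "(\<lambda>x. (cmod (indicator \<Omega> x *\<^sub>R v x))\<^sup>2) \<in> borel_measurable lborel"
    using m by measurable
  moreover have "(cmod (indicator \<Omega> x *\<^sub>R v x))\<^sup>2 = indicator \<Omega> x *\<^sub>R (cmod (v x))\<^sup>2" for x
    by (auto simp: indicator_def)
  ultimately have m2: "(\<lambda>x. indicator \<Omega> x *\<^sub>R (cmod (v x))\<^sup>2) \<in> borel_measurable lborel" by simp
  have ae: "AE x in lborel. indicator \<Omega> x *\<^sub>R (cmod (u x))\<^sup>2 = indicator \<Omega> x *\<^sub>R (cmod (v x))\<^sup>2"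
    using assms(3) by eventually_elim (auto simp: indicator_def)
  have "integrable lborel (\<lambda>x. indicator \<Omega> x *\<^sub>R (cmod (u x))\<^sup>2)"
    using assms(1) by (simp add: L2_def set_integrable_def)
  then have "integrable lborel (\<lambda>x. indicator \<Omega> x *\<^sub>R (cmod (v x))\<^sup>2)"
    using integrable_cong_AE_imp[OF _ m2 ae] by blast
  then show ?thesis using assms(2) by (simp add: L2_def set_integrable_def)
qed

text \<open>The integrand of \<open>energy_form\<close> without the factor 2 pi. The derivative is a
  separate argument so that any weak derivative may be inserted.\<close>

definition radial_energy_density :: "int \<Rightarrow> (real \<Rightarrow> complex) \<Rightarrow> (real \<Rightarrow> complex) \<Rightarrow> real \<Rightarrow> real" where
  "radial_energy_density q g v r =
     ((cmod (g r))\<^sup>2 + (of_int q)\<^sup>2 / r\<^sup>2 * (cmod (v r))\<^sup>2 + (cmod (v r))\<^sup>2) * r"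

lemma set_integrable_radial_energy_density:
  fixes v g :: "real \<Rightarrow> complex"
  assumes "0 < a" "L2 {a<..<b} g" "L2 {a<..<b} v"
  shows "set_integrable lborel {a<..<b} (radial_energy_density q g v)"
proof -
  have i: "set_integrable lborel {a<..<b} (\<lambda>r. (cmod (g r))\<^sup>2)" "set_integrable lborel {a<..<b} (\<lambda>r. (cmod (v r))\<^sup>2)"
    using assms by (auto simp: L2_def)
  have c: "continuous_on {a..b} (\<lambda>r. ((of_int q)\<^sup>2 / r\<^sup>2 + 1) * r :: real)"
    using assms(1) by (intro continuous_intros) auto
  have "set_integrable lborel {a<..<b} (\<lambda>r. (cmod (g r))\<^sup>2 * r + (cmod (v r))\<^sup>2 * (((of_int q)\<^sup>2 / r\<^sup>2 + 1) * r))"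
    by (intro set_integral_add set_integrable_mult_continuous i c continuous_intros)
  then show ?thesis
    by (simp add: radial_energy_density_def[abs_def] algebra_simps)
qed

text \<open>Frees the energy from the choice hidden in \<open>weak_deriv\<close>.\<close>

lemma energy_form_eq:
  fixes v g :: "real \<Rightarrow> complex"
  assumes ab: "0 < a" "a < b" and v: "L2 {a<..<b} v" and g: "is_L2_weak_deriv {a<..<b} 1 v g"
  shows "energy_form a b q v = 2 * pi * (LINT r:{a<..<b}|lborel. radial_energy_density q g v r)"
proof -
  let ?h = "weak_deriv {a<..<b} 1 v"
  have h: "is_L2_weak_deriv {a<..<b} 1 v ?h"
    unfolding weak_deriv_def by (rule someI[of _ g]) (rule g)
  have m: "set_borel_measurable lborel {a<..<b} (radial_energy_density q f v)" if "L2 {a<..<b} f" for f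
    using set_integrable_radial_energy_density[OF ab(1) that v]
    by (auto simp: set_integrable_def set_borel_measurable_def)
  have ae: "AE x in lborel. x \<in> {a<..<b} \<longrightarrow> ?h x = g x"
    using ab by (intro weak_deriv_AE_eq[OF _ _ g]) auto
  have "(LINT r:{a<..<b}|lborel. radial_energy_density q ?h v r) = (LINT r:{a<..<b}|lborel. radial_energy_density q g v r)"
  proof (rule set_integral_cong_AE_borel)
    show "AE x in lborel. x \<in> {a<..<b} \<longrightarrow> radial_energy_density q ?h v x = radial_energy_density q g v x"
      using ae by eventually_elim (auto simp: radial_energy_density_def)
  qed (use m g h in \<open>auto simp: is_L2_weak_deriv_def\<close>)
  then show ?thesis by (simp add: energy_form_def radial_energy_density_def)
qed

text \<open>
  A solution \<open>w\<close> of the Bessel equation calibrates the energy: completing the square and one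
  integration by parts against \<open>r w'\<close> show that it minimizes it for its own boundary values.
\<close>

lemma energy_ge_calibration:
  fixes w W v g :: "real \<Rightarrow> complex"
  assumes ab: "0 < a" "a < b" and v: "L2 {a<..<b} v" and g: "is_L2_weak_deriv {a<..<b} 1 v g"
    and w: "\<And>x. x \<in> {a..b} \<Longrightarrow> (w has_vector_derivative W x / of_real x) (at x within {a..b})"
    and W: "\<And>x. x \<in> {a..b} \<Longrightarrow>
      (W has_vector_derivative of_real ((of_int q)\<^sup>2 / x + x) * w x) (at x within {a..b})"
    and bd: "cont_rep a b v a = w a" "cont_rep a b v b = w b"
  shows "Re (w b * cnj (W b)) - Re (w a * cnj (W a)) \<le> (LINT r:{a<..<b}|lborel. radial_energy_density q g v r)"
proof -
  let ?m = "\<lambda>x. (of_int q)\<^sup>2 / x + x :: real"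
  let ?I = "{a<..<b}"
  have cw: "continuous_on {a..b} w" and cW: "continuous_on {a..b} W"
    unfolding continuous_on_eq_continuous_within
    using has_vector_derivative_continuous[OF w] has_vector_derivative_continuous[OF W] by blast+
  have x0: "x \<noteq> 0" if "x \<in> {a..b}" for x using that ab by auto
  have cm: "continuous_on {a..b} ?m" using x0 by (intro continuous_intros) auto
  have L2g: "L2 ?I g" using g by (simp add: is_L2_weak_deriv_def)
  obtain V where V: "is_cont_rep a b v V" and parts:
    "\<And>\<psi> \<psi>'. (\<And>x. x \<in> {a..b} \<Longrightarrow> (\<psi> has_vector_derivative \<psi>' x) (at x within {a..b})) \<Longrightarrow>
      continuous_on {a..b} \<psi>' \<Longrightarrow>
      (LINT x:?I|lborel. g x * \<psi> x) + (LINT x:?I|lborel. v x * \<psi>' x) = V b * \<psi> b - V a * \<psi> a"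
    using H1_interval_cont_rep[OF ab(2) v g] by blast
  have Vab: "V a = w a" "V b = w b"
    using cont_rep_eq[OF ab(2) V] bd ab by auto
  \<comment> \<open>The flux of \<open>w\<close>, conjugated. By the Bessel equation its derivative
    is the potential times the conjugate of \<open>w\<close>, so integration by parts pairs
    \<open>v\<close> with \<open>w\<close> in the energy inner product.\<close>
  define \<psi> \<psi>' where "\<psi> = (\<lambda>x. cnj (W x))" and "\<psi>' = (\<lambda>x. of_real (?m x) * cnj (w x))"
  have \<psi>: "(\<psi> has_vector_derivative \<psi>' x) (at x within {a..b})" if "x \<in> {a..b}" for x
    using has_vector_derivative_cnj[OF W[OF that]] by (simp add: \<psi>_def \<psi>'_def)
  have c\<psi>: "continuous_on {a..b} \<psi>" "continuous_on {a..b} \<psi>'"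
    unfolding \<psi>_def \<psi>'_def by (intro continuous_intros cw cW cm)+
  define Z where "Z = w b * cnj (W b) - w a * cnj (W a)"
  have si: "set_integrable lborel ?I v" "set_integrable lborel ?I g"
    using v L2g ab by (auto intro!: set_integrable_L2)
  have i1: "set_integrable lborel ?I (\<lambda>x. g x * \<psi> x)" "set_integrable lborel ?I (\<lambda>x. v x * \<psi>' x)"
    using si c\<psi> by (auto intro: set_integrable_mult_continuous)
  have X: "(LINT x:?I|lborel. g x * \<psi> x + v x * \<psi>' x) = Z"
    using parts[OF \<psi> c\<psi>(2)] i1 by (simp add: Vab Z_def \<psi>_def)
  \<comment> \<open>The energy density of \<open>w\<close> itself. It integrates to the same
    boundary term \<open>Z\<close> as the mixed pairing, because \<open>v\<close> and
    \<open>w\<close> agree at the endpoints.\<close>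
  define P where "P = (\<lambda>x. (cmod (W x))\<^sup>2 / x + ?m x * (cmod (w x))\<^sup>2)"
  have cP: "continuous_on {a..b} P"
    unfolding P_def using x0 by (intro continuous_intros cw cW cm) auto
  have PZ: "complex_of_real (LINT x:?I|lborel. P x) = Z"
  proof -
    have "(LINT x:?I|lborel. complex_of_real (P x)) = w b * \<psi> b - w a * \<psi> a"
    proof (rule integral_Ioo_FTC[OF ab(2), of "\<lambda>x. w x * \<psi> x"])
      fix x assume x: "x \<in> {a..b}"
      have "((\<lambda>x. w x * \<psi> x) has_vector_derivative w x * \<psi>' x + (W x / of_real x) * \<psi> x) (at x within {a..b})"
        by (rule has_vector_derivative_mult[OF w[OF x] \<psi>[OF x]])
      moreover have "w x * \<psi>' x + (W x / of_real x) * \<psi> x = of_real (P x)"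
      proof -
        have "(complex_of_real (cmod z))\<^sup>2 = z * cnj z" for z using complex_norm_square[of z] by simp
        then show ?thesis by (simp add: P_def \<psi>_def \<psi>'_def mult_ac)
      qed
      ultimately show "((\<lambda>x. w x * \<psi> x) has_vector_derivative of_real (P x)) (at x within {a..b})" by simp
    qed (intro continuous_intros cP)
    moreover have "(LINT x:?I|lborel. complex_of_real (P x)) = of_real (LINT x:?I|lborel. P x)"
      by (simp add: set_integral_complex_of_real)
    ultimately show ?thesis by (simp add: Z_def \<psi>_def)
  qed
  have iX: "set_integrable lborel ?I (\<lambda>x. Re (g x * \<psi> x + v x * \<psi>' x))"
  proof -
    have "integrable lborel (\<lambda>x. Re (indicator ?I x *\<^sub>R (g x * \<psi> x + v x * \<psi>' x)))"
      using set_integral_add(1)[OF i1] unfolding set_integrable_def by (rule integrable_Re)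
    then show ?thesis by (simp add: set_integrable_def)
  qed
  have ReX: "(LINT x:?I|lborel. Re (g x * \<psi> x + v x * \<psi>' x)) = Re Z"
  proof -
    have "Re (LINT x|lborel. indicator ?I x *\<^sub>R (g x * \<psi> x + v x * \<psi>' x)) =
        (LINT x|lborel. Re (indicator ?I x *\<^sub>R (g x * \<psi> x + v x * \<psi>' x)))"
      using set_integral_add(1)[OF i1] unfolding set_integrable_def by (rule integral_Re[symmetric])
    then show ?thesis using X by (simp add: set_lebesgue_integral_def)
  qed
  have iP: "set_integrable lborel ?I P" by (rule set_integrable_continuous_Ioo[OF cP])
  \<comment> \<open>Written as 2 Z - Z, the boundary term becomes twice the mixed pairing minus the
    energy of \<open>w\<close>; the pointwise inequality 2 <v, w> - |w|^2 \<le> |v|^2 then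
    finishes.\<close>
  have "Re Z = (LINT x:?I|lborel. 2 * Re (g x * \<psi> x + v x * \<psi>' x) - P x)"
  proof -
    have "(LINT x:?I|lborel. P x) = Re Z" unfolding PZ[symmetric] by simp
    moreover have "(LINT x:?I|lborel. 2 * Re (g x * \<psi> x + v x * \<psi>' x) - P x) =
        2 * (LINT x:?I|lborel. Re (g x * \<psi> x + v x * \<psi>' x)) - (LINT x:?I|lborel. P x)"
      by (subst set_integral_diff(2)[OF _ iP]) (use iX in \<open>auto simp only: set_integral_mult_right set_integrable_mult_right\<close>)
    ultimately show ?thesis unfolding ReX by simp
  qed
  also have "\<dots> \<le> (LINT x:?I|lborel. radial_energy_density q g v x)"
  proof (rule set_integral_mono)
    show "set_integrable lborel ?I (\<lambda>x. 2 * Re (g x * \<psi> x + v x * \<psi>' x) - P x)"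
      using iX iP by (intro set_integral_diff set_integrable_mult_right)
    show "set_integrable lborel ?I (radial_energy_density q g v)"
      by (rule set_integrable_radial_energy_density[OF ab(1) L2g v])
    fix x assume "x \<in> ?I"
    then have x: "x > 0" using ab by simp
    have sq: "2 * Re (y * cnj z) \<le> (cmod y)\<^sup>2 + (cmod z)\<^sup>2" for y z
    proof -
      have "0 \<le> (Re y - Re z)\<^sup>2 + (Im y - Im z)\<^sup>2" by simp
      then show ?thesis unfolding cmod_power2 by (simp add: power2_eq_square algebra_simps)
    qed
    \<comment> \<open>The square is completed with weights x and 1/x, because \<open>W\<close> is x
      times the derivative of \<open>w\<close>.\<close>
    have "2 * Re (g x * \<psi> x) \<le> (cmod (g x))\<^sup>2 * x + (cmod (W x))\<^sup>2 / x"
    proof -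
      have "2 * Re ((of_real x * g x) * cnj (W x)) \<le> (cmod (of_real x * g x))\<^sup>2 + (cmod (W x))\<^sup>2" by (rule sq)
      then have "(2 * Re (g x * \<psi> x)) * x \<le> ((cmod (g x))\<^sup>2 * x + (cmod (W x))\<^sup>2 / x) * x"
        using x by (simp add: \<psi>_def norm_mult power_mult_distrib power2_eq_square algebra_simps)
      then show ?thesis using x by simp
    qed
    moreover have "2 * Re (v x * \<psi>' x) \<le> ?m x * (cmod (v x))\<^sup>2 + ?m x * (cmod (w x))\<^sup>2"
    proof -
      have m0: "0 \<le> ?m x" using x by simp
      have "?m x * (2 * Re (v x * cnj (w x))) \<le> ?m x * ((cmod (v x))\<^sup>2 + (cmod (w x))\<^sup>2)"
        by (rule mult_left_mono[OF sq m0])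
      moreover have "Re (v x * \<psi>' x) = ?m x * Re (v x * cnj (w x))"
      proof -
        have "v x * \<psi>' x = of_real (?m x) * (v x * cnj (w x))" by (simp add: \<psi>'_def mult_ac)
        then show ?thesis by (simp only: scaleR_conv_of_real[symmetric] scaleR_complex.sel)
      qed
      ultimately show ?thesis by (simp add: algebra_simps)
    qed
    moreover have "radial_energy_density q g v x = (cmod (g x))\<^sup>2 * x + ?m x * (cmod (v x))\<^sup>2"
      using x by (simp add: radial_energy_density_def field_simps power2_eq_square)
    ultimately show "2 * Re (g x * \<psi> x + v x * \<psi>' x) - P x \<le> radial_energy_density q g v x"
      unfolding P_def plus_complex.sel distrib_left by linarith
  qed
  finally show ?thesis by (simp add: Z_def)
qed


section \<open>Energy bounds for given boundary values, and their attainment\<close>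

context bessel_basis
begin

lemma sol_has_vector_derivative:
  assumes "0 < a" "x \<in> {a..b}"
  shows "((\<lambda>x. complex_of_real (sol c d x)) has_vector_derivative of_real (sol' c d x) / of_real x) (at x within S)"
    "((\<lambda>x. complex_of_real (sol' c d x)) has_vector_derivative
       of_real ((real n)\<^sup>2 / x + x) * of_real (sol c d x)) (at x within S)"
proof -
  have x: "x > 0" using assms by simp
  note D = bessel_systemD(1,2)[OF bessel_system_sol[of c d] x,
      THEN has_vector_derivative_of_real, THEN has_vector_derivative_at_within]
  show "((\<lambda>x. complex_of_real (sol c d x)) has_vector_derivative of_real (sol' c d x) / of_real x) (at x within S)"
    unfolding of_real_divide[symmetric] by (rule D(1))
  show "((\<lambda>x. complex_of_real (sol' c d x)) has_vector_derivative
       of_real ((real n)\<^sup>2 / x + x) * of_real (sol c d x)) (at x within S)"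
    unfolding of_real_mult[symmetric] by (rule D(2))
qed

text \<open>Cramer's rule; the denominator is nonzero by
  \<open>boundary_values_independent\<close>.\<close>

lemma sol_interpolates:
  assumes "0 < a" "a < b"
  obtains c d where "sol c d a = \<alpha>" "sol c d b = \<beta>"
proof
  let ?D = "I b * K a - I a * K b"
  have D: "?D \<noteq> 0" using boundary_values_independent[OF assms] by simp
  have e: "(\<beta> * K a - \<alpha> * K b) * I a + (\<alpha> * I b - \<beta> * I a) * K a = \<alpha> * ?D"
    "(\<beta> * K a - \<alpha> * K b) * I b + (\<alpha> * I b - \<beta> * I a) * K b = \<beta> * ?D"
    by (simp_all add: algebra_simps)
  show "sol ((\<beta> * K a - \<alpha> * K b) / ?D) ((\<alpha> * I b - \<beta> * I a) / ?D) a = \<alpha>"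
    "sol ((\<beta> * K a - \<alpha> * K b) / ?D) ((\<alpha> * I b - \<beta> * I a) / ?D) b = \<beta>"
    by (simp_all only: sol_def times_divide_eq_left add_divide_distrib[symmetric] e nonzero_mult_div_cancel_right[OF D])
qed

text \<open>Since \<open>sol\<close> is real, the real and imaginary parts of the boundary values
  are interpolated separately. The real part of w times the conjugate of W splits accordingly into
  two real fluxes.\<close>

lemma energy_ge_flux:
  fixes v g :: "real \<Rightarrow> complex"
  assumes ab: "0 < a" "a < b" and v: "L2 {a<..<b} v" and g: "is_L2_weak_deriv {a<..<b} 1 v g"
    and q: "n = nat \<bar>q\<bar>"
  obtains c1 d1 c2 d2 where "cont_rep a b v a = Complex (sol c1 d1 a) (sol c2 d2 a)"
    "cont_rep a b v b = Complex (sol c1 d1 b) (sol c2 d2 b)"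
    "(sol c1 d1 b * sol' c1 d1 b - sol c1 d1 a * sol' c1 d1 a) +
     (sol c2 d2 b * sol' c2 d2 b - sol c2 d2 a * sol' c2 d2 a)
       \<le> (LINT r:{a<..<b}|lborel. radial_energy_density q g v r)"
proof -
  let ?\<alpha> = "cont_rep a b v a" and ?\<beta> = "cont_rep a b v b"
  have qn: "(real n)\<^sup>2 = (of_int q)\<^sup>2" by (simp add: q)
  obtain c1 d1 where 1: "sol c1 d1 a = Re ?\<alpha>" "sol c1 d1 b = Re ?\<beta>" using sol_interpolates[OF ab] by metis
  obtain c2 d2 where 2: "sol c2 d2 a = Im ?\<alpha>" "sol c2 d2 b = Im ?\<beta>" using sol_interpolates[OF ab] by metis
  define w W where "w = (\<lambda>x. complex_of_real (sol c1 d1 x) + \<i> * complex_of_real (sol c2 d2 x))"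
    and "W = (\<lambda>x. complex_of_real (sol' c1 d1 x) + \<i> * complex_of_real (sol' c2 d2 x))"
  have "Re (w b * cnj (W b)) - Re (w a * cnj (W a)) \<le> (LINT r:{a<..<b}|lborel. radial_energy_density q g v r)"
  proof (rule energy_ge_calibration[OF ab v g])
    fix x assume x: "x \<in> {a..b}"
    note s = sol_has_vector_derivative[OF ab(1) x, where S = "{a..b}"]
    have "(w has_vector_derivative of_real (sol' c1 d1 x) / of_real x + \<i> * (of_real (sol' c2 d2 x) / of_real x)) (at x within {a..b})"
      unfolding w_def by (intro has_vector_derivative_add has_vector_derivative_mult_right s)
    then show "(w has_vector_derivative W x / of_real x) (at x within {a..b})"
      by (simp add: W_def add_divide_distrib)
    have "(W has_vector_derivative of_real ((real n)\<^sup>2 / x + x) * of_real (sol c1 d1 x) +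
        \<i> * (of_real ((real n)\<^sup>2 / x + x) * of_real (sol c2 d2 x))) (at x within {a..b})"
      unfolding W_def by (intro has_vector_derivative_add has_vector_derivative_mult_right s)
    moreover have "of_real ((real n)\<^sup>2 / x + x) * of_real (sol c1 d1 x) +
        \<i> * (of_real ((real n)\<^sup>2 / x + x) * of_real (sol c2 d2 x)) = of_real ((of_int q)\<^sup>2 / x + x) * w x"
      unfolding w_def qn by (simp only: distrib_left mult.left_commute)
    ultimately show "(W has_vector_derivative of_real ((of_int q)\<^sup>2 / x + x) * w x) (at x within {a..b})" by simp
  qed (simp_all add: w_def 1 2 complex_eq_iff)
  then show thesis
    by (intro that[of c1 d1 c2 d2]) (simp_all add: w_def W_def 1 2 complex_eq_iff)
qed

text \<open>Equality case of the calibration bound: the energy density of a solution is the exact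
  derivative of w W.\<close>

lemma sol_extremal:
  fixes c d :: real
  assumes ab: "0 < a" "a < b" and q: "n = nat \<bar>q\<bar>"
  defines "v \<equiv> \<lambda>r. complex_of_real (sol c d r)" and "g \<equiv> \<lambda>r. complex_of_real (sol' c d r / r)"
  shows "L2 {a<..<b} v" "is_L2_weak_deriv {a<..<b} 1 v g"
    "cont_rep a b v a = v a" "cont_rep a b v b = v b"
    "(LINT r:{a<..<b}|lborel. radial_energy_density q g v r) = sol c d b * sol' c d b - sol c d a * sol' c d a"
proof -
  have qn: "(real n)\<^sup>2 = (of_int q)\<^sup>2" by (simp add: q)
  have cs: "continuous_on {a..b} (sol c d)" "continuous_on {a..b} (sol' c d)"
    using bessel_system_continuous_on[OF bessel_system_sol ab(1)] by auto
  have x0: "x \<noteq> 0" if "x \<in> {a..b}" for x using that ab by auto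
  have cv: "continuous_on {a..b} v" unfolding v_def by (intro continuous_intros cs)
  have cg: "continuous_on {a..b} g" unfolding g_def using x0 by (intro continuous_intros cs) auto
  show L2v: "L2 {a<..<b} v" by (rule L2_continuous_Ioo[OF cv])
  have "is_cont_rep a b v v" using cv by (simp add: is_cont_rep_def)
  then show "cont_rep a b v a = v a" "cont_rep a b v b = v b" using cont_rep_eq[OF ab(2)] ab by auto
  have der: "(v has_derivative (\<lambda>h. h *\<^sub>R g x)) (at x)" if "x \<in> {a<..<b}" for x
    using sol_has_vector_derivative(1)[OF ab(1), of x b c d UNIV] that
    by (simp add: v_def g_def has_vector_derivative_def)
  have pd: "partial_deriv 1 v x = g x" if "x \<in> {a<..<b}" for x
    using partial_deriv_eq[OF der[OF that], of 1] by simp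
  have cg': "continuous_on {a<..<b} g" by (rule continuous_on_subset[OF cg]) auto
  have L2g: "L2 {a<..<b} g" by (rule L2_continuous_Ioo[OF cg])
  have cpd: "continuous_on {a<..<b} (partial_deriv 1 v)"
    using cg' by (subst continuous_on_cong[OF refl pd]) auto
  have L2pd: "L2 {a<..<b} (partial_deriv 1 v)"
  proof (rule L2_AE_cong[OF L2g])
    have "(\<lambda>x. indicator {a<..<b} x *\<^sub>R partial_deriv 1 v x) = (\<lambda>x. indicator {a<..<b} x *\<^sub>R g x)"
    proof
      show "indicator {a<..<b} x *\<^sub>R partial_deriv 1 v x = indicator {a<..<b} x *\<^sub>R g x" for x
        by (cases "x \<in> {a<..<b}") (simp_all add: pd)
    qed
    then show "set_borel_measurable lborel {a<..<b} (partial_deriv 1 v)"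
      using L2g by (simp add: L2_def set_borel_measurable_def)
  qed (use pd in auto)
  have "is_L2_weak_deriv {a<..<b} 1 v (partial_deriv 1 v)"
    using der cpd ab by (intro weak_deriv_classical L2v L2pd) (auto simp: differentiable_def)
  then show "is_L2_weak_deriv {a<..<b} 1 v g"
    unfolding is_L2_weak_deriv_def
    using L2g set_lebesgue_integral_cong[of "{a<..<b}" lborel] pd by (simp add: set_lebesgue_integral_cong)
  show "(LINT r:{a<..<b}|lborel. radial_energy_density q g v r) = sol c d b * sol' c d b - sol c d a * sol' c d a"
  proof (rule integral_Ioo_FTC[OF ab(2)])
    fix x assume x: "x \<in> {a..b}"
    then have xp: "x > 0" using ab by simp
    have "((\<lambda>x. sol c d x * sol' c d x) has_real_derivative
        sol' c d x / x * sol' c d x + ((real n)\<^sup>2 / x + x) * sol c d x * sol c d x) (at x within {a..b})"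
      using DERIV_mult[OF bessel_systemD(1,2)[OF bessel_system_sol xp]] by (rule has_field_derivative_at_within)
    moreover have "sol' c d x / x * sol' c d x + ((real n)\<^sup>2 / x + x) * sol c d x * sol c d x = radial_energy_density q g v x"
      using xp unfolding qn radial_energy_density_def v_def g_def norm_of_real
      by (simp add: field_simps power2_eq_square)
    ultimately show "((\<lambda>x. sol c d x * sol' c d x) has_vector_derivative radial_energy_density q g v x) (at x within {a..b})"
      by (simp add: has_real_derivative_iff_has_vector_derivative)
  qed (unfold radial_energy_density_def, intro continuous_intros cv cg, use x0 in auto)
qed

end

text \<open>Combines the calibration bound, which reduces every competitor to two real solutions,
  with the maximum over the coefficient plane. The maximizing radial profile is exported because it
  reappears as the radial factor of the extremal function on the annulus.\<close>

lemma Lambda_characterization: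
  assumes ab: "0 < a" "a < b"
  obtains L w W where "0 \<le> L" "Lambda a b q = ennreal L"
    "det (bessel_matrix a b q L) = 0" "\<And>L'. det (bessel_matrix a b q L') = 0 \<Longrightarrow> L' \<le> L"
    "\<And>v. H1 {a<..<b} v \<Longrightarrow> bdry_form a b q v \<le> L * energy_form a b q v"
    "bessel_system (nat \<bar>q\<bar>) w W" "0 < w b * W b - w a * W a"
    "sqrt (a\<^sup>2 + (of_int q)\<^sup>2) * (w a)\<^sup>2 + sqrt (b\<^sup>2 + (of_int q)\<^sup>2) * (w b)\<^sup>2 = L * (w b * W b - w a * W a)"
    "(LINT r:{a<..<b}|lborel. radial_energy_density q (\<lambda>r. of_real (W r / r)) (\<lambda>r. of_real (w r)) r)
       = w b * W b - w a * W a"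
proof -
  define n where "n = nat \<bar>q\<bar>"
  define A C where "A = sqrt (a\<^sup>2 + (of_int q)\<^sup>2)" and "C = sqrt (b\<^sup>2 + (of_int q)\<^sup>2)"
  obtain WI WK where basis: "bessel_basis n (bessel_I n) WI (bessel_K n) WK" using bessel_basis_I_K by blast
  interpret bessel_basis n "bessel_I n" WI "bessel_K n" WK by (rule basis)
  have det: "det (bessel_matrix a b q L) = robin_det a b A C L" for L
  proof -
    have D: "x * deriv (bessel_I n) x = WI x" "x * deriv (bessel_K n) x = WK x" if "x > 0" for x
      using bessel_systemD(3)[OF I that] bessel_systemD(3)[OF K that] by auto
    show ?thesis
      using D[of a] D[of b] ab
      by (simp add: bessel_matrix_def det_2 robin_det_def A_def C_def n_def[symmetric] mult.assoc)
  qed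
  obtain L c d where L: "0 \<le> L" "(c, d) \<noteq> (0, 0)"
    "\<And>x y. A * (sol x y a)\<^sup>2 + C * (sol x y b)\<^sup>2 \<le> L * (sol x y b * sol' x y b - sol x y a * sol' x y a)"
    "A * (sol c d a)\<^sup>2 + C * (sol c d b)\<^sup>2 = L * (sol c d b * sol' c d b - sol c d a * sol' c d a)"
    "robin_det a b A C L = 0" "\<And>L'. robin_det a b A C L' = 0 \<Longrightarrow> L' \<le> L"
    by (rule robin_quotient_max[of a b A C]) (use ab in \<open>auto simp: A_def C_def\<close>)
  have upper: "bdry_form a b q v \<le> L * energy_form a b q v" if H: "H1 {a<..<b} v" for v
  proof -
    obtain g where v: "L2 {a<..<b} v" and g: "is_L2_weak_deriv {a<..<b} 1 v g"
      using H by (auto simp: H1_def)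
    obtain c1 d1 c2 d2 where cr: "cont_rep a b v a = Complex (sol c1 d1 a) (sol c2 d2 a)"
      "cont_rep a b v b = Complex (sol c1 d1 b) (sol c2 d2 b)"
      and le: "(sol c1 d1 b * sol' c1 d1 b - sol c1 d1 a * sol' c1 d1 a) +
       (sol c2 d2 b * sol' c2 d2 b - sol c2 d2 a * sol' c2 d2 a)
         \<le> (LINT r:{a<..<b}|lborel. radial_energy_density q g v r)"
      using energy_ge_flux[OF ab v g n_def] by metis
    have "A * (cmod (cont_rep a b v a))\<^sup>2 + C * (cmod (cont_rep a b v b))\<^sup>2 =
        (A * (sol c1 d1 a)\<^sup>2 + C * (sol c1 d1 b)\<^sup>2) + (A * (sol c2 d2 a)\<^sup>2 + C * (sol c2 d2 b)\<^sup>2)"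
      by (simp add: cr cmod_power2 algebra_simps)
    also have "\<dots> \<le> L * ((sol c1 d1 b * sol' c1 d1 b - sol c1 d1 a * sol' c1 d1 a) +
       (sol c2 d2 b * sol' c2 d2 b - sol c2 d2 a * sol' c2 d2 a))"
      using L(3)[of c1 d1] L(3)[of c2 d2] by (simp add: distrib_left)
    also have "\<dots> \<le> L * (LINT r:{a<..<b}|lborel. radial_energy_density q g v r)"
      by (rule mult_left_mono[OF le L(1)])
    finally have "2 * pi * (A * (cmod (cont_rep a b v a))\<^sup>2 + C * (cmod (cont_rep a b v b))\<^sup>2) \<le>
        2 * pi * (L * (LINT r:{a<..<b}|lborel. radial_energy_density q g v r))"
      by (intro mult_left_mono) auto
    then show ?thesis
      by (simp add: bdry_form_def energy_form_eq[OF ab v g] A_def C_def mult_ac)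
  qed
  define w W where "w = sol c d" and "W = sol' c d"
  note ex = sol_extremal[OF ab n_def, of c d, folded w_def W_def]
  have flux: "0 < w b * W b - w a * W a"
    using sol_flux_increasing[OF ab L(2)] by (simp add: w_def W_def)
  let ?v = "\<lambda>r. complex_of_real (w r)"
  have H: "H1 {a<..<b} ?v" using ex(1,2) by (auto simp: H1_def)
  have E: "energy_form a b q ?v = 2 * pi * (w b * W b - w a * W a)"
    using energy_form_eq[OF ab ex(1,2)] ex(5) by simp
  have B: "bdry_form a b q ?v = L * energy_form a b q ?v"
  proof -
    have "bdry_form a b q ?v = 2 * pi * (A * (w a)\<^sup>2 + C * (w b)\<^sup>2)"
      by (simp add: bdry_form_def ex(3,4) A_def C_def)
    then show ?thesis unfolding L(4)[folded w_def W_def] E by simp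
  qed
  have "Lambda a b q = ennreal L"
  proof (rule antisym)
    show "Lambda a b q \<le> ennreal L"
      unfolding Lambda_def
    proof (rule SUP_least, clarify)
      fix v assume v: "H1 {a<..<b} v"
      have "0 \<le> bdry_form a b q v" by (simp add: bdry_form_def)
      then have "bdry_form a b q v / energy_form a b q v \<le> L"
      proof (cases "energy_form a b q v > 0")
        case True
        then show ?thesis using upper[OF v] by (simp add: divide_le_eq)
      next
        \<comment> \<open>Includes vanishing energy, where division by zero makes the quotient
          0.\<close>
        case False
        then have "bdry_form a b q v / energy_form a b q v \<le> 0"
          using \<open>0 \<le> bdry_form a b q v\<close> by (simp add: divide_nonneg_nonpos)
        then show ?thesis using L(1) by simp
      qed
      then show "ennreal (bdry_form a b q v / energy_form a b q v) \<le> ennreal L" by (rule ennreal_leI)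
    qed
    \<comment> \<open>If the profile were zero almost everywhere, its continuous representative and
      so both boundary values would vanish, contradicting the positive flux difference.\<close>
    have nz: "\<not> ae_zero {a<..<b} ?v"
    proof
      assume z: "ae_zero {a<..<b} ?v"
      have "is_cont_rep a b ?v (\<lambda>_. 0)"
        using z by (auto simp: is_cont_rep_def ae_zero_def elim!: AE_mp)
      then have "cont_rep a b ?v a = 0" "cont_rep a b ?v b = 0" using cont_rep_eq[OF ab(2)] ab by auto
      then have "w a = 0" "w b = 0" using ex(3,4) by auto
      then show False using flux by simp
    qed
    have "ennreal L = ennreal (bdry_form a b q ?v / energy_form a b q ?v)"
      unfolding B using flux E by simp
    also have "\<dots> \<le> Lambda a b q"
      unfolding Lambda_def by (rule SUP_upper) (use H nz in auto)
    finally show "ennreal L \<le> Lambda a b q" .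
  qed
  then show thesis
    using that[OF L(1), of w W] upper flux L(4-6) ex(5) bessel_system_sol[of c d]
    by (simp add: det A_def C_def w_def W_def n_def)
qed

section \<open>Polar coordinates\<close>

lemma vector_2_eq: "(vector [x, y] :: real^2) = x *\<^sub>R axis 1 1 + y *\<^sub>R axis 2 1"
  by (simp add: vec_eq_iff forall_2 axis_def)

lemma norm_polar: "norm (polar r \<theta>) = \<bar>r\<bar>"
  by (simp add: polar_def norm_vec_def L2_set_def UNIV_2 power_mult_distrib flip: distrib_left)

lemma polar_nth [simp]: "polar r \<theta> $ 1 = r * cos \<theta>" "polar r \<theta> $ 2 = r * sin \<theta>"
  by (simp_all add: polar_def)

lemma continuous_on_polar: "continuous_on UNIV (\<lambda>p. polar (fst p) (snd p))"
  unfolding polar_def vector_2_eq by (intro continuous_intros)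

lemma Basis_real_2: "(Basis :: (real^2) set) = {axis 1 1, axis 2 1}"
  by (auto simp: Basis_vec_def UNIV_2)

lemma sum_Basis_real_2: "(\<Sum>i\<in>Basis. f (i :: real^2)) = f (axis 1 1) + f (axis 2 1)"
  by (simp add: Basis_real_2 axis_eq_axis)

lemma norm_real_2: "norm (x :: real^2) = sqrt ((x $ 1)\<^sup>2 + (x $ 2)\<^sup>2)"
  by (simp add: norm_vec_def L2_set_def UNIV_2)

text \<open>Links the two models of the plane: the change of variables is carried out in
  \<open>real^2\<close>, iterated integration on pairs.\<close>

lemma distr_lborel_vector_2: "distr lborel borel (\<lambda>(x, y). vector [x, y] :: real^2) = lborel"
proof (rule lborel_eqI[symmetric])
  have m: "(\<lambda>(x, y). vector [x, y] :: real^2) \<in> borel_measurable borel"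
    unfolding vector_2_eq case_prod_unfold by (intro borel_measurable_continuous_onI continuous_intros)
  fix l u :: "real^2" assume le: "\<And>b. b \<in> Basis \<Longrightarrow> l \<bullet> b \<le> u \<bullet> b"
  have "(\<lambda>(x, y). vector [x, y] :: real^2) -` box l u = box (l $ 1, l $ 2) (u $ 1, u $ 2)"
    by (auto simp: mem_box Basis_real_2 inner_axis Basis_prod_def)
  then have "emeasure (distr lborel borel (\<lambda>(x, y). vector [x, y])) (box l u) =
      emeasure lborel (box (l $ 1, l $ 2) (u $ 1, u $ 2))"
    using m by (subst emeasure_distr) auto
  also have "\<dots> = (\<Prod>b\<in>Basis. (u - l) \<bullet> b)"
  proof -
    have "l $ 1 \<le> u $ 1" "l $ 2 \<le> u $ 2" 
      using le[of "axis 1 1"] le[of "axis 2 1"] by (simp_all add: Basis_real_2 inner_axis)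
    then show ?thesis
      by (subst emeasure_lborel_box) (auto simp: Basis_real_2 Basis_prod_def inner_axis axis_eq_axis)
  qed
  finally show "emeasure (distr lborel borel (\<lambda>(x, y). vector [x, y])) (box l u) = (\<Prod>b\<in>Basis. (u - l) \<bullet> b)" .
qed simp

lemma annulus_open [simp]: "open (annulus a b)"
  unfolding annulus_def by (intro open_Collect_conj open_Collect_less continuous_intros)

lemma annulus_borel [measurable]: "annulus a b \<in> sets borel"
  by (rule borel_open) simp

lemma emeasure_annulus_finite: "emeasure lborel (annulus a b) < \<infinity>"
proof -
  have "annulus a b \<subseteq> ball 0 b" by (auto simp: annulus_def)
  then have "emeasure lborel (annulus a b) \<le> emeasure lborel (ball (0 :: real^2) b)" by (rule emeasure_mono) simp
  also have "\<dots> < \<infinity>" by (rule emeasure_lborel_ball_finite)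
  finally show ?thesis .
qed

section \<open>Polar coordinates on the annulus, up to null sets\<close>

lemma polar_inj:
  assumes "0 < r" "0 < r'" "\<theta> \<in> {0<..<2*pi}" "\<theta>' \<in> {0<..<2*pi}" "polar r \<theta> = polar r' \<theta>'"
  shows "r = r' \<and> \<theta> = \<theta>'"
proof -
  have r: "r = r'" using arg_cong[OF assms(5), of norm] assms(1,2) by (simp add: norm_polar)
  moreover have "r * cos \<theta> = r' * cos \<theta>'" "r * sin \<theta> = r' * sin \<theta>'"
    using arg_cong[OF assms(5), of "\<lambda>v. v $ 1"] arg_cong[OF assms(5), of "\<lambda>v. v $ 2"]
    by (simp_all only: polar_nth)
  ultimately have "sin \<theta> = sin \<theta>' \<and> cos \<theta> = cos \<theta>'"
    using assms(1) by simp
  then obtain n :: int where n: "\<theta> = \<theta>' + 2 * pi * n" using sin_cos_eq_iff by blast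
  have "n = 0"
  proof (rule ccontr)
    assume "n \<noteq> 0"
    then have "real_of_int \<bar>n\<bar> \<ge> 1" by linarith
    then have "\<bar>2 * pi * n\<bar> \<ge> 2 * pi" by (simp add: abs_mult)
    moreover have "\<bar>\<theta> - \<theta>'\<bar> < 2 * pi" using assms(3,4) by (auto simp: abs_less_iff)
    moreover have "2 * pi * n = \<theta> - \<theta>'" using n by simp
    ultimately show False by simp
  qed
  then show ?thesis using r n by simp
qed

text \<open>Removing the whole axis, a null set, keeps the angle strictly between 0 and 2 pi, where
  polar coordinates are injective.\<close>

lemma polar_surj:
  assumes "x $ 2 \<noteq> 0"
  obtains \<theta> where "\<theta> \<in> {0<..<2*pi}" "x = polar (norm x) \<theta>"
proof -
  have n: "norm x > 0" using assms by auto
  have "(norm x)\<^sup>2 = (x $ 1)\<^sup>2 + (x $ 2)\<^sup>2" by (simp add: norm_real_2)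
  then have "(x $ 1 / norm x)\<^sup>2 + (x $ 2 / norm x)\<^sup>2 = 1"
    unfolding power_divide add_divide_distrib[symmetric] using n
    by (metis div_self less_irrefl power_not_zero)
  then obtain t where t: "0 \<le> t" "t < 2 * pi" "x $ 1 / norm x = cos t" "x $ 2 / norm x = sin t"
    using sincos_total_2pi by blast
  have "t \<noteq> 0" using t(4) assms n by auto
  moreover have "x = polar (norm x) t"
    using n t(3,4)[symmetric] by (simp add: vec_eq_iff forall_2)
  ultimately show thesis using t that[of t] by auto
qed

lemma AE_lborel_hyperplane:
  assumes "k \<in> Basis"
  shows "AE x in lborel. (x :: 'a::euclidean_space) \<bullet> k \<noteq> c"
proof (rule AE_I')
  have "{x :: 'a. x \<bullet> k = c} \<in> null_sets lebesgue"
    using negligible_standard_hyperplane[OF assms] by (simp add: negligible_iff_null_sets)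
  moreover have "{x :: 'a. x \<bullet> k = c} \<in> sets borel"
    by (intro borel_closed closed_Collect_eq continuous_intros)
  ultimately show "{x :: 'a. x \<bullet> k = c} \<in> null_sets lborel"
    by (simp add: null_sets_completion_iff)
qed auto

text \<open>The change of variables formula is applied on the open parameter rectangle, where the
  map is injective with Jacobian determinant r. The part of the annulus it misses lies on an
  axis.\<close>

lemma emeasure_annulus_polar:
  assumes ab: "0 < a" "a < b" and A: "A \<in> sets borel"
  shows "emeasure lborel (annulus a b \<inter> A) =
    (\<integral>\<^sup>+p. ennreal (indicator ({a<..<b} \<times> {0..2*pi}) p * fst p * indicator A (polar (fst p) (snd p))) \<partial>lborel)"
proof -
  define g where "g = (\<lambda>y :: real^2. polar (y $ 1) (y $ 2))"
  define g' where "g' = (\<lambda>(y :: real^2) (h :: real^2). (h $ 1 * cos (y $ 2) - y $ 1 * sin (y $ 2) * h $ 2) *\<^sub>R axis 1 1 +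
      (h $ 1 * sin (y $ 2) + y $ 1 * cos (y $ 2) * h $ 2) *\<^sub>R (axis 2 1 :: real^2))"
  define S where "S = {y :: real^2. a < y $ 1 \<and> y $ 1 < b \<and> 0 < y $ 2 \<and> y $ 2 < 2 * pi}"
  define T where "T = S \<inter> g -` A"
  have cg: "continuous_on UNIV g"
    unfolding g_def by (rule continuous_on_compose2[OF continuous_on_polar, of _ "\<lambda>y. (y $ 1, y $ 2)", simplified])
      (intro continuous_intros)
  have Sb: "S \<in> sets borel"
    unfolding S_def by (intro borel_open open_Collect_conj open_Collect_less continuous_intros)
  have gA: "g -` A \<in> sets borel"
    using measurable_sets[OF borel_measurable_continuous_onI[OF cg] A] by simp
  have Tb: "T \<in> sets borel" unfolding T_def using Sb gA by blast
  have der: "(g has_derivative g' y) (at y within X)" for y X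
    unfolding g_def g'_def polar_def vector_2_eq
    by (auto intro!: derivative_eq_intros bounded_linear.has_derivative[OF bounded_linear_vec_nth] simp: algebra_simps)
  have det: "det (matrix (g' y)) = y $ 1" for y
  proof -
    have "det (matrix (g' y)) = y $ 1 * (cos (y $ 2))\<^sup>2 + y $ 1 * (sin (y $ 2))\<^sup>2"
      by (simp add: det_2 matrix_def g'_def axis_def power2_eq_square algebra_simps)
    also have "\<dots> = y $ 1" by (simp flip: distrib_left)
    finally show ?thesis .
  qed
  have inj: "inj_on g T"
  proof (rule inj_onI)
    fix x y assume xy: "x \<in> T" "y \<in> T" "g x = g y"
    then have "x $ 1 = y $ 1 \<and> x $ 2 = y $ 2"
      using ab by (intro polar_inj) (auto simp: T_def S_def g_def)
    then show "x = y" by (simp add: vec_eq_iff forall_2)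
  qed
  have Sfin: "emeasure lborel S < \<infinity>"
  proof -
    have "S \<subseteq> box (vector [a, 0]) (vector [b, 2 * pi])"
      by (auto simp: S_def mem_box Basis_real_2 inner_axis)
    then have "emeasure lborel S \<le> emeasure lborel (box (vector [a, 0]) (vector [b, 2 * pi]) :: (real^2) set)"
      by (rule emeasure_mono) simp
    also have "\<dots> < \<infinity>" by (rule emeasure_lborel_box_finite)
    finally show ?thesis .
  qed
  have Ti: "set_integrable lborel T (\<lambda>y. y $ 1)"
    unfolding set_integrable_def
  proof (rule Bochner_Integration.integrable_bound)
    show "integrable lborel (\<lambda>y. b * indicator S y :: real)"
      using Sb Sfin by (intro integrable_mult_right integrable_real_indicator) auto
    have "(\<lambda>y :: real^2. y $ 1) \<in> borel_measurable borel"
      by (intro borel_measurable_continuous_onI continuous_intros)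
    then show "(\<lambda>y. indicator T y *\<^sub>R y $ 1) \<in> borel_measurable lborel" using Tb by simp
    show "AE y in lborel. norm (indicator T y *\<^sub>R y $ 1) \<le> norm (b * indicator S y :: real)"
      using ab by (auto simp: indicator_def T_def S_def)
  qed
  have "measure lebesgue (g ` T) = integral T (\<lambda>y. y $ 1)"
  proof -
    have int: "(\<lambda>y. y $ 1) integrable_on T" by (rule set_borel_integral_eq_integral(1)[OF Ti])
    have eq: "\<bar>det (matrix (g' y))\<bar> = y $ 1" if "y \<in> T" for y
      using that ab by (simp add: det T_def S_def)
    have "measure lebesgue (g ` T) = integral T (\<lambda>y. \<bar>det (matrix (g' y))\<bar>)"
    proof (rule measure_differentiable_image_eq[OF _ der inj])
      show "T \<in> sets lebesgue" using Tb by simp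
      show "(\<lambda>y. \<bar>det (matrix (g' y))\<bar>) integrable_on T" using int integrable_cong[of T "\<lambda>y. \<bar>det (matrix (g' y))\<bar>"] eq by simp
    qed
    also have "\<dots> = integral T (\<lambda>y. y $ 1)" by (rule integral_cong) (rule eq)
    finally show ?thesis .
  qed
  also have "\<dots> = (LINT y:T|lborel. y $ 1)" by (rule set_borel_integral_eq_integral(2)[OF Ti, symmetric])
  finally have m1: "ennreal (measure lebesgue (g ` T)) = (\<integral>\<^sup>+y. ennreal (indicator T y * y $ 1) \<partial>lborel)"
    using Ti ab unfolding set_integrable_def set_lebesgue_integral_def
    by (subst nn_integral_eq_integral) (auto simp: indicator_def T_def S_def)
  have gTsub: "g ` T \<subseteq> annulus a b \<inter> A"
    using ab by (auto simp: T_def S_def g_def annulus_def norm_polar)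
  have sup: "x \<in> g ` T" if "x \<in> annulus a b \<inter> A" "x $ 2 \<noteq> 0" for x
  proof -
    obtain \<theta> where \<theta>: "\<theta> \<in> {0<..<2*pi}" "x = polar (norm x) \<theta>" using polar_surj[OF \<open>x $ 2 \<noteq> 0\<close>] .
    then have "x = g (vector [norm x, \<theta>])" by (simp add: g_def)
    moreover have "vector [norm x, \<theta>] \<in> T"
      using \<theta> that(1) calculation by (auto simp: T_def S_def annulus_def)
    ultimately show ?thesis by blast
  qed
  \<comment> \<open>The image lies in the target set and misses only points with second coordinate
    0.\<close>
  have "measure lebesgue (g ` T) = measure lebesgue (annulus a b \<inter> A)"
  proof (rule measure_negligible_symdiff)
    have "bounded (annulus a b \<inter> A)"
      by (rule bounded_subset[OF bounded_ball[of 0 b]]) (auto simp: annulus_def)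
    then show "annulus a b \<inter> A \<in> lmeasurable" using A by (intro bounded_set_imp_lmeasurable) auto
    have "negligible {x :: real^2. x \<bullet> axis 2 1 = 0}"
      by (rule negligible_standard_hyperplane) (simp add: Basis_real_2)
    then show "negligible (annulus a b \<inter> A - g ` T \<union> (g ` T - annulus a b \<inter> A))"
      by (rule negligible_subset) (use sup gTsub in \<open>auto simp: inner_axis\<close>)
  qed
  moreover have "emeasure lborel (annulus a b \<inter> A) = ennreal (measure lborel (annulus a b \<inter> A))"
  proof (rule emeasure_eq_ennreal_measure)
    have "emeasure lborel (annulus a b \<inter> A) \<le> emeasure lborel (annulus a b)" by (rule emeasure_mono) auto
    then show "emeasure lborel (annulus a b \<inter> A) \<noteq> top"
      using emeasure_annulus_finite[of a b] by (auto simp: top_unique)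
  qed
  moreover have "measure lebesgue (annulus a b \<inter> A) = measure lborel (annulus a b \<inter> A)"
    using A by (intro measure_completion) auto
  ultimately have "emeasure lborel (annulus a b \<inter> A) = (\<integral>\<^sup>+y. ennreal (indicator T y * y $ 1) \<partial>lborel)"
    using m1 by simp
  also have "\<dots> = (\<integral>\<^sup>+p. ennreal (indicator T (vector [fst p, snd p]) * fst p) \<partial>lborel)"
  proof -
    have m: "(\<lambda>(x, y). vector [x, y] :: real^2) \<in> borel_measurable borel"
      unfolding vector_2_eq case_prod_unfold by (intro borel_measurable_continuous_onI continuous_intros)
    have m1: "(\<lambda>y :: real^2. y $ 1) \<in> borel_measurable borel"
      by (intro borel_measurable_continuous_onI continuous_intros)
    have "(\<integral>\<^sup>+y. ennreal (indicator T y * y $ 1) \<partial>distr lborel borel (\<lambda>(x, y). vector [x, y] :: real^2)) =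
        (\<integral>\<^sup>+p. ennreal (indicator T (vector [fst p, snd p]) * fst p) \<partial>lborel)"
      using m m1 Tb by (subst nn_integral_distr) (auto simp: case_prod_unfold)
    then show ?thesis by (simp only: distr_lborel_vector_2)
  qed
  also have "\<dots> = (\<integral>\<^sup>+p. ennreal (indicator ({a<..<b} \<times> {0..2*pi}) p * fst p * indicator A (polar (fst p) (snd p))) \<partial>lborel)"
  proof (rule nn_integral_cong_AE)
    \<comment> \<open>The open and the closed angular interval differ by the two null lines at
      angles 0 and 2 pi.\<close>
    have "AE p in lborel. (p :: real \<times> real) \<bullet> (0, 1) \<noteq> 0 \<and> p \<bullet> (0, 1) \<noteq> 2 * pi"
      by (intro AE_conjI AE_lborel_hyperplane) (auto simp: Basis_prod_def)
    then show "AE p in lborel. ennreal (indicator T (vector [fst p, snd p]) * fst p) =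
        ennreal (indicator ({a<..<b} \<times> {0..2*pi}) p * fst p * indicator A (polar (fst p) (snd p)))"
      by eventually_elim (auto simp: indicator_def T_def S_def g_def)
  qed
  finally show ?thesis .
qed


lemma polar_domain_borel: "{a<..<b} \<times> {c..d} \<in> sets (borel :: (real \<times> real) measure)"
  by (intro borel_Times) auto

lemma polar_weight_measurable:
  "(\<lambda>p :: real \<times> real. indicator ({a<..<b} \<times> {0..2*pi}) p * fst p :: real) \<in> borel_measurable borel"
  by (rule borel_measurable_times[OF borel_measurable_indicator[OF polar_domain_borel]])
     (intro borel_measurable_continuous_onI continuous_intros)

text \<open>Stating polar coordinates as an equality of measures transfers integrability and
  integrals of Banach-space-valued functions at once.\<close>

lemma lborel_annulus_polar:
  assumes "0 < a" "a < b"
  shows "density lborel (\<lambda>x. ennreal (indicator (annulus a b) x)) =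
    distr (density lborel (\<lambda>p. ennreal (indicator ({a<..<b} \<times> {0..2*pi}) p * fst p))) borel
      (\<lambda>p. polar (fst p) (snd p))" (is "?M = ?N")
proof (rule measure_eqI)
  fix A assume "A \<in> sets ?M"
  then have A: "A \<in> sets borel" by simp
  have [measurable]: "(\<lambda>p. polar (fst p) (snd p)) \<in> borel_measurable borel"
    by (rule borel_measurable_continuous_onI[OF continuous_on_polar])
  have w: "(\<lambda>p. ennreal (indicator ({a<..<b} \<times> {0..2*pi}) p * fst p)) \<in> borel_measurable lborel"
    using measurable_compose[OF polar_weight_measurable[of a b] measurable_ennreal] by simp
  have v: "(\<lambda>p. polar (fst p) (snd p)) -` A \<in> sets borel"
    using measurable_sets[OF borel_measurable_continuous_onI[OF continuous_on_polar] A] by simp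
  have "emeasure ?M A = (\<integral>\<^sup>+x. indicator (annulus a b \<inter> A) x \<partial>lborel)"
  proof -
    have "emeasure ?M A = (\<integral>\<^sup>+x. ennreal (indicator (annulus a b) x) * indicator A x \<partial>lborel)"
      by (rule emeasure_density) (use A in auto)
    also have "\<dots> = (\<integral>\<^sup>+x. indicator (annulus a b \<inter> A) x \<partial>lborel)"
      by (intro nn_integral_cong) (auto simp: indicator_def)
    finally show ?thesis .
  qed
  also have "\<dots> = emeasure lborel (annulus a b \<inter> A)" using A by (intro nn_integral_indicator) auto
  also have "\<dots> = (\<integral>\<^sup>+p. ennreal (indicator ({a<..<b} \<times> {0..2*pi}) p * fst p) *
      indicator ((\<lambda>p. polar (fst p) (snd p)) -` A) p \<partial>lborel)"
    unfolding emeasure_annulus_polar[OF assms A]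
    by (intro nn_integral_cong) (auto simp: indicator_def)
  also have "\<dots> = emeasure (density lborel (\<lambda>p. ennreal (indicator ({a<..<b} \<times> {0..2*pi}) p * fst p)))
      ((\<lambda>p. polar (fst p) (snd p)) -` A)"
    using w v by (subst emeasure_density) auto
  also have "\<dots> = emeasure ?N A"
    using A by (subst emeasure_distr) auto
  finally show "emeasure ?M A = emeasure ?N A" .
qed simp

lemma polar_integral:
  fixes f :: "real^2 \<Rightarrow> 'b::{banach, second_countable_topology}"
  assumes ab: "0 < a" "a < b" and f: "set_integrable lborel (annulus a b) f"
  defines "F \<equiv> \<lambda>p. indicator ({a<..<b} \<times> {0..2*pi}) p *\<^sub>R (fst p *\<^sub>R f (polar (fst p) (snd p)))"
  shows "integrable lborel F" "(LINT x:annulus a b|lborel. f x) = (LINT p|lborel. F p)"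
proof -
  let ?D = "density lborel (\<lambda>x. ennreal (indicator (annulus a b) x))"
  let ?w = "\<lambda>p :: real \<times> real. indicator ({a<..<b} \<times> {0..2*pi}) p * fst p :: real"
  define h where "h = (\<lambda>x. indicator (annulus a b) x *\<^sub>R f x)"
  have hi: "integrable lborel h" using f by (simp add: h_def set_integrable_def)
  have hm: "h \<in> borel_measurable borel" using hi by (auto dest: borel_measurable_integrable)
  have ih: "indicator (annulus a b) x *\<^sub>R h x = h x" for x by (simp add: h_def indicator_def)
  note wm = polar_weight_measurable[of a b]
  have w0: "0 \<le> ?w p" for p using ab by (auto simp: indicator_def)
  have pm: "(\<lambda>p. polar (fst p) (snd p)) \<in> borel_measurable borel"
    by (rule borel_measurable_continuous_onI[OF continuous_on_polar])
  have hpm: "(\<lambda>p. h (polar (fst p) (snd p))) \<in> borel_measurable borel"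
    by (rule measurable_compose[OF pm hm])
  have FF: "F = (\<lambda>p. ?w p *\<^sub>R h (polar (fst p) (snd p)))"
    using ab by (auto simp: F_def h_def fun_eq_iff indicator_def annulus_def norm_polar)
  have Dh: "integrable ?D h"
    using hi hm by (subst integrable_density) (auto simp: ih)
  then show "integrable lborel F"
    unfolding lborel_annulus_polar[OF ab] FF using pm hm hpm wm w0
    by (subst (asm) integrable_distr_eq) (auto simp: integrable_density)
  have "(LINT x:annulus a b|lborel. f x) = (LINT x|?D. h x)"
  proof -
    have "(LINT x|?D. h x) = (LINT x|lborel. indicator (annulus a b) x *\<^sub>R h x)"
      by (rule integral_density) (use hm in auto)
    then show ?thesis by (simp only: ih) (simp only: h_def set_lebesgue_integral_def)
  qed
  also have "\<dots> = (LINT p|density lborel (\<lambda>p. ennreal (?w p)). h (polar (fst p) (snd p)))"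
    unfolding lborel_annulus_polar[OF ab] using pm hm by (subst integral_distr) auto
  also have "\<dots> = (LINT p|lborel. F p)"
    unfolding FF using hpm wm w0 by (subst integral_density) auto
  finally show "(LINT x:annulus a b|lborel. f x) = (LINT p|lborel. F p)" .
qed

text \<open>Integration in the angle; the arc length factor r is supplied separately.\<close>

definition circle_integral :: "(real^2 \<Rightarrow> 'b::{banach, second_countable_topology}) \<Rightarrow> real \<Rightarrow> 'b" where
  "circle_integral f r = (LINT \<theta>:{0..2*pi}|lborel. f (polar r \<theta>))"

text \<open>The first conclusion gives meaning to the pointwise Fourier coefficients: on almost
  every circle the restriction is integrable.\<close>

lemma polar_Fubini:
  fixes f :: "real^2 \<Rightarrow> 'b::{banach, second_countable_topology}"
  assumes ab: "0 < a" "a < b" and f: "set_integrable lborel (annulus a b) f"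
  shows "AE r in lborel. r \<in> {a<..<b} \<longrightarrow> set_integrable lborel {0..2*pi} (\<lambda>\<theta>. f (polar r \<theta>))"
    and "set_integrable lborel {a<..<b} (\<lambda>r. r *\<^sub>R circle_integral f r)"
    and "(LINT x:annulus a b|lborel. f x) = (LINT r:{a<..<b}|lborel. r *\<^sub>R circle_integral f r)"
proof -
  define F where "F = (\<lambda>p. indicator ({a<..<b} \<times> {0..2*pi}) p *\<^sub>R (fst p *\<^sub>R f (polar (fst p) (snd p))))"
  have Fi: "integrable (lborel \<Otimes>\<^sub>M lborel) F"
    using polar_integral(1)[OF ab f] by (simp add: F_def lborel_prod)
  have sl: "F (r, \<theta>) = indicator {a<..<b} r *\<^sub>R (r *\<^sub>R (indicator {0..2*pi} \<theta> *\<^sub>R f (polar r \<theta>)))" for r \<theta>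
    by (auto simp: F_def indicator_def)
  have "AE r in lborel. integrable lborel (\<lambda>\<theta>. F (r, \<theta>))"
    by (rule lborel_pair.AE_integrable_fst'[OF Fi])
  then show "AE r in lborel. r \<in> {a<..<b} \<longrightarrow> set_integrable lborel {0..2*pi} (\<lambda>\<theta>. f (polar r \<theta>))"
  proof eventually_elim
    case (elim r)
    show ?case
    proof
      assume r: "r \<in> {a<..<b}"
      have "integrable lborel (\<lambda>\<theta>. (1 / r) *\<^sub>R F (r, \<theta>))" by (rule integrable_scaleR_right) (rule elim)
      moreover have "(1 / r) *\<^sub>R F (r, \<theta>) = indicator {0..2*pi} \<theta> *\<^sub>R f (polar r \<theta>)" for \<theta>
        using r ab by (simp add: sl)
      ultimately show "set_integrable lborel {0..2*pi} (\<lambda>\<theta>. f (polar r \<theta>))" by (simp add: set_integrable_def)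
    qed
  qed
  have inner: "(LINT \<theta>|lborel. F (r, \<theta>)) = indicator {a<..<b} r *\<^sub>R (r *\<^sub>R circle_integral f r)" for r
    unfolding sl circle_integral_def set_lebesgue_integral_def by (simp only: integral_scaleR_right)
  show "set_integrable lborel {a<..<b} (\<lambda>r. r *\<^sub>R circle_integral f r)"
    using lborel_pair.integrable_fst'[OF Fi] by (simp only: inner set_integrable_def)
  have "(LINT r|lborel. LINT \<theta>|lborel. F (r, \<theta>)) = (LINT p|(lborel \<Otimes>\<^sub>M lborel). F p)"
    by (rule lborel_pair.integral_fst'[OF Fi])
  then show "(LINT x:annulus a b|lborel. f x) = (LINT r:{a<..<b}|lborel. r *\<^sub>R circle_integral f r)"
    unfolding polar_integral(2)[OF ab f] F_def[symmetric]
    by (simp add: inner lborel_prod set_lebesgue_integral_def)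
qed

section \<open>Fourier coefficients on circles\<close>

lemma set_integrable_continuous_Icc:
  fixes f :: "real \<Rightarrow> 'b::{banach, second_countable_topology}"
  assumes "continuous_on {a..b} f"
  shows "set_integrable lborel {a..b} f"
  unfolding set_integrable_def by (rule borel_integrable_compact[OF compact_Icc assms])

lemma integral_cis:
  fixes k :: int
  shows "(LINT \<theta>:{0..2*pi}|lborel. cis (of_int k * \<theta>)) = (if k = 0 then 2 * pi else 0)"
proof (cases "k = 0")
  case True
  have "(LINT \<theta>:{0..2*pi}|lborel. (1::complex)) = 2 * pi"
    by (simp add: set_lebesgue_integral_def scaleR_conv_of_real)
  then show ?thesis using True by simp
next
  case False
  have c: "continuous_on {0..2*pi} (\<lambda>\<theta>. cis (of_int k * \<theta>))" by (intro continuous_intros)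
  define G where "G = (\<lambda>\<theta>. cis (of_int k * \<theta>) / (\<i> * of_int k))"
  have "(LINT \<theta>:{0..2*pi}|lborel. cis (of_int k * \<theta>)) = integral {0..2*pi} (\<lambda>\<theta>. cis (of_int k * \<theta>))"
    by (rule set_borel_integral_eq_integral[OF set_integrable_continuous_Icc[OF c]])
  also have "\<dots> = G (2 * pi) - G 0"
  proof (rule integral_unique, rule fundamental_theorem_of_calculus)
    fix \<theta> :: real
    have "((\<lambda>\<theta>. cis (of_int k * \<theta>)) has_vector_derivative of_int k *\<^sub>R (\<i> * cis (of_int k * \<theta>))) (at \<theta> within {0..2*pi})"
      unfolding has_vector_derivative_def by (auto intro!: derivative_eq_intros simp: scaleR_conv_of_real mult_ac)
    from has_vector_derivative_divide[OF this, of "\<i> * of_int k"]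
    show "(G has_vector_derivative cis (of_int k * \<theta>)) (at \<theta> within {0..2*pi})"
      using False by (simp add: G_def scaleR_conv_of_real)
  qed simp
  also have "\<dots> = 0"
  proof -
    have "cis (of_int k * (2 * pi)) = 1" using cis_multiple_2pi[of "of_int k"] by (simp add: mult.commute)
    then show ?thesis by (simp add: G_def)
  qed
  finally show ?thesis using False by simp
qed

text \<open>Expand the nonnegative integral of |h - T|^2 for the partial Fourier sum
  \<open>T\<close>. Both the mixed term and the integral of |T|^2 equal \<open>S\<close>, so the
  expansion is the integral of |h|^2 minus \<open>S\<close>.\<close>

lemma bessel_inequality_circle:
  fixes h :: "real \<Rightarrow> complex"
  assumes h: "L2 {0..2*pi} h" and Q: "finite Q"
  defines "c \<equiv> \<lambda>q::int. (1 / (2 * pi)) * (LINT \<theta>:{0..2*pi}|lborel. h \<theta> * cis (- (of_int q * \<theta>)))"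
  shows "(\<Sum>q\<in>Q. (cmod (c q))\<^sup>2) \<le> 1 / (2 * pi) * (LINT \<theta>:{0..2*pi}|lborel. (cmod (h \<theta>))\<^sup>2)"
proof -
  let ?I = "{0..2*pi}"
  define T where "T = (\<lambda>\<theta>. \<Sum>q\<in>Q. c q * cis (of_int q * \<theta>))"
  define S where "S = 2 * pi * (\<Sum>q\<in>Q. (cmod (c q))\<^sup>2)"
  have cT: "continuous_on A T" for A unfolding T_def by (intro continuous_intros)
  have hi: "set_integrable lborel ?I h" using h by (intro set_integrable_L2) auto
  have hk: "set_integrable lborel ?I (\<lambda>\<theta>. h \<theta> * k \<theta>)" if k: "continuous_on UNIV k" for k
  proof -
    have "bounded (k ` ?I)" using k by (intro compact_imp_bounded compact_continuous_image) (auto intro: continuous_on_subset)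
    then obtain B where B: "\<And>x. x \<in> ?I \<Longrightarrow> norm (k x) \<le> B" unfolding bounded_iff by blast
    have "(\<lambda>x. indicator ?I x *\<^sub>R k x) \<in> borel_measurable borel"
      using borel_measurable_continuous_onI[OF k] by simp
    then have "set_integrable lborel ?I (\<lambda>\<theta>. h \<theta> * (indicator ?I \<theta> *\<^sub>R k \<theta>))"
      by (rule set_integrable_mult_bounded[OF hi, where B = "max 0 B"]) (use B in \<open>auto simp: indicator_def le_max_iff_disj\<close>)
    moreover have "indicator ?I x *\<^sub>R (h x * (indicator ?I x *\<^sub>R k x)) = indicator ?I x *\<^sub>R (h x * k x)" for x
      by (simp add: indicator_def)
    ultimately show ?thesis by (simp only: set_integrable_def)
  qed
  have ck: "continuous_on A (\<lambda>\<theta>. cis (- (of_int q * \<theta>)))" for A and q :: int by (intro continuous_intros)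
  \<comment> \<open>Stated for a general \<open>f\<close> because \<open>h\<close> and
    \<open>T\<close> share the Fourier coefficients \<open>c q\<close> for q in
    \<open>Q\<close>.\<close>
  have coef: "(LINT \<theta>:?I|lborel. f \<theta> * cnj (T \<theta>)) = of_real S"
    if fi: "\<And>q. set_integrable lborel ?I (\<lambda>\<theta>. f \<theta> * cis (- (of_int q * \<theta>)))"
      and fc: "\<And>q. q \<in> Q \<Longrightarrow> (LINT \<theta>:?I|lborel. f \<theta> * cis (- (of_int q * \<theta>))) = 2 * pi * c q" for f
  proof -
    have "f \<theta> * cnj (T \<theta>) = (\<Sum>q\<in>Q. cnj (c q) * (f \<theta> * cis (- (of_int q * \<theta>))))" for \<theta>
      by (simp add: T_def sum_distrib_left cis_cnj mult_ac)
    then have "(LINT \<theta>:?I|lborel. f \<theta> * cnj (T \<theta>)) =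
        (LINT \<theta>:?I|lborel. (\<Sum>q\<in>Q. cnj (c q) * (f \<theta> * cis (- (of_int q * \<theta>)))))" by simp
    also have "\<dots> = (\<Sum>q\<in>Q. LINT \<theta>:?I|lborel. cnj (c q) * (f \<theta> * cis (- (of_int q * \<theta>))))"
      unfolding set_lebesgue_integral_def scaleR_sum_right
      by (rule Bochner_Integration.integral_sum)
         (use fi in \<open>auto simp: set_integrable_def[symmetric]\<close>)
    also have "\<dots> = (\<Sum>q\<in>Q. cnj (c q) * (2 * pi * c q))"
      by (rule sum.cong) (simp_all add: fc)
    also have "\<dots> = of_real S"
    proof -
      have "cnj (c q) * (2 * pi * c q) = of_real (2 * pi * (cmod (c q))\<^sup>2)" for q
        by (simp add: complex_norm_square[simplified] mult_ac)
      then show ?thesis by (simp only: S_def sum_distrib_left of_real_sum)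
    qed
    finally show ?thesis .
  qed
  have hT: "(LINT \<theta>:?I|lborel. h \<theta> * cnj (T \<theta>)) = of_real S"
    by (rule coef[OF hk[OF ck]]) (simp add: c_def)
  have TT: "(LINT \<theta>:?I|lborel. T \<theta> * cnj (T \<theta>)) = of_real S"
  proof (rule coef)
    show "set_integrable lborel ?I (\<lambda>\<theta>. T \<theta> * cis (- (of_int q * \<theta>)))" for q :: int
      by (intro set_integrable_continuous_Icc continuous_intros cT)
    fix q assume q: "q \<in> Q"
    have "T \<theta> * cis (- (of_int q * \<theta>)) = (\<Sum>p\<in>Q. c p * cis (of_int (p - q) * \<theta>))" for \<theta>
      unfolding T_def sum_distrib_right by (rule sum.cong) (simp_all add: mult.assoc cis_mult left_diff_distrib)
    then have "(LINT \<theta>:?I|lborel. T \<theta> * cis (- (of_int q * \<theta>))) =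
        (LINT \<theta>:?I|lborel. (\<Sum>p\<in>Q. c p * cis (of_int (p - q) * \<theta>)))" by simp
    also have "\<dots> = (\<Sum>p\<in>Q. LINT \<theta>:?I|lborel. c p * cis (of_int (p - q) * \<theta>))"
      unfolding set_lebesgue_integral_def scaleR_sum_right
    proof (rule Bochner_Integration.integral_sum)
      show "integrable lborel (\<lambda>\<theta>. indicator ?I \<theta> *\<^sub>R (c p * cis (of_int (p - q) * \<theta>)))" for p
        unfolding set_integrable_def[symmetric]
        by (intro set_integrable_continuous_Icc continuous_intros)
    qed
    also have "\<dots> = (\<Sum>p\<in>Q. if p = q then 2 * pi * c q else 0)"
      by (rule sum.cong) (auto simp only: set_integral_mult_right integral_cis, simp_all)
    also have "\<dots> = 2 * pi * c q" using Q q by simp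
    finally show "(LINT \<theta>:?I|lborel. T \<theta> * cis (- (of_int q * \<theta>))) = 2 * pi * c q" .
  qed
  have Re_int: "(LINT \<theta>:?I|lborel. Re (f \<theta>)) = Re (LINT \<theta>:?I|lborel. f \<theta>)" "set_integrable lborel ?I (\<lambda>\<theta>. Re (f \<theta>))"
    if "set_integrable lborel ?I f" for f
  proof -
    have f: "integrable lborel (\<lambda>\<theta>. indicator ?I \<theta> *\<^sub>R f \<theta>)" using that by (simp add: set_integrable_def)
    show "(LINT \<theta>:?I|lborel. Re (f \<theta>)) = Re (LINT \<theta>:?I|lborel. f \<theta>)"
      unfolding set_lebesgue_integral_def integral_Re[OF f, symmetric] by simp
    show "set_integrable lborel ?I (\<lambda>\<theta>. Re (f \<theta>))"
      using integrable_Re[OF f] by (simp add: set_integrable_def)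
  qed
  have i1: "set_integrable lborel ?I (\<lambda>\<theta>. (cmod (h \<theta>))\<^sup>2)" using h by (simp add: L2_def)
  have i2: "set_integrable lborel ?I (\<lambda>\<theta>. h \<theta> * cnj (T \<theta>))" by (intro hk continuous_intros cT)
  have i3: "set_integrable lborel ?I (\<lambda>\<theta>. T \<theta> * cnj (T \<theta>))"
    by (intro set_integrable_continuous_Icc continuous_intros cT)
  have sq: "(cmod (h \<theta> - T \<theta>))\<^sup>2 = (cmod (h \<theta>))\<^sup>2 - 2 * Re (h \<theta> * cnj (T \<theta>)) + Re (T \<theta> * cnj (T \<theta>))" for \<theta>
    unfolding cmod_power2 by (simp add: power2_eq_square algebra_simps)
  have "0 \<le> (LINT \<theta>:?I|lborel. (cmod (h \<theta> - T \<theta>))\<^sup>2)"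
    unfolding set_lebesgue_integral_def by (intro Bochner_Integration.integral_nonneg) auto
  also have "\<dots> = (LINT \<theta>:?I|lborel. (cmod (h \<theta>))\<^sup>2 - 2 * Re (h \<theta> * cnj (T \<theta>))) + (LINT \<theta>:?I|lborel. Re (T \<theta> * cnj (T \<theta>)))"
    unfolding sq by (intro set_integral_add(2) set_integral_diff(1) set_integrable_mult_right i1 Re_int(2) i2 i3)
  also have "(LINT \<theta>:?I|lborel. (cmod (h \<theta>))\<^sup>2 - 2 * Re (h \<theta> * cnj (T \<theta>))) =
      (LINT \<theta>:?I|lborel. (cmod (h \<theta>))\<^sup>2) - (LINT \<theta>:?I|lborel. 2 * Re (h \<theta> * cnj (T \<theta>)))"
    by (intro set_integral_diff(2) set_integrable_mult_right i1 Re_int(2) i2)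
  also have "(LINT \<theta>:?I|lborel. 2 * Re (h \<theta> * cnj (T \<theta>))) = 2 * S"
    by (simp only: set_integral_mult_right Re_int(1)[OF i2] hT Re_complex_of_real)
  also have "(LINT \<theta>:?I|lborel. Re (T \<theta> * cnj (T \<theta>))) = S"
    by (simp only: Re_int(1)[OF i3] TT Re_complex_of_real)
  finally have "S \<le> (LINT \<theta>:?I|lborel. (cmod (h \<theta>))\<^sup>2)" by simp
  then show ?thesis by (simp add: S_def field_simps)
qed

text \<open>\<open>ang q\<close> is \<open>e\<^sup>i\<^sup>q\<^sup>\<theta>\<close> as a function on the punctured plane.\<close>

definition ang :: "int \<Rightarrow> real^2 \<Rightarrow> complex" where
  "ang q x = (if q \<ge> 0 then (of_real (x $ 1 / norm x) + \<i> * of_real (x $ 2 / norm x)) ^ nat q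
     else (of_real (x $ 1 / norm x) - \<i> * of_real (x $ 2 / norm x)) ^ nat (- q))"

lemma ang_polar:
  assumes "r > 0"
  shows "ang q (polar r \<theta>) = cis (of_int q * \<theta>)"
proof -
  have e: "of_real (cos \<theta>) + \<i> * of_real (sin \<theta>) = cis \<theta>" "of_real (cos \<theta>) - \<i> * of_real (sin \<theta>) = cis (- \<theta>)"
    by (simp_all add: complex_eq_iff)
  show ?thesis
    using assms by (simp add: ang_def norm_polar e Complex.DeMoivre)
qed

section \<open>Derivatives of the radius and of the angular factor\<close>

lemma has_derivative_norm_2:
  fixes x :: "real^2"
  assumes "x \<noteq> 0"
  shows "(norm has_derivative (\<lambda>h. (x $ 1 * h $ 1 + x $ 2 * h $ 2) / norm x)) (at x)"
  using has_derivative_norm[OF assms]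
  by (simp add: sgn_div_norm inner_vec_def UNIV_2 add_divide_distrib divide_inverse algebra_simps)

text \<open>\<open>\<tau>\<close> is the differential of the polar angle, written in Cartesian
  coordinates so that no branch of the angle has to be chosen.\<close>

lemma has_derivative_unit_components:
  fixes x :: "real^2"
  assumes "x \<noteq> 0"
  defines "\<tau> \<equiv> \<lambda>h. (x $ 1 * h $ 2 - x $ 2 * h $ 1) / (norm x)\<^sup>2"
  shows "((\<lambda>x. x $ 1 / norm x) has_derivative (\<lambda>h. - (x $ 2 / norm x) * \<tau> h)) (at x)"
    and "((\<lambda>x. x $ 2 / norm x) has_derivative (\<lambda>h. (x $ 1 / norm x) * \<tau> h)) (at x)"
proof -
  let ?\<rho> = "norm x"
  have \<rho>: "?\<rho> \<noteq> 0" using assms by simp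
  have \<rho>2: "?\<rho> * ?\<rho> = x $ 1 * x $ 1 + x $ 2 * x $ 2" using norm_real_2[of x] by (simp add: power2_eq_square)
  note dn = has_derivative_norm_2[OF assms(1)]
  have dc: "((\<lambda>x. x $ i) has_derivative (\<lambda>h. h $ i)) (at x)" for i
    by (rule bounded_linear_imp_has_derivative[OF bounded_linear_vec_nth])
  have key: "(h $ 1 * ?\<rho> - x $ 1 * ((x $ 1 * h $ 1 + x $ 2 * h $ 2) / ?\<rho>)) / (?\<rho> * ?\<rho>) = - (x $ 2 / ?\<rho>) * \<tau> h"
    "(h $ 2 * ?\<rho> - x $ 2 * ((x $ 1 * h $ 1 + x $ 2 * h $ 2) / ?\<rho>)) / (?\<rho> * ?\<rho>) = (x $ 1 / ?\<rho>) * \<tau> h" for h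
  proof -
    have "h $ 1 * (?\<rho> * ?\<rho>) - x $ 1 * (x $ 1 * h $ 1 + x $ 2 * h $ 2) = - x $ 2 * (x $ 1 * h $ 2 - x $ 2 * h $ 1)"
      "h $ 2 * (?\<rho> * ?\<rho>) - x $ 2 * (x $ 1 * h $ 1 + x $ 2 * h $ 2) = x $ 1 * (x $ 1 * h $ 2 - x $ 2 * h $ 1)"
      unfolding \<rho>2 by (simp_all add: algebra_simps)
    then show "(h $ 1 * ?\<rho> - x $ 1 * ((x $ 1 * h $ 1 + x $ 2 * h $ 2) / ?\<rho>)) / (?\<rho> * ?\<rho>) = - (x $ 2 / ?\<rho>) * \<tau> h"
      "(h $ 2 * ?\<rho> - x $ 2 * ((x $ 1 * h $ 1 + x $ 2 * h $ 2) / ?\<rho>)) / (?\<rho> * ?\<rho>) = (x $ 1 / ?\<rho>) * \<tau> h"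
      using \<rho> by (simp_all add: \<tau>_def divide_simps power2_eq_square)
  qed
  show "((\<lambda>x. x $ 1 / norm x) has_derivative (\<lambda>h. - (x $ 2 / norm x) * \<tau> h)) (at x)"
    using has_derivative_divide'[OF dc[of 1] dn \<rho>] by (simp only: key)
  show "((\<lambda>x. x $ 2 / norm x) has_derivative (\<lambda>h. (x $ 1 / norm x) * \<tau> h)) (at x)"
    using has_derivative_divide'[OF dc[of 2] dn \<rho>] by (simp only: key)
qed

lemma ang_has_derivative:
  fixes x :: "real^2"
  assumes "x \<noteq> 0"
  shows "(ang q has_derivative (\<lambda>h. \<i> * of_int q * of_real ((x $ 1 * h $ 2 - x $ 2 * h $ 1) / (norm x)\<^sup>2) * ang q x)) (at x)"
proof -
  define \<tau> where "\<tau> = (\<lambda>h :: real^2. (x $ 1 * h $ 2 - x $ 2 * h $ 1) / (norm x)\<^sup>2)"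
  have D: "((\<lambda>x. complex_of_real (x $ 1 / norm x)) has_derivative (\<lambda>h. of_real (- (x $ 2 / norm x) * \<tau> h))) (at x)"
    "((\<lambda>x. complex_of_real (x $ 2 / norm x)) has_derivative (\<lambda>h. of_real ((x $ 1 / norm x) * \<tau> h))) (at x)"
    unfolding \<tau>_def by (rule has_derivative_of_real has_derivative_unit_components assms)+
  \<comment> \<open>The sign s = 1 gives the unit vector as a complex number, s = -1 its conjugate;
    nonnegative powers of these cover all frequencies q.\<close>
  define e where "e = (\<lambda>s (x :: real^2). of_real (x $ 1 / norm x) + s * (\<i> * complex_of_real (x $ 2 / norm x)))"
  have de: "(e s has_derivative (\<lambda>h. s * (\<i> * of_real (\<tau> h) * e s x))) (at x)" if s: "s = 1 \<or> s = - 1" for s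
  proof -
    have "(e s has_derivative (\<lambda>h. of_real (- (x $ 2 / norm x) * \<tau> h) + s * (\<i> * of_real ((x $ 1 / norm x) * \<tau> h)))) (at x)"
      unfolding e_def by (intro has_derivative_add has_derivative_mult_right D)
    moreover have "of_real (- (x $ 2 / norm x) * \<tau> h) + s * (\<i> * of_real ((x $ 1 / norm x) * \<tau> h)) =
        s * (\<i> * of_real (\<tau> h) * e s x)" for h
      using s by (auto simp: e_def complex_eq_iff)
    ultimately show ?thesis by simp
  qed
  have dp: "((\<lambda>x. e s x ^ n) has_derivative (\<lambda>h. s * of_nat n * (\<i> * of_real (\<tau> h)) * e s x ^ n)) (at x)"
    if s: "s = 1 \<or> s = - 1" for s n
  proof -
    have "((\<lambda>x. e s x ^ n) has_derivative (\<lambda>h. of_nat n * (s * (\<i> * of_real (\<tau> h) * e s x)) * e s x ^ (n - 1))) (at x)"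
      by (rule has_derivative_power[OF de[OF s]])
    moreover have "of_nat n * (s * (\<i> * of_real (\<tau> h) * e s x)) * e s x ^ (n - 1) =
        s * of_nat n * (\<i> * of_real (\<tau> h)) * e s x ^ n" for h
      by (cases n) (simp_all add: mult_ac)
    ultimately show ?thesis by (simp only:)
  qed
  show ?thesis
  proof (cases "q \<ge> 0")
    case True
    then have "ang q = (\<lambda>x. e 1 x ^ nat q)" by (simp add: fun_eq_iff ang_def e_def)
    then show ?thesis
      using dp[of 1 "nat q"] True by (simp add: \<tau>_def mult_ac)
  next
    case False
    then have "ang q = (\<lambda>x. e (- 1) x ^ nat (- q))" by (simp add: fun_eq_iff ang_def e_def)
    then show ?thesis
      using dp[of "- 1" "nat (- q)"] False by (simp add: \<tau>_def mult_ac)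
  qed
qed

lemma norm_ang:
  assumes "x \<noteq> 0"
  shows "norm (ang q x) = 1"
proof -
  have n: "(norm x)\<^sup>2 = (x $ 1)\<^sup>2 + (x $ 2)\<^sup>2" by (simp add: norm_real_2)
  have "(x $ 1 / norm x)\<^sup>2 + (x $ 2 / norm x)\<^sup>2 = (norm x)\<^sup>2 / (norm x)\<^sup>2"
    unfolding power_divide add_divide_distrib[symmetric] n[symmetric] ..
  then have "(x $ 1 / norm x)\<^sup>2 + (x $ 2 / norm x)\<^sup>2 = 1" using assms by simp
  then have "cmod (of_real (x $ 1 / norm x) + \<i> * of_real (x $ 2 / norm x)) = 1"
    "cmod (of_real (x $ 1 / norm x) - \<i> * of_real (x $ 2 / norm x)) = 1"
    by (simp_all add: cmod_def)
  then show ?thesis by (simp only: ang_def norm_power power_one split: if_split) simp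
qed

lemma continuous_on_ang: "0 \<notin> S \<Longrightarrow> continuous_on S (ang q)"
  by (intro continuous_at_imp_continuous_on ballI has_derivative_continuous[OF ang_has_derivative]) auto

lemma fourier_coeff_eq:
  assumes "r > 0"
  shows "fourier_coeff u q r = (1 / (2 * pi)) * circle_integral (\<lambda>x. u x * ang (- q) x) r"
proof -
  have "exp (- \<i> * of_int q * of_real \<theta>) = cis (of_int (- q) * \<theta>)" for \<theta>
    by (simp add: cis_conv_exp mult.assoc)
  then show ?thesis
    using assms by (simp add: fourier_coeff_def circle_integral_def ang_polar)
qed

lemma annulus_nonzero: "0 < a \<Longrightarrow> x \<in> annulus a b \<Longrightarrow> x \<noteq> 0"
  by (auto simp: annulus_def)

lemma set_integrable_mult_annulus:
  fixes f g :: "real^2 \<Rightarrow> complex"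
  assumes f: "set_integrable lborel (annulus a b) f" and g: "continuous_on (annulus a b) g"
    and B: "\<And>x. x \<in> annulus a b \<Longrightarrow> norm (g x) \<le> B"
  shows "set_integrable lborel (annulus a b) (\<lambda>x. f x * g x)"
proof -
  have "(\<lambda>x. indicator (annulus a b) x *\<^sub>R g x) \<in> borel_measurable borel"
    using borel_measurable_continuous_on_indicator[OF _ g] by simp
  then have "set_integrable lborel (annulus a b) (\<lambda>x. f x * (indicator (annulus a b) x *\<^sub>R g x))"
    by (rule set_integrable_mult_bounded[OF f, where B = "max 0 B"]) (use B in \<open>auto simp: indicator_def le_max_iff_disj\<close>)
  moreover have "indicator (annulus a b) x *\<^sub>R (f x * (indicator (annulus a b) x *\<^sub>R g x)) =
      indicator (annulus a b) x *\<^sub>R (f x * g x)" for x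
    by (simp add: indicator_def)
  ultimately show ?thesis by (simp only: set_integrable_def)
qed

lemma set_integrable_mult_ang:
  assumes "0 < a" "set_integrable lborel (annulus a b) f"
  shows "set_integrable lborel (annulus a b) (\<lambda>x. f x * ang q x)"
  by (rule set_integrable_mult_annulus[OF assms(2), where B = 1])
     (use assms(1) norm_ang annulus_nonzero in \<open>force intro!: continuous_on_ang simp: annulus_def\<close>)+

lemma circle_integral_radial:
  fixes f :: "real^2 \<Rightarrow> complex"
  assumes "r > 0"
  shows "circle_integral (\<lambda>x. f x * k (norm x)) r = circle_integral f r * k r"
  using assms by (simp add: circle_integral_def norm_polar)

lemma fourier_coeff_radial:
  assumes "r > 0"
  shows "fourier_coeff (\<lambda>x. f x * k (norm x)) q r = fourier_coeff f q r * k r"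
proof -
  have "(\<lambda>x. f x * k (norm x) * ang (- q) x) = (\<lambda>x. (f x * ang (- q) x) * k (norm x))" by (simp add: mult_ac)
  then show ?thesis
    using circle_integral_radial[OF assms, of "\<lambda>x. f x * ang (- q) x" k]
    by (simp only: fourier_coeff_eq[OF assms] mult.assoc)
qed

text \<open>Integrates a function against one angular mode; the weight r is the polar
  Jacobian.\<close>

lemma fourier_coeff_integral:
  assumes ab: "0 < a" "a < b" and f: "set_integrable lborel (annulus a b) f"
  shows "set_integrable lborel {a<..<b} (\<lambda>r. of_real r * fourier_coeff f q r)"
    and "(LINT x:annulus a b|lborel. f x * ang (- q) x) = 2 * pi * (LINT r:{a<..<b}|lborel. of_real r * fourier_coeff f q r)"
proof -
  note P = polar_Fubini[OF ab set_integrable_mult_ang[OF ab(1) f, of "- q"]]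
  have eq: "indicator {a<..<b} r *\<^sub>R (r *\<^sub>R circle_integral (\<lambda>x. f x * ang (- q) x) r) =
      (2 * pi) *\<^sub>R (indicator {a<..<b} r *\<^sub>R (of_real r * fourier_coeff f q r))" for r
    using ab by (simp add: indicator_def fourier_coeff_eq scaleR_conv_of_real)
  have "integrable lborel (\<lambda>r. (1 / (2 * pi)) *\<^sub>R ((2 * pi) *\<^sub>R (indicator {a<..<b} r *\<^sub>R (of_real r * fourier_coeff f q r))))"
    using P(2) unfolding set_integrable_def eq by (rule integrable_scaleR_right)
  then show "set_integrable lborel {a<..<b} (\<lambda>r. of_real r * fourier_coeff f q r)"
    by (simp add: set_integrable_def)
  have "(LINT x:annulus a b|lborel. f x * ang (- q) x) =
      (LINT r|lborel. (2 * pi) *\<^sub>R (indicator {a<..<b} r *\<^sub>R (of_real r * fourier_coeff f q r)))"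
    using P(3) unfolding set_lebesgue_integral_def eq .
  then show "(LINT x:annulus a b|lborel. f x * ang (- q) x) = 2 * pi * (LINT r:{a<..<b}|lborel. of_real r * fourier_coeff f q r)"
    by (simp only: integral_scaleR_right set_lebesgue_integral_def) (simp add: scaleR_conv_of_real)
qed

lemma fourier_coeff_sum_le:
  assumes ab: "0 < a" "a < b" and f: "L2 (annulus a b) f" and Q: "finite Q"
  shows "AE r in lborel. r \<in> {a<..<b} \<longrightarrow>
    (\<Sum>q\<in>Q. (cmod (fourier_coeff f q r))\<^sup>2) \<le> 1 / (2 * pi) * circle_integral (\<lambda>x. (cmod (f x))\<^sup>2) r"
proof -
  have fi: "set_integrable lborel (annulus a b) f"
    using f emeasure_annulus_finite[of a b] by (intro set_integrable_L2) auto
  have f2: "set_integrable lborel (annulus a b) (\<lambda>x. (cmod (f x))\<^sup>2)" using f by (simp add: L2_def)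
  show ?thesis
    using polar_Fubini(1)[OF ab fi] polar_Fubini(1)[OF ab f2]
  proof eventually_elim
    case (elim r)
    show ?case
    proof
      assume r: "r \<in> {a<..<b}"
      then have r0: "r > 0" using ab by simp
      have "L2 {0..2*pi} (\<lambda>\<theta>. f (polar r \<theta>))"
        using elim r by (auto simp: L2_def set_integrable_def set_borel_measurable_def)
      from bessel_inequality_circle[OF this Q]
      show "(\<Sum>q\<in>Q. (cmod (fourier_coeff f q r))\<^sup>2) \<le> 1 / (2 * pi) * circle_integral (\<lambda>x. (cmod (f x))\<^sup>2) r"
        using r0 by (simp add: fourier_coeff_eq circle_integral_def ang_polar)
    qed
  qed
qed

text \<open>Measurability follows from Fubini after dividing by the weight r, and square
  integrability from the one-term Bessel inequality on almost every circle.\<close>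

lemma L2_fourier_coeff:
  assumes ab: "0 < a" "a < b" and f: "L2 (annulus a b) f"
  shows "L2 {a<..<b} (fourier_coeff f q)"
proof -
  have fi: "set_integrable lborel (annulus a b) f"
    using f emeasure_annulus_finite[of a b] by (intro set_integrable_L2) auto
  have f2: "set_integrable lborel (annulus a b) (\<lambda>x. (cmod (f x))\<^sup>2)" using f by (simp add: L2_def)
  have m: "set_borel_measurable lborel {a<..<b} (fourier_coeff f q)"
  proof -
    have "set_integrable lborel {a<..<b} (\<lambda>r. (of_real r * fourier_coeff f q r) * of_real (1 / r))"
      by (rule set_integrable_mult_continuous[OF fourier_coeff_integral(1)[OF ab fi]])
         (use ab in \<open>auto intro!: continuous_intros\<close>)
    then have "(\<lambda>r. indicator {a<..<b} r *\<^sub>R ((of_real r * fourier_coeff f q r) * of_real (1 / r))) \<in> borel_measurable lborel"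
      unfolding set_integrable_def by (rule borel_measurable_integrable)
    moreover have "indicator {a<..<b} r *\<^sub>R ((of_real r * fourier_coeff f q r) * of_real (1 / r)) =
        indicator {a<..<b} r *\<^sub>R fourier_coeff f q r" for r
      using ab by (simp add: indicator_def)
    ultimately show ?thesis by (simp only: set_borel_measurable_def)
  qed
  have i: "set_integrable lborel {a<..<b} (\<lambda>r. (r *\<^sub>R circle_integral (\<lambda>x. (cmod (f x))\<^sup>2) r) * (1 / (2 * pi) * (1 / r)))"
    by (rule set_integrable_mult_continuous[OF polar_Fubini(2)[OF ab f2]]) (use ab in \<open>auto intro!: continuous_intros\<close>)
  have "set_integrable lborel {a<..<b} (\<lambda>r. (cmod (fourier_coeff f q r))\<^sup>2)"
    unfolding set_integrable_def
  proof (rule Bochner_Integration.integrable_bound[OF i[unfolded set_integrable_def]])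
    have "(\<lambda>r. (cmod (indicator {a<..<b} r *\<^sub>R fourier_coeff f q r))\<^sup>2) \<in> borel_measurable lborel"
      using m unfolding set_borel_measurable_def by measurable
    moreover have "(cmod (indicator {a<..<b} r *\<^sub>R fourier_coeff f q r))\<^sup>2 =
        indicator {a<..<b} r *\<^sub>R (cmod (fourier_coeff f q r))\<^sup>2" for r
      by (simp add: indicator_def)
    ultimately show "(\<lambda>r. indicator {a<..<b} r *\<^sub>R (cmod (fourier_coeff f q r))\<^sup>2) \<in> borel_measurable lborel" by simp
    have "finite {q}" by simp
    from fourier_coeff_sum_le[OF ab f this]
    show "AE r in lborel. norm (indicator {a<..<b} r *\<^sub>R (cmod (fourier_coeff f q r))\<^sup>2) \<le>
        norm (indicator {a<..<b} r *\<^sub>R ((r *\<^sub>R circle_integral (\<lambda>x. (cmod (f x))\<^sup>2) r) * (1 / (2 * pi) * (1 / r))))"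
    proof eventually_elim
      case (elim r)
      show ?case
      proof (cases "r \<in> {a<..<b}")
        case True
        then have "(cmod (fourier_coeff f q r))\<^sup>2 \<le> 1 / (2 * pi) * circle_integral (\<lambda>x. (cmod (f x))\<^sup>2) r"
          using elim by simp
        then have "(cmod (fourier_coeff f q r))\<^sup>2 \<le> \<bar>1 / (2 * pi) * circle_integral (\<lambda>x. (cmod (f x))\<^sup>2) r\<bar>"
          by (rule order_trans[OF _ abs_ge_self])
        then show ?thesis using True ab by simp
      qed simp
    qed
  qed
  then show ?thesis using m by (simp add: L2_def)
qed

section \<open>Weak derivatives in polar coordinates\<close>

lemma radial_has_derivative:
  assumes "test_function {a<..<b} \<phi>" "x \<noteq> 0"
  shows "((\<lambda>x :: real^2. \<phi> (norm x)) has_derivative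
    (\<lambda>h. of_real ((x $ 1 * h $ 1 + x $ 2 * h $ 2) / norm x) * partial_deriv 1 \<phi> (norm x))) (at x)"
proof -
  have "(\<phi> has_derivative (\<lambda>h. h *\<^sub>R partial_deriv 1 \<phi> (norm x))) (at (norm x))"
    using test_function_has_vector_derivative[OF assms(1), of _ UNIV] by (simp add: has_vector_derivative_def)
  from has_derivative_compose[OF has_derivative_norm_2[OF assms(2)] this] show ?thesis by (simp add: scaleR_conv_of_real)
qed

text \<open>The norm is smooth away from the origin, and the preimage of a compact set of radii
  strictly between \<open>a\<close> and \<open>b\<close> is a compact subset of the annulus.\<close>

lemma test_function_radial:
  assumes a: "0 < a" and \<phi>: "test_function {a<..<b} \<phi>"
  shows "test_function (annulus a b) (\<lambda>x. \<phi> (norm x))"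
proof -
  obtain K where K: "compact K" "K \<subseteq> {a<..<b}" "\<And>x. x \<notin> K \<Longrightarrow> \<phi> x = 0"
    using test_functionE[OF \<phi>] by metis
  define K' where "K' = (norm -` K :: (real^2) set)"
  have cK': "closed K'"
    unfolding K'_def using K(1) by (intro closed_vimage compact_imp_closed continuous_intros)
  have sub: "K' \<subseteq> annulus a b" using K(2) by (auto simp: K'_def annulus_def)
  have "bounded K'"
    by (rule bounded_subset[OF bounded_ball[of 0 b]]) (use sub in \<open>auto simp: annulus_def\<close>)
  then have compact: "compact K'" using cK' by (simp add: compact_eq_bounded_closed)
  have z: "\<phi> (norm x) = 0" if "x \<in> - K'" for x using that K(3) by (simp add: K'_def)
  note p0 = partial_deriv_eq_0[OF open_Compl[OF cK'] _ z]
  have UN: "UNIV = annulus a b \<union> - K'" using sub by auto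
  have d: "(\<lambda>x. \<phi> (norm x)) differentiable (at x)" for x :: "real^2"
  proof (cases "x \<in> annulus a b")
    case True
    from radial_has_derivative[OF \<phi> annulus_nonzero[OF a this]]
    show ?thesis by (rule differentiableI)
  next
    case False
    then have "x \<in> - K'" using sub by blast
    from p0(1)[OF this] show ?thesis by (rule differentiableI)
  qed
  have "continuous_on UNIV (partial_deriv i (\<lambda>x. \<phi> (norm x)))" for i :: "real^2"
    unfolding UN
  proof (rule continuous_on_open_Un)
    have "continuous_on UNIV (partial_deriv 1 \<phi>)" using \<phi> by (simp add: test_function_def)
    then have c: "continuous_on (annulus a b) (\<lambda>x. partial_deriv 1 \<phi> (norm x))"
      by (rule continuous_on_compose2) (auto intro: continuous_intros)
    have "continuous_on (annulus a b) (\<lambda>x. of_real ((x $ 1 * i $ 1 + x $ 2 * i $ 2) / norm x) * partial_deriv 1 \<phi> (norm x))"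
      using annulus_nonzero[OF a] by (intro continuous_intros c) auto
    then show "continuous_on (annulus a b) (partial_deriv i (\<lambda>x. \<phi> (norm x)))"
      by (rule continuous_on_eq) (rule partial_deriv_eq[OF radial_has_derivative[OF \<phi> annulus_nonzero[OF a]], symmetric])
    show "continuous_on (- K') (partial_deriv i (\<lambda>x. \<phi> (norm x)))"
      by (rule continuous_on_eq[OF continuous_on_const[of _ 0]]) (rule p0(2)[symmetric])
  qed (use cK' in auto)
  then show ?thesis
    unfolding test_function_def differentiable_on_def
    using d compact sub z by (intro conjI ballI exI[of _ K'] allI impI) auto
qed

section \<open>Radial and angular components of a weak gradient\<close>

definition rad_deriv :: "(real^2 \<Rightarrow> complex) \<Rightarrow> (real^2 \<Rightarrow> complex) \<Rightarrow> real^2 \<Rightarrow> complex" where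
  "rad_deriv g1 g2 x = (of_real (x $ 1) * g1 x + of_real (x $ 2) * g2 x) / of_real (norm x)"

text \<open>Contains the factor 1/r: this is the component of the gradient along the unit tangent,
  so together with \<open>rad_deriv\<close> it preserves the length of the gradient.\<close>

definition ang_deriv :: "(real^2 \<Rightarrow> complex) \<Rightarrow> (real^2 \<Rightarrow> complex) \<Rightarrow> real^2 \<Rightarrow> complex" where
  "ang_deriv g1 g2 x = (of_real (x $ 1) * g2 x - of_real (x $ 2) * g1 x) / of_real (norm x)"

lemma rad_ang_deriv_norm:
  assumes "x \<noteq> 0"
  shows "(cmod (rad_deriv g1 g2 x))\<^sup>2 + (cmod (ang_deriv g1 g2 x))\<^sup>2 = (cmod (g1 x))\<^sup>2 + (cmod (g2 x))\<^sup>2"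
proof -
  have n: "(norm x)\<^sup>2 = (x $ 1)\<^sup>2 + (x $ 2)\<^sup>2" by (simp add: norm_real_2)
  have "(cmod (of_real p * z + of_real t * w))\<^sup>2 + (cmod (of_real p * w - of_real t * z))\<^sup>2 =
      (p\<^sup>2 + t\<^sup>2) * ((cmod z)\<^sup>2 + (cmod w)\<^sup>2)" for p t z w
    unfolding cmod_power2 by (simp add: power2_eq_square algebra_simps)
  from this[of "x $ 1" "g1 x" "x $ 2" "g2 x"]
  have "(cmod (of_real (x $ 1) * g1 x + of_real (x $ 2) * g2 x))\<^sup>2 + (cmod (of_real (x $ 1) * g2 x - of_real (x $ 2) * g1 x))\<^sup>2
      = (norm x)\<^sup>2 * ((cmod (g1 x))\<^sup>2 + (cmod (g2 x))\<^sup>2)" by (simp only: n)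
  then show ?thesis
    using assms
    by (simp add: rad_deriv_def ang_deriv_def norm_divide power_divide add_divide_distrib[symmetric])
qed

text \<open>
  The vector fields \<open>\<kappa>(|x|) e\<^sup>-\<^sup>i\<^sup>q\<^sup>\<theta> x\<close> and \<open>\<kappa>(|x|) e\<^sup>-\<^sup>i\<^sup>q\<^sup>\<theta> x\<^sup>\<bottom>\<close> have divergence
  \<open>(2\<kappa> + r\<kappa>') e\<^sup>-\<^sup>i\<^sup>q\<^sup>\<theta>\<close> and \<open>-iq\<kappa> e\<^sup>-\<^sup>i\<^sup>q\<^sup>\<theta>\<close>; testing with them extracts the polar derivatives.
\<close>

lemma test_field:
  fixes q :: int
  assumes a: "0 < a" and \<kappa>: "test_function {a<..<b} \<kappa>"
  defines "T \<equiv> \<lambda>c d x. of_real (c * x $ 1 + d * x $ 2) * ang (- q) x * \<kappa> (norm x)"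
  shows "test_function (annulus a b) (T c d)"
    and "x \<in> annulus a b \<Longrightarrow> partial_deriv h (T c d) x =
      of_real (c * x $ 1 + d * x $ 2) * ang (- q) x * (of_real ((x $ 1 * h $ 1 + x $ 2 * h $ 2) / norm x) * partial_deriv 1 \<kappa> (norm x))
      + (of_real (c * h $ 1 + d * h $ 2) * ang (- q) x
         - of_real (c * x $ 1 + d * x $ 2) * (\<i> * of_int q * of_real ((x $ 1 * h $ 2 - x $ 2 * h $ 1) / (norm x)\<^sup>2) * ang (- q) x)) * \<kappa> (norm x)"
proof -
  let ?M = "\<lambda>x :: real^2. of_real (c * x $ 1 + d * x $ 2) * ang (- q) x"
  have dM: "(?M has_derivative (\<lambda>h. of_real (c * x $ 1 + d * x $ 2) *
        (\<i> * of_int (- q) * of_real ((x $ 1 * h $ 2 - x $ 2 * h $ 1) / (norm x)\<^sup>2) * ang (- q) x) +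
        of_real (c * h $ 1 + d * h $ 2) * ang (- q) x)) (at x)" if "x \<noteq> 0" for x
  proof -
    have "((\<lambda>x :: real^2. complex_of_real (c * x $ 1 + d * x $ 2)) has_derivative (\<lambda>h. of_real (c * h $ 1 + d * h $ 2))) (at x)"
      by (intro bounded_linear_imp_has_derivative bounded_linear_compose[OF bounded_linear_of_real]
          bounded_linear_add bounded_linear_const_mult bounded_linear_vec_nth)
    from has_derivative_mult[OF this ang_has_derivative[OF that, of "- q"]] show ?thesis .
  qed
  note pM = partial_deriv_eq[OF dM]
  have cM: "continuous_on (annulus a b) (partial_deriv i ?M)" for i
  proof -
    have "continuous_on (annulus a b) (ang (- q))"
      by (rule continuous_on_ang) (use a in \<open>auto simp: annulus_def\<close>)
    then have "continuous_on (annulus a b) (\<lambda>x. of_real (c * x $ 1 + d * x $ 2) *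
        (\<i> * of_int (- q) * of_real ((x $ 1 * i $ 2 - x $ 2 * i $ 1) / (norm x)\<^sup>2) * ang (- q) x) +
        of_real (c * i $ 1 + d * i $ 2) * ang (- q) x)"
      using annulus_nonzero[OF a] by (intro continuous_intros) auto
    then show ?thesis
      by (rule continuous_on_eq) (use pM annulus_nonzero[OF a] in auto)
  qed
  have diffM: "?M differentiable (at x)" if "x \<in> annulus a b" for x
    using dM[OF annulus_nonzero[OF a that]] unfolding differentiable_def by blast
  note R = test_function_radial[OF a \<kappa>]
  show "test_function (annulus a b) (T c d)"
    unfolding T_def by (rule test_function_mult(1)[OF annulus_open R diffM cM])
  show "partial_deriv h (T c d) x =
      of_real (c * x $ 1 + d * x $ 2) * ang (- q) x * (of_real ((x $ 1 * h $ 1 + x $ 2 * h $ 2) / norm x) * partial_deriv 1 \<kappa> (norm x))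
      + (of_real (c * h $ 1 + d * h $ 2) * ang (- q) x
         - of_real (c * x $ 1 + d * x $ 2) * (\<i> * of_int q * of_real ((x $ 1 * h $ 2 - x $ 2 * h $ 1) / (norm x)\<^sup>2) * ang (- q) x)) * \<kappa> (norm x)"
    if x: "x \<in> annulus a b"
  proof -
    have "partial_deriv h (T c d) x = ?M x * partial_deriv h (\<lambda>x. \<kappa> (norm x)) x + partial_deriv h ?M x * \<kappa> (norm x)"
      unfolding T_def by (rule test_function_mult(2)[OF annulus_open R diffM cM x])
    also have "partial_deriv h (\<lambda>x. \<kappa> (norm x)) x =
        of_real ((x $ 1 * h $ 1 + x $ 2 * h $ 2) / norm x) * partial_deriv 1 \<kappa> (norm x)"
      by (rule partial_deriv_eq[OF radial_has_derivative[OF \<kappa> annulus_nonzero[OF a x]]])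
    also have "partial_deriv h ?M x = of_real (c * h $ 1 + d * h $ 2) * ang (- q) x
         - of_real (c * x $ 1 + d * x $ 2) * (\<i> * of_int q * of_real ((x $ 1 * h $ 2 - x $ 2 * h $ 1) / (norm x)\<^sup>2) * ang (- q) x)"
      unfolding pM[OF annulus_nonzero[OF a x]] by simp
    finally show ?thesis .
  qed
qed

lemma set_integrable_mult_radial:
  fixes f :: "real^2 \<Rightarrow> complex" and k :: "real \<Rightarrow> complex"
  assumes f: "set_integrable lborel (annulus a b) f"
    and k: "continuous_on UNIV k" "compact K" "\<And>r. r \<notin> K \<Longrightarrow> k r = 0"
  shows "set_integrable lborel (annulus a b) (\<lambda>x. f x * k (norm x))"
proof -
  obtain B where B: "\<And>r. norm (k r) \<le> B" using bounded_if_compact_support[OF k] by blast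
  show ?thesis
    by (rule set_integrable_mult_annulus[OF f _ B])
       (rule continuous_on_compose2[OF k(1)], auto intro: continuous_intros)
qed

lemma radial_fourier_integral:
  fixes f :: "real^2 \<Rightarrow> complex" and k :: "real \<Rightarrow> complex"
  assumes ab: "0 < a" "a < b" and f: "set_integrable lborel (annulus a b) f"
    and k: "continuous_on UNIV k" "compact K" "\<And>r. r \<notin> K \<Longrightarrow> k r = 0"
  shows "(LINT x:annulus a b|lborel. f x * k (norm x) * ang (- q) x) =
    2 * pi * (LINT r:{a<..<b}|lborel. of_real r * fourier_coeff f q r * k r)"
proof -
  have "(LINT r:{a<..<b}|lborel. of_real r * fourier_coeff (\<lambda>x. f x * k (norm x)) q r) =
      (LINT r:{a<..<b}|lborel. of_real r * fourier_coeff f q r * k r)"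
    by (rule set_lebesgue_integral_cong) (use ab in \<open>auto simp: fourier_coeff_radial\<close>)
  then show ?thesis
    using fourier_coeff_integral(2)[OF ab set_integrable_mult_radial[OF f k], of q] by simp
qed

lemma DERIV_inverse_square:
  "r \<noteq> 0 \<Longrightarrow> ((\<lambda>r :: real. 1 / r\<^sup>2) has_real_derivative - 2 / r ^ 3) (at r)"
  by (rule derivative_eq_intros refl | assumption | simp)+
     (simp add: divide_simps power2_eq_square power3_eq_cube power4_eq_xxxx)

lemma two_pi_cancel:
  assumes "2 * complex_of_real pi * X = - (2 * complex_of_real pi * Y)"
  shows "X = - Y"
proof -
  have "2 * complex_of_real pi * X = 2 * complex_of_real pi * (- Y)" using assms by simp
  then show ?thesis by (simp only: mult_cancel_left) simp
qed

text \<open>\<open>g1\<close> and \<open>g2\<close> are arbitrary weak partial derivatives; they are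
  specialized to the chosen ones only when the norm of \<open>u\<close> is compared.\<close>

locale annulus_H1 =
  fixes a b :: real and u g1 g2 :: "real^2 \<Rightarrow> complex"
  assumes ab: "0 < a" "a < b"
    and u: "L2 (annulus a b) u"
    and g1: "is_L2_weak_deriv (annulus a b) (axis 1 1) u g1"
    and g2: "is_L2_weak_deriv (annulus a b) (axis 2 1) u g2"
begin

abbreviation "\<Omega> \<equiv> annulus a b"

lemma L2_imp_integrable: "L2 \<Omega> f \<Longrightarrow> set_integrable lborel \<Omega> f"
  using emeasure_annulus_finite[of a b] by (intro set_integrable_L2) auto

lemma L2_g: "L2 \<Omega> g1" "L2 \<Omega> g2"
  using g1 g2 by (auto simp: is_L2_weak_deriv_def)

lemma L2_polar_derivs: "L2 \<Omega> (rad_deriv g1 g2)" "L2 \<Omega> (ang_deriv g1 g2)"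
proof -
  have c: "set_borel_measurable lborel \<Omega> (\<lambda>x. complex_of_real (x $ i / norm x))" for i
  proof -
    have "continuous_on \<Omega> (\<lambda>x. complex_of_real (x $ i / norm x))"
      using annulus_nonzero[OF ab(1)] by (intro continuous_intros) auto
    then have "(\<lambda>x. indicator \<Omega> x *\<^sub>R complex_of_real (x $ i / norm x)) \<in> borel_measurable borel"
      by (intro borel_measurable_continuous_on_indicator) auto
    then show ?thesis by (simp add: set_borel_measurable_def)
  qed
  have gm: "set_borel_measurable lborel \<Omega> g1" "set_borel_measurable lborel \<Omega> g2"
    using L2_g by (auto simp: L2_def)
  have add: "set_borel_measurable lborel \<Omega> (\<lambda>x. f x + g x)" "set_borel_measurable lborel \<Omega> (\<lambda>x. f x - g x)"
    if "set_borel_measurable lborel \<Omega> f" "set_borel_measurable lborel \<Omega> g" for f g :: "real^2 \<Rightarrow> complex"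
    using that unfolding set_borel_measurable_def scaleR_add_right scaleR_diff_right
    by (auto intro: borel_measurable_add borel_measurable_diff)
  have r: "rad_deriv g1 g2 = (\<lambda>x. of_real (x $ 1 / norm x) * g1 x + of_real (x $ 2 / norm x) * g2 x)"
    and t: "ang_deriv g1 g2 = (\<lambda>x. of_real (x $ 1 / norm x) * g2 x - of_real (x $ 2 / norm x) * g1 x)"
    by (auto simp: rad_deriv_def ang_deriv_def add_divide_distrib diff_divide_distrib)
  have mr: "set_borel_measurable lborel \<Omega> (rad_deriv g1 g2)" "set_borel_measurable lborel \<Omega> (ang_deriv g1 g2)"
    unfolding r t by (intro add set_borel_measurable_mult c gm)+
  have i: "integrable lborel (\<lambda>x. indicator \<Omega> x *\<^sub>R ((cmod (g1 x))\<^sup>2 + (cmod (g2 x))\<^sup>2))"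
    using set_integral_add(1)[of lborel \<Omega> "\<lambda>x. (cmod (g1 x))\<^sup>2" "\<lambda>x. (cmod (g2 x))\<^sup>2"] L2_g
    by (simp add: L2_def set_integrable_def)
  have L: "L2 \<Omega> f" if m: "set_borel_measurable lborel \<Omega> f"
    and le: "\<And>x. x \<in> \<Omega> \<Longrightarrow> (cmod (f x))\<^sup>2 \<le> (cmod (g1 x))\<^sup>2 + (cmod (g2 x))\<^sup>2" for f :: "real^2 \<Rightarrow> complex"
  proof -
    have "(\<lambda>x. (cmod (indicator \<Omega> x *\<^sub>R f x))\<^sup>2) \<in> borel_measurable lborel"
      using m unfolding set_borel_measurable_def by measurable
    moreover have "(cmod (indicator \<Omega> x *\<^sub>R f x))\<^sup>2 = indicator \<Omega> x *\<^sub>R (cmod (f x))\<^sup>2" for x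
      by (simp add: indicator_def)
    ultimately have "(\<lambda>x. indicator \<Omega> x *\<^sub>R (cmod (f x))\<^sup>2) \<in> borel_measurable lborel" by simp
    then have "set_integrable lborel \<Omega> (\<lambda>x. (cmod (f x))\<^sup>2)"
      unfolding set_integrable_def
      by (rule Bochner_Integration.integrable_bound[OF i]) (use le in \<open>auto simp: indicator_def\<close>)
    then show ?thesis using m by (simp add: L2_def)
  qed
  have n: "(cmod (rad_deriv g1 g2 x))\<^sup>2 + (cmod (ang_deriv g1 g2 x))\<^sup>2 = (cmod (g1 x))\<^sup>2 + (cmod (g2 x))\<^sup>2"
    if "x \<in> \<Omega>" for x
    by (rule rad_ang_deriv_norm[OF annulus_nonzero[OF ab(1) that]])
  have "(cmod (rad_deriv g1 g2 x))\<^sup>2 \<le> (cmod (g1 x))\<^sup>2 + (cmod (g2 x))\<^sup>2"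
    "(cmod (ang_deriv g1 g2 x))\<^sup>2 \<le> (cmod (g1 x))\<^sup>2 + (cmod (g2 x))\<^sup>2" if "x \<in> \<Omega>" for x
    using n[OF that] zero_le_power2[of "cmod (rad_deriv g1 g2 x)"] zero_le_power2[of "cmod (ang_deriv g1 g2 x)"]
    by linarith+
  then show "L2 \<Omega> (rad_deriv g1 g2)" "L2 \<Omega> (ang_deriv g1 g2)" using L mr by blast+
qed

text \<open>Integration by parts against the vector field (T1, T2), obtained by adding the two
  coordinate identities.\<close>

lemma divergence_identity:
  assumes T1: "test_function \<Omega> T1" and T2: "test_function \<Omega> T2"
    and D: "\<And>x. x \<in> \<Omega> \<Longrightarrow> u x * (partial_deriv (axis 1 1) T1 x + partial_deriv (axis 2 1) T2 x) = D x"
    and G: "\<And>x. x \<in> \<Omega> \<Longrightarrow> g1 x * T1 x + g2 x * T2 x = G x"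
  shows "(LINT x:\<Omega>|lborel. D x) = - (LINT x:\<Omega>|lborel. G x)"
proof -
  have B: "(axis 1 1 :: real^2) \<in> Basis" "(axis 2 1 :: real^2) \<in> Basis" by (auto simp: Basis_real_2)
  note iu = L2_imp_integrable[OF u] and ig = L2_imp_integrable[OF L2_g(1)] L2_imp_integrable[OF L2_g(2)]
  have "(LINT x:\<Omega>|lborel. D x) =
      (LINT x:\<Omega>|lborel. u x * partial_deriv (axis 1 1) T1 x + u x * partial_deriv (axis 2 1) T2 x)"
    by (rule set_lebesgue_integral_cong) (use D in \<open>auto simp: distrib_left\<close>)
  also have "\<dots> = (LINT x:\<Omega>|lborel. u x * partial_deriv (axis 1 1) T1 x) + (LINT x:\<Omega>|lborel. u x * partial_deriv (axis 2 1) T2 x)"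
    by (intro set_integral_add(2) set_integrable_mult_test_function(2)[OF iu T1 B(1)]
        set_integrable_mult_test_function(2)[OF iu T2 B(2)])
  also have "\<dots> = - ((LINT x:\<Omega>|lborel. g1 x * T1 x) + (LINT x:\<Omega>|lborel. g2 x * T2 x))"
    using g1 g2 T1 T2 by (simp add: is_L2_weak_deriv_def)
  also have "(LINT x:\<Omega>|lborel. g1 x * T1 x) + (LINT x:\<Omega>|lborel. g2 x * T2 x) = (LINT x:\<Omega>|lborel. g1 x * T1 x + g2 x * T2 x)"
    by (intro set_integral_add(2)[symmetric] set_integrable_mult_test_function(1)[OF ig(1) T1]
        set_integrable_mult_test_function(1)[OF ig(2) T2])
  also have "\<dots> = (LINT x:\<Omega>|lborel. G x)"
    by (rule set_lebesgue_integral_cong) (use G in auto)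
  finally show ?thesis .
qed

text \<open>Each field pairs \<open>u\<close> with a divergence and the gradient with a single polar
  component. Only the mode q survives the angular integration, which leaves one-dimensional
  integrals with weight r.\<close>

lemma polar_identities:
  assumes \<kappa>: "test_function {a<..<b} \<kappa>"
  shows "(LINT r:{a<..<b}|lborel. of_real r * fourier_coeff u q r * (2 * \<kappa> r + of_real r * partial_deriv 1 \<kappa> r)) =
      - (LINT r:{a<..<b}|lborel. of_real r * fourier_coeff (rad_deriv g1 g2) q r * (of_real r * \<kappa> r))"
    and "(LINT r:{a<..<b}|lborel. of_real r * fourier_coeff u q r * (- \<i> * of_int q * \<kappa> r)) =
      - (LINT r:{a<..<b}|lborel. of_real r * fourier_coeff (ang_deriv g1 g2) q r * (of_real r * \<kappa> r))"
proof -
  let ?T = "\<lambda>c d x. of_real (c * x $ 1 + d * x $ 2) * ang (- q) x * \<kappa> (norm x)"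
  let ?E = "ang (- q)"
  note tf = test_field(1)[OF ab(1) \<kappa>, where q = q] and pd = test_field(2)[OF ab(1) \<kappa>, where q = q]
  have ax: "(axis 1 1 :: real^2) $ 1 = 1" "(axis 1 1 :: real^2) $ 2 = 0"
    "(axis 2 1 :: real^2) $ 1 = 0" "(axis 2 1 :: real^2) $ 2 = 1"
    by (auto simp: axis_def)
  have n2: "(of_real (x $ 1) * of_real (x $ 1) + of_real (x $ 2) * of_real (x $ 2) :: complex) / of_real (norm x) = of_real (norm x)"
    if "x \<in> \<Omega>" for x
  proof -
    have "(x $ 1 * x $ 1 + x $ 2 * x $ 2) / norm x = norm x"
      using annulus_nonzero[OF ab(1) that] norm_real_2[of x]
      by (simp add: divide_eq_eq flip: power2_eq_square)
    from arg_cong[OF this, of complex_of_real] show ?thesis by simp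
  qed
  obtain K where K: "compact K" "\<And>x. x \<notin> K \<Longrightarrow> \<kappa> x = 0" "\<And>i x. x \<notin> K \<Longrightarrow> partial_deriv i \<kappa> x = 0"
    using test_functionE[OF \<kappa>] by metis
  have ck: "continuous_on UNIV \<kappa>" "continuous_on UNIV (partial_deriv 1 \<kappa>)"
    using test_function_continuous[OF \<kappa>] \<kappa> by (auto simp: test_function_def)
  note rf = radial_fourier_integral[OF ab _ _ K(1), where q = q]
  have "(LINT x:\<Omega>|lborel. u x * (2 * \<kappa> (norm x) + of_real (norm x) * partial_deriv 1 \<kappa> (norm x)) * ?E x) =
      - (LINT x:\<Omega>|lborel. rad_deriv g1 g2 x * (of_real (norm x) * \<kappa> (norm x)) * ?E x)"
  \<comment> \<open>The coefficients select the components x_1 and x_2, giving the radial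
    field.\<close>
  proof (rule divergence_identity[OF tf[where c = 1 and d = 0] tf[where c = 0 and d = 1]])
    fix x assume x: "x \<in> \<Omega>"
    have "partial_deriv (axis 1 1) (?T 1 0) x + partial_deriv (axis 2 1) (?T 0 1) x =
        (of_real (x $ 1) * of_real (x $ 1) + of_real (x $ 2) * of_real (x $ 2)) / of_real (norm x) * ?E x * partial_deriv 1 \<kappa> (norm x)
        + 2 * ?E x * \<kappa> (norm x)"
      unfolding pd[OF x] ax by (simp add: algebra_simps add_divide_distrib diff_divide_distrib)
    then have e: "partial_deriv (axis 1 1) (?T 1 0) x + partial_deriv (axis 2 1) (?T 0 1) x =
        (2 * \<kappa> (norm x) + of_real (norm x) * partial_deriv 1 \<kappa> (norm x)) * ?E x"
      unfolding n2[OF x] by (simp add: algebra_simps)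
    show "u x * (partial_deriv (axis 1 1) (?T 1 0) x + partial_deriv (axis 2 1) (?T 0 1) x) =
        u x * (2 * \<kappa> (norm x) + of_real (norm x) * partial_deriv 1 \<kappa> (norm x)) * ?E x"
      unfolding e by (simp only: mult.assoc)
    show "g1 x * ?T 1 0 x + g2 x * ?T 0 1 x = rad_deriv g1 g2 x * (of_real (norm x) * \<kappa> (norm x)) * ?E x"
    proof -
      have h: "rad_deriv g1 g2 x * of_real (norm x) = of_real (x $ 1) * g1 x + of_real (x $ 2) * g2 x"
        using annulus_nonzero[OF ab(1) x] by (simp add: rad_deriv_def)
      have "rad_deriv g1 g2 x * (of_real (norm x) * \<kappa> (norm x)) * ?E x = (rad_deriv g1 g2 x * of_real (norm x)) * \<kappa> (norm x) * ?E x"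
        by (simp only: mult.assoc)
      then show ?thesis unfolding h by (simp add: algebra_simps)
    qed
  qed
  note id1 = this
  have ck1: "continuous_on UNIV (\<lambda>r. 2 * \<kappa> r + of_real r * partial_deriv 1 \<kappa> r)"
    and ck2: "continuous_on UNIV (\<lambda>r. of_real r * \<kappa> r)" and ck3: "continuous_on UNIV (\<lambda>r. - \<i> * of_int q * \<kappa> r)"
    by (intro continuous_intros ck)+
  have k1: "2 * \<kappa> r + of_real r * partial_deriv 1 \<kappa> r = 0" and k2: "of_real r * \<kappa> r = 0"
    and k3: "- \<i> * of_int q * \<kappa> r = 0" if "r \<notin> K" for r
    using K(2,3)[OF that] by simp_all
  have P1: "(LINT x:\<Omega>|lborel. u x * (2 * \<kappa> (norm x) + of_real (norm x) * partial_deriv 1 \<kappa> (norm x)) * ?E x) =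
      2 * complex_of_real pi * (LINT r:{a<..<b}|lborel. of_real r * fourier_coeff u q r * (2 * \<kappa> r + of_real r * partial_deriv 1 \<kappa> r))"
    using rf[OF L2_imp_integrable[OF u] ck1] k1 by simp
  have P2: "(LINT x:\<Omega>|lborel. f x * (of_real (norm x) * \<kappa> (norm x)) * ?E x) =
      2 * complex_of_real pi * (LINT r:{a<..<b}|lborel. of_real r * fourier_coeff f q r * (of_real r * \<kappa> r))" if "L2 \<Omega> f" for f
    using rf[OF L2_imp_integrable[OF that] ck2] k2 by simp
  show "(LINT r:{a<..<b}|lborel. of_real r * fourier_coeff u q r * (2 * \<kappa> r + of_real r * partial_deriv 1 \<kappa> r)) =
      - (LINT r:{a<..<b}|lborel. of_real r * fourier_coeff (rad_deriv g1 g2) q r * (of_real r * \<kappa> r))"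
    using id1 unfolding P1 P2[OF L2_polar_derivs(1)] by (rule two_pi_cancel)
  have "(LINT x:\<Omega>|lborel. u x * (- \<i> * of_int q * \<kappa> (norm x)) * ?E x) =
      - (LINT x:\<Omega>|lborel. ang_deriv g1 g2 x * (of_real (norm x) * \<kappa> (norm x)) * ?E x)"
  \<comment> \<open>The coefficients select -x_2 and x_1, giving the rotated field.\<close>
  proof (rule divergence_identity[OF tf[where c = 0 and d = "- 1"] tf[where c = 1 and d = 0]])
    fix x assume x: "x \<in> \<Omega>"
    have "partial_deriv (axis 1 1) (?T 0 (- 1)) x + partial_deriv (axis 2 1) (?T 1 0) x =
        - \<i> * of_int q * ?E x * \<kappa> (norm x) * (((of_real (x $ 1) * of_real (x $ 1) + of_real (x $ 2) * of_real (x $ 2)) / of_real (norm x)) / of_real (norm x))"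
      unfolding pd[OF x] ax by (simp add: algebra_simps add_divide_distrib diff_divide_distrib power2_eq_square)
    then have e: "partial_deriv (axis 1 1) (?T 0 (- 1)) x + partial_deriv (axis 2 1) (?T 1 0) x =
        (- \<i> * of_int q * \<kappa> (norm x)) * ?E x"
      unfolding n2[OF x] using annulus_nonzero[OF ab(1) x] by simp
    show "u x * (partial_deriv (axis 1 1) (?T 0 (- 1)) x + partial_deriv (axis 2 1) (?T 1 0) x) =
        u x * (- \<i> * of_int q * \<kappa> (norm x)) * ?E x"
      unfolding e by (simp only: mult.assoc)
    show "g1 x * ?T 0 (- 1) x + g2 x * ?T 1 0 x = ang_deriv g1 g2 x * (of_real (norm x) * \<kappa> (norm x)) * ?E x"
    proof -
      have h: "ang_deriv g1 g2 x * of_real (norm x) = of_real (x $ 1) * g2 x - of_real (x $ 2) * g1 x"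
        using annulus_nonzero[OF ab(1) x] by (simp add: ang_deriv_def)
      have "ang_deriv g1 g2 x * (of_real (norm x) * \<kappa> (norm x)) * ?E x = (ang_deriv g1 g2 x * of_real (norm x)) * \<kappa> (norm x) * ?E x"
        by (simp only: mult.assoc)
      then show ?thesis unfolding h by (simp add: algebra_simps)
    qed
  qed
  note id2 = this
  have P3: "(LINT x:\<Omega>|lborel. u x * (- \<i> * of_int q * \<kappa> (norm x)) * ?E x) =
      2 * complex_of_real pi * (LINT r:{a<..<b}|lborel. of_real r * fourier_coeff u q r * (- \<i> * of_int q * \<kappa> r))"
    using rf[OF L2_imp_integrable[OF u] ck3] k3 by simp
  show "(LINT r:{a<..<b}|lborel. of_real r * fourier_coeff u q r * (- \<i> * of_int q * \<kappa> r)) =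
      - (LINT r:{a<..<b}|lborel. of_real r * fourier_coeff (ang_deriv g1 g2) q r * (of_real r * \<kappa> r))"
    using id2 unfolding P3 P2[OF L2_polar_derivs(2)] by (rule two_pi_cancel)
qed

end

context annulus_H1
begin

text \<open>With \<kappa> = \<phi> / r^2 the weight r (2 \<kappa> + r \<kappa>') is the derivative
  of r^2 \<kappa>, that is \<phi>'. The first polar identity then is the defining relation of the
  weak derivative, with no weight left.\<close>

lemma fourier_coeff_weak_deriv:
  "is_L2_weak_deriv {a<..<b} 1 (fourier_coeff u q) (fourier_coeff (rad_deriv g1 g2) q)"
  unfolding is_L2_weak_deriv_def
proof (intro conjI allI impI)
  show "L2 {a<..<b} (fourier_coeff (rad_deriv g1 g2) q)" by (rule L2_fourier_coeff[OF ab L2_polar_derivs(1)])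
  fix \<phi> :: "real \<Rightarrow> complex" assume \<phi>: "test_function {a<..<b} \<phi>"
  define m where "m = (\<lambda>r :: real. complex_of_real (1 / r\<^sup>2))"
  define \<kappa> where "\<kappa> = (\<lambda>r. m r * \<phi> r)"
  have dm: "(m has_derivative (\<lambda>h. h *\<^sub>R of_real (- 2 / r ^ 3))) (at r)" if "r \<noteq> 0" for r
  proof -
    have "((\<lambda>r :: real. 1 / r\<^sup>2) has_real_derivative - 2 / r ^ 3) (at r)"
      using that by (rule DERIV_inverse_square)
    from has_vector_derivative_of_real[OF this, where ?'a = complex] show ?thesis
      by (simp add: m_def has_vector_derivative_def)
  qed
  have pm: "partial_deriv i m r = i *\<^sub>R of_real (- 2 / r ^ 3)" if "r \<noteq> 0" for i r
    by (rule partial_deriv_eq[OF dm[OF that]])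
  have r0: "r \<noteq> 0" if "r \<in> {a<..<b}" for r using that ab by auto
  have m1: "of_real r * of_real r * m r = 1" and m2: "2 * m r + of_real (- 2 / r ^ 3) * of_real r = 0"
    if "r \<in> {a<..<b}" for r
  proof -
    have e: "r * r * (1 / r\<^sup>2) = 1" "2 * (1 / r\<^sup>2) + - 2 / r ^ 3 * r = 0"
      using r0[OF that] by (simp_all add: power2_eq_square power3_eq_cube)
    show "of_real r * of_real r * m r = 1"
      using arg_cong[OF e(1), of complex_of_real] unfolding m_def of_real_mult of_real_1 .
    show "2 * m r + of_real (- 2 / r ^ 3) * of_real r = 0"
      using arg_cong[OF e(2), of complex_of_real] unfolding m_def of_real_mult of_real_add of_real_0 of_real_numeral .
  qed
  have cm: "continuous_on {a<..<b} (partial_deriv i m)" for i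
  proof -
    have "continuous_on {a<..<b} (\<lambda>r. i *\<^sub>R complex_of_real (- 2 / r ^ 3))"
      using r0 by (intro continuous_intros) auto
    then show ?thesis by (rule continuous_on_eq) (rule pm[symmetric, OF r0])
  qed
  have diffm: "m differentiable (at r)" if "r \<in> {a<..<b}" for r by (rule differentiableI[OF dm[OF r0[OF that]]])
  note tm = test_function_mult(1,2)[OF open_greaterThanLessThan \<phi> diffm cm, folded \<kappa>_def]
  have "(LINT r:{a<..<b}|lborel. fourier_coeff u q r * partial_deriv 1 \<phi> r) =
      (LINT r:{a<..<b}|lborel. of_real r * fourier_coeff u q r * (2 * \<kappa> r + of_real r * partial_deriv 1 \<kappa> r))"
  proof (rule set_lebesgue_integral_cong, simp, intro allI impI)
    fix r assume r: "r \<in> {a<..<b}"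
    have h: "of_real r * (2 * \<kappa> r + of_real r * partial_deriv 1 \<kappa> r) = partial_deriv 1 \<phi> r"
    proof -
      have "partial_deriv 1 \<kappa> r = m r * partial_deriv 1 \<phi> r + partial_deriv 1 m r * \<phi> r"
        by (rule tm(2)[OF _ r])
      then have p: "partial_deriv 1 \<kappa> r = m r * partial_deriv 1 \<phi> r + of_real (- 2 / r ^ 3) * \<phi> r"
        using pm[OF r0[OF r], of 1] by (simp only: scaleR_one)
      have k: "\<kappa> r = m r * \<phi> r" by (simp only: \<kappa>_def)
      have "of_real r * (2 * \<kappa> r + of_real r * partial_deriv 1 \<kappa> r) =
          (of_real r * of_real r * m r) * partial_deriv 1 \<phi> r
          + of_real r * \<phi> r * (2 * m r + of_real (- 2 / r ^ 3) * of_real r)"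
        unfolding p k by (simp only: distrib_left distrib_right mult_ac add_ac)
      then show ?thesis by (simp only: m1[OF r] m2[OF r] mult_1_left mult_zero_right add_0_right)
    qed
    show "fourier_coeff u q r * partial_deriv 1 \<phi> r =
        of_real r * fourier_coeff u q r * (2 * \<kappa> r + of_real r * partial_deriv 1 \<kappa> r)"
      unfolding h[symmetric] by (simp only: mult_ac)
  qed
  also have "\<dots> = - (LINT r:{a<..<b}|lborel. of_real r * fourier_coeff (rad_deriv g1 g2) q r * (of_real r * \<kappa> r))"
    by (rule polar_identities(1)) (rule tm(1))
  also have "(LINT r:{a<..<b}|lborel. of_real r * fourier_coeff (rad_deriv g1 g2) q r * (of_real r * \<kappa> r)) =
      (LINT r:{a<..<b}|lborel. fourier_coeff (rad_deriv g1 g2) q r * \<phi> r)"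
  proof (rule set_lebesgue_integral_cong, simp, intro allI impI)
    fix r assume r: "r \<in> {a<..<b}"
    have "of_real r * fourier_coeff (rad_deriv g1 g2) q r * (of_real r * \<kappa> r) =
        (of_real r * of_real r * m r) * (fourier_coeff (rad_deriv g1 g2) q r * \<phi> r)"
      unfolding \<kappa>_def by (simp only: mult_ac)
    then show "of_real r * fourier_coeff (rad_deriv g1 g2) q r * (of_real r * \<kappa> r) =
        fourier_coeff (rad_deriv g1 g2) q r * \<phi> r"
      by (simp only: m1[OF r] mult_1_left)
  qed
  finally show "(LINT r:{a<..<b}|lborel. fourier_coeff u q r * partial_deriv 1 \<phi> r) =
      - (LINT r:{a<..<b}|lborel. fourier_coeff (rad_deriv g1 g2) q r * \<phi> r)" .
qed

text \<open>The second polar identity holds for all radial test functions, so the fundamental lemma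
  makes it pointwise. It turns q^2/r^2 |u_q|^2 into the squared coefficient of the angular
  derivative.\<close>

lemma fourier_coeff_ang_deriv:
  "AE r in lborel. r \<in> {a<..<b} \<longrightarrow>
    of_real r * fourier_coeff (ang_deriv g1 g2) q r = \<i> * of_int q * fourier_coeff u q r"
proof -
  let ?U = "fourier_coeff u q" and ?A = "fourier_coeff (ang_deriv g1 g2) q"
  have iU: "set_integrable lborel {a<..<b} (\<lambda>r. of_real r * ?U r)"
    by (rule fourier_coeff_integral(1)[OF ab L2_imp_integrable[OF u]])
  have iA: "set_integrable lborel {a<..<b} (\<lambda>r. of_real r * ?A r)"
    by (rule fourier_coeff_integral(1)[OF ab L2_imp_integrable[OF L2_polar_derivs(2)]])
  have i1: "set_integrable lborel {a<..<b} (\<lambda>r. of_real r * ?A r * of_real r)"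
    by (rule set_integrable_mult_continuous[OF iA]) (intro continuous_intros)
  have i2: "set_integrable lborel {a<..<b} (\<lambda>r. of_real r * ?U r * (\<i> * of_int q))"
    by (rule set_integrable_mult_continuous[OF iU]) (intro continuous_intros)
  have "AE r in lborel. r \<in> {a<..<b} \<longrightarrow> of_real r * ?A r * of_real r - of_real r * ?U r * (\<i> * of_int q) = 0"
  proof (rule fundamental_lemma)
    show "set_integrable lborel {a<..<b} (\<lambda>r. of_real r * ?A r * of_real r - of_real r * ?U r * (\<i> * of_int q))"
      by (rule set_integral_diff(1)[OF i1 i2])
    fix \<kappa> assume \<kappa>: "test_function {a<..<b} \<kappa>"
    have "(LINT r:{a<..<b}|lborel. (of_real r * ?A r * of_real r - of_real r * ?U r * (\<i> * of_int q)) * \<kappa> r) =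
      (LINT r:{a<..<b}|lborel. of_real r * ?A r * of_real r * \<kappa> r) - (LINT r:{a<..<b}|lborel. of_real r * ?U r * (\<i> * of_int q) * \<kappa> r)"
      unfolding left_diff_distrib
      by (intro set_integral_diff(2) set_integrable_mult_test_function(1)[OF i1 \<kappa>] set_integrable_mult_test_function(1)[OF i2 \<kappa>])
    moreover have e2: "(LINT r:{a<..<b}|lborel. of_real r * ?U r * (- \<i> * of_int q * \<kappa> r)) =
        - (LINT r:{a<..<b}|lborel. of_real r * ?U r * (\<i> * of_int q) * \<kappa> r)"
    proof -
      have "indicator {a<..<b} r *\<^sub>R (of_real r * ?U r * (- \<i> * of_int q * \<kappa> r)) =
          - (indicator {a<..<b} r *\<^sub>R (of_real r * ?U r * (\<i> * of_int q) * \<kappa> r))" for r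
        by (simp only: mult_minus_left mult_minus_right scaleR_minus_right mult.assoc)
      then show ?thesis unfolding set_lebesgue_integral_def by (simp only: Bochner_Integration.integral_minus)
    qed
    moreover have e3: "(LINT r:{a<..<b}|lborel. of_real r * ?A r * (of_real r * \<kappa> r)) =
        (LINT r:{a<..<b}|lborel. of_real r * ?A r * of_real r * \<kappa> r)" by (simp only: mult.assoc)
    ultimately show "(LINT r:{a<..<b}|lborel. (of_real r * ?A r * of_real r - of_real r * ?U r * (\<i> * of_int q)) * \<kappa> r) = 0"
      using polar_identities(2)[OF \<kappa>, of q] unfolding e2 e3 neg_equal_iff_equal by (simp only: diff_self)
  qed simp
  then show ?thesis
  proof eventually_elim
    case (elim r)
    show ?case
    proof
      assume r: "r \<in> {a<..<b}"
      then have r0: "complex_of_real r \<noteq> 0" using ab by simp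
      have "of_real r * ?A r * of_real r = of_real r * ?U r * (\<i> * of_int q)"
        by (rule iffD1[OF right_minus_eq]) (rule elim[rule_format, OF r])
      then have "of_real r * (of_real r * ?A r) = of_real r * (\<i> * of_int q * ?U r)"
        by (simp only: mult_ac)
      then show "of_real r * ?A r = \<i> * of_int q * ?U r" by (rule mult_left_cancel[OF r0, THEN iffD1])
    qed
  qed
qed

text \<open>On almost every circle Bessel's inequality is applied to the radial derivative, the
  angular derivative and \<open>u\<close>. Integrating the sum in r reassembles the norm on the
  annulus, since the polar components preserve the length of the gradient.\<close>

lemma sum_energy_form_le:
  assumes Q: "finite Q"
  shows "(\<Sum>q\<in>Q. energy_form a b q (fourier_coeff u q)) \<le>
    (LINT x:\<Omega>|lborel. (cmod (g1 x))\<^sup>2 + (cmod (g2 x))\<^sup>2 + (cmod (u x))\<^sup>2)"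
proof -
  let ?R = "rad_deriv g1 g2" and ?A = "ang_deriv g1 g2"
  let ?d = "\<lambda>q. radial_energy_density q (fourier_coeff ?R q) (fourier_coeff u q)"
  let ?S = "\<lambda>x. (cmod (?R x))\<^sup>2 + (cmod (?A x))\<^sup>2 + (cmod (u x))\<^sup>2"
  have E: "energy_form a b q (fourier_coeff u q) = 2 * pi * (LINT r:{a<..<b}|lborel. ?d q r)" for q
    by (rule energy_form_eq[OF ab L2_fourier_coeff[OF ab u] fourier_coeff_weak_deriv])
  have di: "set_integrable lborel {a<..<b} (?d q)" for q
    by (rule set_integrable_radial_energy_density[OF ab(1) L2_fourier_coeff[OF ab L2_polar_derivs(1)] L2_fourier_coeff[OF ab u]])
  have i3: "set_integrable lborel \<Omega> (\<lambda>x. (cmod (?R x))\<^sup>2)" "set_integrable lborel \<Omega> (\<lambda>x. (cmod (?A x))\<^sup>2)"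
    "set_integrable lborel \<Omega> (\<lambda>x. (cmod (u x))\<^sup>2)"
    using L2_polar_derivs u by (auto simp: L2_def)
  have Si: "set_integrable lborel \<Omega> ?S" by (intro set_integral_add(1) i3)
  note PS = polar_Fubini[OF ab Si]
  have 1: "(\<Sum>q\<in>Q. energy_form a b q (fourier_coeff u q)) = 2 * pi * (\<Sum>q\<in>Q. LINT r:{a<..<b}|lborel. ?d q r)"
    by (simp add: E sum_distrib_left)
  have "(\<Sum>q\<in>Q. LINT r:{a<..<b}|lborel. ?d q r) = (LINT r|lborel. (\<Sum>q\<in>Q. indicator {a<..<b} r *\<^sub>R ?d q r))"
    unfolding set_lebesgue_integral_def
    by (rule Bochner_Integration.integral_sum[symmetric]) (use di in \<open>simp add: set_integrable_def\<close>)
  also have "\<dots> \<le> (LINT r|lborel. indicator {a<..<b} r *\<^sub>R ((1 / (2 * pi)) * (r *\<^sub>R circle_integral ?S r)))"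
  proof (rule integral_mono_AE)
    show "integrable lborel (\<lambda>r. \<Sum>q\<in>Q. indicator {a<..<b} r *\<^sub>R ?d q r)"
      by (rule Bochner_Integration.integrable_sum) (use di in \<open>simp add: set_integrable_def\<close>)
    show "integrable lborel (\<lambda>r. indicator {a<..<b} r *\<^sub>R ((1 / (2 * pi)) * (r *\<^sub>R circle_integral ?S r)))"
      unfolding set_integrable_def[symmetric] by (intro set_integrable_mult_right PS(2))
    \<comment> \<open>Countably many exceptional null sets, one for each frequency, are merged into
      one.\<close>
    have "AE r in lborel. \<forall>q. r \<in> {a<..<b} \<longrightarrow> of_real r * fourier_coeff ?A q r = \<i> * of_int q * fourier_coeff u q r"
      unfolding AE_all_countable using fourier_coeff_ang_deriv by blast
    then show "AE r in lborel. (\<Sum>q\<in>Q. indicator {a<..<b} r *\<^sub>R ?d q r) \<le>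
        indicator {a<..<b} r *\<^sub>R ((1 / (2 * pi)) * (r *\<^sub>R circle_integral ?S r))"
      using fourier_coeff_sum_le[OF ab L2_polar_derivs(1) Q] fourier_coeff_sum_le[OF ab L2_polar_derivs(2) Q]
        fourier_coeff_sum_le[OF ab u Q] polar_Fubini(1)[OF ab i3(1)] polar_Fubini(1)[OF ab i3(2)] polar_Fubini(1)[OF ab i3(3)]
    proof eventually_elim
      case (elim r)
      show ?case
      proof (cases "r \<in> {a<..<b}")
        case True
        then have r: "r > 0" using ab by simp
        \<comment> \<open>The relation between the coefficients of the angular derivative and of
          \<open>u\<close> removes the explicit factor q^2/r^2.\<close>
        have d: "?d q r = ((cmod (fourier_coeff ?R q r))\<^sup>2 + (cmod (fourier_coeff ?A q r))\<^sup>2 + (cmod (fourier_coeff u q r))\<^sup>2) * r" for q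
        proof -
          have "cmod (of_real r * fourier_coeff ?A q r) = cmod (\<i> * of_int q * fourier_coeff u q r)"
            using elim(1) True by simp
          then have "r * cmod (fourier_coeff ?A q r) = \<bar>of_int q\<bar> * cmod (fourier_coeff u q r)"
            using r by (simp add: norm_mult)
          then have "(r * cmod (fourier_coeff ?A q r))\<^sup>2 = (\<bar>of_int q\<bar> * cmod (fourier_coeff u q r))\<^sup>2" by simp
          then have "(of_int q)\<^sup>2 / r\<^sup>2 * (cmod (fourier_coeff u q r))\<^sup>2 = (cmod (fourier_coeff ?A q r))\<^sup>2"
            using r by (simp add: power_mult_distrib divide_simps mult.commute)
          then show ?thesis by (simp add: radial_energy_density_def)
        qed
        have ci: "circle_integral ?S r = circle_integral (\<lambda>x. (cmod (?R x))\<^sup>2) r + circle_integral (\<lambda>x. (cmod (?A x))\<^sup>2) r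
            + circle_integral (\<lambda>x. (cmod (u x))\<^sup>2) r"
          unfolding circle_integral_def using elim(5-7) True by (simp add: set_integral_add)
        have "(\<Sum>q\<in>Q. ?d q r) = ((\<Sum>q\<in>Q. (cmod (fourier_coeff ?R q r))\<^sup>2) + (\<Sum>q\<in>Q. (cmod (fourier_coeff ?A q r))\<^sup>2)
            + (\<Sum>q\<in>Q. (cmod (fourier_coeff u q r))\<^sup>2)) * r"
          unfolding d sum_distrib_right[symmetric] sum.distrib ..
        also have "\<dots> \<le> (1 / (2 * pi) * circle_integral ?S r) * r"
        proof (rule mult_right_mono)
          show "(\<Sum>q\<in>Q. (cmod (fourier_coeff ?R q r))\<^sup>2) + (\<Sum>q\<in>Q. (cmod (fourier_coeff ?A q r))\<^sup>2)
            + (\<Sum>q\<in>Q. (cmod (fourier_coeff u q r))\<^sup>2) \<le> 1 / (2 * pi) * circle_integral ?S r"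
            unfolding ci distrib_left
            by (intro add_mono elim(2)[rule_format, OF True] elim(3)[rule_format, OF True] elim(4)[rule_format, OF True])
        qed (use r in simp)
        finally have le: "(\<Sum>q\<in>Q. ?d q r) \<le> 1 / (2 * pi) * (r * circle_integral ?S r)"
          by (simp only: mult_ac)
        have "indicator {a<..<b} r = (1 :: real)" using True by simp
        then show ?thesis using le by (simp only: scaleR_one real_scaleR_def mult_1_left)
      qed simp
    qed
  qed
  also have "\<dots> = 1 / (2 * pi) * (LINT r:{a<..<b}|lborel. r *\<^sub>R circle_integral ?S r)"
    by (subst set_integral_mult_right[symmetric]) (simp only: set_lebesgue_integral_def)
  finally have 2: "(\<Sum>q\<in>Q. LINT r:{a<..<b}|lborel. ?d q r) \<le> 1 / (2 * pi) * (LINT x:\<Omega>|lborel. ?S x)"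
    unfolding PS(3) .
  have "2 * pi * (\<Sum>q\<in>Q. LINT r:{a<..<b}|lborel. ?d q r) \<le> 2 * pi * (1 / (2 * pi) * (LINT x:\<Omega>|lborel. ?S x))"
    by (rule mult_left_mono[OF 2]) simp
  also have "\<dots> = (LINT x:\<Omega>|lborel. ?S x)" by simp
  also have "\<dots> = (LINT x:\<Omega>|lborel. (cmod (g1 x))\<^sup>2 + (cmod (g2 x))\<^sup>2 + (cmod (u x))\<^sup>2)"
    by (rule set_lebesgue_integral_cong) (use rad_ang_deriv_norm annulus_nonzero[OF ab(1)] in auto)
  finally show ?thesis unfolding 1 .
qed

end

section \<open>The trace inequality and its extremals\<close>

text \<open>A series in [0, \<infinity>] is the supremum of its finite partial sums, so the finite
  Bessel estimates control the trace norm. Each term is the boundary form of a Fourier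
  coefficient.\<close>

lemma Hhalf_norm_sq_eq_SUP:
  "Hhalf_norm_sq a b u = (SUP F\<in>{F. finite F}. \<Sum>q\<in>F. ennreal (bdry_form a b q (fourier_coeff u q)))"
proof -
  define t where "t = (\<lambda>q::int. sqrt (a\<^sup>2 + (of_int q)\<^sup>2) * (cmod (trace_coeff a b u q a))\<^sup>2
       + sqrt (b\<^sup>2 + (of_int q)\<^sup>2) * (cmod (trace_coeff a b u q b))\<^sup>2)"
  have t: "ennreal (2 * pi) * ennreal (t q) = ennreal (bdry_form a b q (fourier_coeff u q))" for q
  proof -
    have "bdry_form a b q (fourier_coeff u q) = 2 * pi * t q" by (simp add: t_def bdry_form_def trace_coeff_def)
    then show ?thesis using ennreal_mult'[of "2 * pi" "t q"] by simp
  qed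
  have "Hhalf_norm_sq a b u = ennreal (2 * pi) * (\<Sum>\<^sub>\<infinity>q\<in>UNIV. ennreal (t q))"
    by (simp only: Hhalf_norm_sq_def t_def)
  also have "(\<Sum>\<^sub>\<infinity>q\<in>UNIV. ennreal (t q)) = (SUP F\<in>{F. finite F}. \<Sum>q\<in>F. ennreal (t q))"
    by (subst nonneg_infsum_complete) auto
  finally show ?thesis by (simp add: SUP_mult_left_ennreal sum_distrib_left t)
qed

lemma H1_norm_nonneg: "0 \<le> H1_norm \<Omega> u"
  unfolding H1_norm_def set_lebesgue_integral_def
  by (intro real_sqrt_ge_zero Bochner_Integration.integral_nonneg) (auto intro!: mult_nonneg_nonneg add_nonneg_nonneg sum_nonneg)

lemma H1_norm_sq:
  "(H1_norm \<Omega> u)\<^sup>2 = (LINT x:\<Omega>|lborel. (cmod (weak_deriv \<Omega> (axis 1 1) u x))\<^sup>2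
     + (cmod (weak_deriv \<Omega> (axis 2 1) u x))\<^sup>2 + (cmod (u x))\<^sup>2)" for \<Omega> :: "(real^2) set"
proof -
  have "0 \<le> (LINT x:\<Omega>|lborel. (\<Sum>i\<in>Basis. (cmod (weak_deriv \<Omega> i u x))\<^sup>2) + (cmod (u x))\<^sup>2)"
    unfolding set_lebesgue_integral_def
    by (intro Bochner_Integration.integral_nonneg) (auto intro!: mult_nonneg_nonneg add_nonneg_nonneg sum_nonneg)
  then show ?thesis by (simp add: H1_norm_def sum_Basis_real_2)
qed

lemma H1_weak_deriv:
  assumes "H1 \<Omega> u" "i \<in> Basis"
  shows "is_L2_weak_deriv \<Omega> i u (weak_deriv \<Omega> i u)"
  using assms unfolding H1_def weak_deriv_def by (metis someI_ex)

text \<open>Termwise, the boundary form of each coefficient is at most \<open>Lambda\<close> times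
  its energy. Replacing the factor by the supremum allows the energies of any finite set of modes to
  be summed.\<close>

lemma trace_inequality:
  assumes ab: "0 < a" "a < b" and u: "H1 (annulus a b) u"
  shows "Hhalf_norm_sq a b u \<le> (SUP q. Lambda a b q) * ennreal ((H1_norm (annulus a b) u)\<^sup>2)"
proof -
  let ?W = "\<lambda>i. weak_deriv (annulus a b) (axis i 1) u"
  interpret annulus_H1 a b u "?W 1" "?W 2"
    using ab u H1_weak_deriv[OF u] by unfold_locales (auto simp: H1_def Basis_real_2)
  have "(\<Sum>q\<in>F. ennreal (bdry_form a b q (fourier_coeff u q))) \<le>
      (SUP q. Lambda a b q) * ennreal ((H1_norm (annulus a b) u)\<^sup>2)" if F: "finite F" for F
  proof -
    have E0: "0 \<le> energy_form a b q v" for q v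
      unfolding energy_form_def set_lebesgue_integral_def
      by (intro mult_nonneg_nonneg Bochner_Integration.integral_nonneg)
         (use ab in \<open>auto simp: indicator_def intro!: add_nonneg_nonneg\<close>)
    have "ennreal (bdry_form a b q (fourier_coeff u q)) \<le> (SUP q. Lambda a b q) * ennreal (energy_form a b q (fourier_coeff u q))" for q
    proof -
      have H: "H1 {a<..<b} (fourier_coeff u q)"
        using L2_fourier_coeff[OF ab annulus_H1.u[OF annulus_H1_axioms]] fourier_coeff_weak_deriv[of q]
        by (auto simp: H1_def)
      obtain L w W where L: "0 \<le> L" "Lambda a b q = ennreal L"
        "\<And>v. H1 {a<..<b} v \<Longrightarrow> bdry_form a b q v \<le> L * energy_form a b q v"
        using Lambda_characterization[OF ab, of q] by metis
      have "ennreal (bdry_form a b q (fourier_coeff u q)) \<le> ennreal (L * energy_form a b q (fourier_coeff u q))"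
        by (rule ennreal_leI[OF L(3)[OF H]])
      also have "\<dots> = Lambda a b q * ennreal (energy_form a b q (fourier_coeff u q))"
        by (simp add: L(2) ennreal_mult'[OF L(1)])
      also have "\<dots> \<le> (SUP q. Lambda a b q) * ennreal (energy_form a b q (fourier_coeff u q))"
        by (intro mult_right_mono SUP_upper) auto
      finally show ?thesis .
    qed
    then have "(\<Sum>q\<in>F. ennreal (bdry_form a b q (fourier_coeff u q))) \<le>
        (\<Sum>q\<in>F. (SUP q. Lambda a b q) * ennreal (energy_form a b q (fourier_coeff u q)))"
      by (intro sum_mono)
    also have "\<dots> = (SUP q. Lambda a b q) * ennreal (\<Sum>q\<in>F. energy_form a b q (fourier_coeff u q))"
      by (simp only: sum_distrib_left[symmetric] sum_ennreal[OF E0])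
    also have "\<dots> \<le> (SUP q. Lambda a b q) * ennreal ((H1_norm (annulus a b) u)\<^sup>2)"
      using sum_energy_form_le[OF F] by (intro mult_left_mono ennreal_leI) (auto simp: H1_norm_sq)
    finally show ?thesis .
  qed
  then show ?thesis unfolding Hhalf_norm_sq_eq_SUP by (intro SUP_least) auto
qed

section \<open>Separated functions as extremals, and comparison of the two suprema\<close>

lemma L2_annulus_continuous:
  assumes "0 < a" "continuous_on (- {0}) f"
  shows "L2 (annulus a b) f"
proof -
  let ?C = "{x :: real^2. a \<le> norm x \<and> norm x \<le> b}"
  have "closed ?C" by (intro closed_Collect_conj closed_Collect_le continuous_intros)
  moreover have "bounded ?C" by (rule bounded_subset[OF bounded_cball[of 0 b]]) auto
  ultimately have C: "compact ?C" by (simp add: compact_eq_bounded_closed)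
  have c: "continuous_on ?C f" by (rule continuous_on_subset[OF assms(2)]) (use assms(1) in auto)
  have i: "set_integrable lborel (annulus a b) g" if "continuous_on ?C g" for g :: "real^2 \<Rightarrow> 'c::{banach, second_countable_topology}"
    by (rule set_integrable_subset[of _ ?C])
       (use borel_integrable_compact[OF C that] in \<open>auto simp: set_integrable_def annulus_def\<close>)
  have "set_integrable lborel (annulus a b) (\<lambda>x. (cmod (f x))\<^sup>2)" by (intro i continuous_intros c)
  moreover have "set_borel_measurable lborel (annulus a b) f"
    using i[OF c] unfolding set_integrable_def set_borel_measurable_def by (rule borel_measurable_integrable)
  ultimately show ?thesis by (simp add: L2_def)
qed

lemma is_L2_weak_deriv_ae_zero:
  assumes "ae_zero \<Omega> u" "set_borel_measurable lborel \<Omega> u" "i \<in> Basis"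
  shows "is_L2_weak_deriv \<Omega> i u (\<lambda>_. 0)"
  unfolding is_L2_weak_deriv_def
proof (intro conjI allI impI)
  show "L2 \<Omega> (\<lambda>_. 0)" by (simp add: L2_def set_borel_measurable_def set_integrable_def)
  fix \<phi> assume "test_function \<Omega> \<phi>"
  have "AE x in lborel. indicator \<Omega> x *\<^sub>R (u x * partial_deriv i \<phi> x) = 0"
    using assms(1) unfolding ae_zero_def by eventually_elim (auto simp: indicator_def)
  then have "(LINT x:\<Omega>|lborel. u x * partial_deriv i \<phi> x) = 0"
    unfolding set_lebesgue_integral_def by (rule integral_eq_zero_AE)
  then show "(LINT x:\<Omega>|lborel. u x * partial_deriv i \<phi> x) = - (LINT x:\<Omega>|lborel. 0 * \<phi> x)"
    by (simp add: set_lebesgue_integral_def)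
qed

text \<open>The phase is factored out and has modulus one; the real and imaginary parts of the
  remaining factor are the radial and angular contributions, so squared moduli can be read
  off.\<close>

lemma separated_has_derivative:
  assumes w: "bessel_system n w W" and x: "x \<noteq> 0"
  shows "((\<lambda>x. complex_of_real (w (norm x)) * ang q x) has_derivative
    (\<lambda>h. ang q x * Complex (W (norm x) * ((x $ 1 * h $ 1 + x $ 2 * h $ 2) / (norm x)\<^sup>2))
      (of_int q * w (norm x) * ((x $ 1 * h $ 2 - x $ 2 * h $ 1) / (norm x)\<^sup>2)))) (at x)"
proof -
  have n: "norm x > 0" using x by simp
  have "((\<lambda>x. w (norm x)) has_derivative (\<lambda>h. (x $ 1 * h $ 1 + x $ 2 * h $ 2) / norm x * (W (norm x) / norm x))) (at x)"
    by (rule DERIV_compose_FDERIV[OF bessel_systemD(1)[OF w n] has_derivative_norm_2[OF x]])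
  from has_derivative_mult[OF has_derivative_of_real[OF this, where 'a = complex] ang_has_derivative[OF x, of q]]
  show ?thesis
  proof (rule has_derivative_eq_rhs, intro ext)
    fix h :: "real^2"
    have "Complex (W (norm x) * ((x $ 1 * h $ 1 + x $ 2 * h $ 2) / (norm x)\<^sup>2))
      (of_int q * w (norm x) * ((x $ 1 * h $ 2 - x $ 2 * h $ 1) / (norm x)\<^sup>2)) =
      of_real (W (norm x) * ((x $ 1 * h $ 1 + x $ 2 * h $ 2) / (norm x)\<^sup>2)) +
      \<i> * (of_int q * (of_real (w (norm x)) * of_real ((x $ 1 * h $ 2 - x $ 2 * h $ 1) / (norm x)\<^sup>2)))"
      by (simp add: complex_eq_iff)
    moreover have "(x $ 1 * h $ 1 + x $ 2 * h $ 2) / norm x * (W (norm x) / norm x) = W (norm x) * ((x $ 1 * h $ 1 + x $ 2 * h $ 2) / (norm x)\<^sup>2)"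
      by (simp add: power2_eq_square)
    ultimately show "of_real (w (norm x)) * (\<i> * of_int q * of_real ((x $ 1 * h $ 2 - x $ 2 * h $ 1) / (norm x)\<^sup>2) * ang q x) +
        of_real ((x $ 1 * h $ 1 + x $ 2 * h $ 2) / norm x * (W (norm x) / norm x)) * ang q x =
        ang q x * Complex (W (norm x) * ((x $ 1 * h $ 1 + x $ 2 * h $ 2) / (norm x)\<^sup>2))
      (of_int q * w (norm x) * ((x $ 1 * h $ 2 - x $ 2 * h $ 1) / (norm x)\<^sup>2))"
      by (simp only: distrib_left distrib_right mult_ac add_ac)
  qed
qed

text \<open>The radial profile maximizing the one-dimensional quotient is multiplied by the mode q.
  Its norm on the annulus is the one-dimensional energy, and the q-th term of the trace norm alone
  gives the lower bound.\<close>

lemma trace_extremal: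
  assumes ab: "0 < a" "a < b"
  obtains u where "H1 (annulus a b) u" "\<not> ae_zero (annulus a b) u" "0 < H1_norm (annulus a b) u"
    "Lambda a b q * ennreal ((H1_norm (annulus a b) u)\<^sup>2) \<le> Hhalf_norm_sq a b u"
proof -
  let ?\<Omega> = "annulus a b"
  obtain L w W where L: "0 \<le> L" "Lambda a b q = ennreal L"
    and w: "bessel_system (nat \<bar>q\<bar>) w W" and flux: "0 < w b * W b - w a * W a"
    and B: "sqrt (a\<^sup>2 + (of_int q)\<^sup>2) * (w a)\<^sup>2 + sqrt (b\<^sup>2 + (of_int q)\<^sup>2) * (w b)\<^sup>2 = L * (w b * W b - w a * W a)"
    and E: "(LINT r:{a<..<b}|lborel. radial_energy_density q (\<lambda>r. of_real (W r / r)) (\<lambda>r. of_real (w r)) r)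
       = w b * W b - w a * W a"
    by (rule Lambda_characterization[OF ab, of q])
  define u where "u = (\<lambda>x :: real^2. complex_of_real (w (norm x)) * ang q x)"
  let ?D = "\<lambda>x h. ang q x * Complex (W (norm x) * ((x $ 1 * h $ 1 + x $ 2 * h $ 2) / (norm x)\<^sup>2))
      (of_int q * w (norm x) * ((x $ 1 * h $ 2 - x $ 2 * h $ 1) / (norm x)\<^sup>2))"
  have du: "(u has_derivative ?D x) (at x)" if "x \<noteq> 0" for x
    unfolding u_def by (rule separated_has_derivative[OF w that])
  note pd = partial_deriv_eq[OF du]
  have cw: "continuous_on {0<..} w" "continuous_on {0<..} W"
    using DERIV_isCont[OF bessel_systemD(1)[OF w]] DERIV_isCont[OF bessel_systemD(2)[OF w]]
    by (auto intro!: continuous_at_imp_continuous_on)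
  have cn: "continuous_on (- {0 :: real^2}) (\<lambda>x. w (norm x))" "continuous_on (- {0 :: real^2}) (\<lambda>x. W (norm x))"
    by (rule continuous_on_compose2[OF cw(1)], auto intro: continuous_intros)
       (rule continuous_on_compose2[OF cw(2)], auto intro: continuous_intros)
  have ca: "continuous_on (- {0}) (ang q)" by (rule continuous_on_ang) simp
  have cD: "continuous_on (- {0}) (partial_deriv i u)" for i
  proof -
    have "continuous_on (- {0}) (\<lambda>x. ?D x i)"
      unfolding Complex_eq by (intro continuous_intros cn ca) auto
    then show ?thesis by (rule continuous_on_eq) (simp add: pd)
  qed
  have cu: "continuous_on (- {0}) u" unfolding u_def by (intro continuous_intros cn ca)
  have L2u: "L2 ?\<Omega> u" and L2D: "L2 ?\<Omega> (partial_deriv i u)" for i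
    by (rule L2_annulus_continuous[OF ab(1)], rule cu cD)+
  have n0: "x \<noteq> 0" if "x \<in> ?\<Omega>" for x by (rule annulus_nonzero[OF ab(1) that])
  have wd: "is_L2_weak_deriv ?\<Omega> i u (partial_deriv i u)" if "i \<in> Basis" for i
    using that emeasure_annulus_finite n0
    by (intro weak_deriv_classical L2u L2D differentiableI[OF du] continuous_on_subset[OF cD]) auto
  have H: "H1 ?\<Omega> u" using wd L2u by (auto simp: H1_def)
  \<comment> \<open>The density |grad u|^2 + |u|^2 depends on the radius only; multiplied by the
    Jacobian r it is the radial energy density.\<close>
  define e where "e = (\<lambda>r. (W r / r)\<^sup>2 + (of_int q)\<^sup>2 / r\<^sup>2 * (w r)\<^sup>2 + (w r)\<^sup>2)"
  have ax: "(axis 1 1 :: real^2) \<in> Basis" "(axis 2 1 :: real^2) \<in> Basis" by (auto simp: Basis_real_2)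
  have ee: "(cmod (partial_deriv (axis 1 1) u x))\<^sup>2 + (cmod (partial_deriv (axis 2 1) u x))\<^sup>2 + (cmod (u x))\<^sup>2 = e (norm x)"
    if "x \<in> ?\<Omega>" for x
  proof -
    let ?r = "norm x"
    have x: "x \<noteq> 0" by (rule n0[OF that])
    have r2: "x $ 1 * x $ 1 + x $ 2 * x $ 2 = ?r * ?r" using norm_real_2[of x] by (simp add: power2_eq_square)
    have "(cmod (partial_deriv (axis 1 1) u x))\<^sup>2 + (cmod (partial_deriv (axis 2 1) u x))\<^sup>2 =
        ((W ?r)\<^sup>2 + (of_int q * w ?r)\<^sup>2) * ((x $ 1 * x $ 1 + x $ 2 * x $ 2) / (?r\<^sup>2 * ?r\<^sup>2))"
      unfolding pd[OF x] norm_mult norm_ang[OF x] mult_1_left cmod_power2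
      by (simp add: axis_def power2_eq_square algebra_simps add_divide_distrib)
    also have "\<dots> = (W ?r / ?r)\<^sup>2 + (of_int q)\<^sup>2 / ?r\<^sup>2 * (w ?r)\<^sup>2"
      unfolding r2 using x by (simp add: field_simps power2_eq_square)
    finally show ?thesis by (simp add: e_def u_def norm_mult norm_ang[OF x])
  qed
  have N: "(H1_norm ?\<Omega> u)\<^sup>2 = 2 * pi * (w b * W b - w a * W a)"
  proof -
    have m: "set_integrable lborel ?\<Omega> (\<lambda>x. (cmod (f x))\<^sup>2 + (cmod (g x))\<^sup>2 + (cmod (u x))\<^sup>2)"
      if "L2 ?\<Omega> f" "L2 ?\<Omega> g" for f g
      using that L2u by (intro set_integral_add(1)) (auto simp: L2_def)
    have L2w: "L2 ?\<Omega> (weak_deriv ?\<Omega> i u)" if "i \<in> Basis" for i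
      using H1_weak_deriv[OF H that] by (simp add: is_L2_weak_deriv_def)
    have ae: "AE x in lborel. x \<in> ?\<Omega> \<longrightarrow> weak_deriv ?\<Omega> i u x = partial_deriv i u x" if "i \<in> Basis" for i
      using emeasure_annulus_finite by (intro weak_deriv_AE_eq wd[OF that]) auto
    have i1: "set_integrable lborel ?\<Omega> (\<lambda>x. (cmod (partial_deriv (axis 1 1) u x))\<^sup>2 + (cmod (partial_deriv (axis 2 1) u x))\<^sup>2 + (cmod (u x))\<^sup>2)"
      by (rule m[OF L2D L2D])
    have "(H1_norm ?\<Omega> u)\<^sup>2 = (LINT x:?\<Omega>|lborel. (cmod (partial_deriv (axis 1 1) u x))\<^sup>2
        + (cmod (partial_deriv (axis 2 1) u x))\<^sup>2 + (cmod (u x))\<^sup>2)"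
      unfolding H1_norm_sq
    proof (rule set_integral_cong_AE_borel)
      show "AE x in lborel. x \<in> ?\<Omega> \<longrightarrow> (cmod (weak_deriv ?\<Omega> (axis 1 1) u x))\<^sup>2 + (cmod (weak_deriv ?\<Omega> (axis 2 1) u x))\<^sup>2 + (cmod (u x))\<^sup>2
          = (cmod (partial_deriv (axis 1 1) u x))\<^sup>2 + (cmod (partial_deriv (axis 2 1) u x))\<^sup>2 + (cmod (u x))\<^sup>2"
        using ae[OF ax(1)] ae[OF ax(2)] by eventually_elim auto
    qed (use m[OF L2w[OF ax(1)] L2w[OF ax(2)]] i1 in \<open>auto simp: set_integrable_def set_borel_measurable_def\<close>)
    also have "\<dots> = (LINT x:?\<Omega>|lborel. e (norm x))"
      by (rule set_lebesgue_integral_cong) (use ee in auto)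
    also have "\<dots> = (LINT r:{a<..<b}|lborel. r *\<^sub>R circle_integral (\<lambda>x. e (norm x)) r)"
    proof (rule polar_Fubini(3)[OF ab])
      have "indicator ?\<Omega> x *\<^sub>R ((cmod (partial_deriv (axis 1 1) u x))\<^sup>2 + (cmod (partial_deriv (axis 2 1) u x))\<^sup>2 + (cmod (u x))\<^sup>2)
          = indicator ?\<Omega> x *\<^sub>R e (norm x)" for x
        using ee[of x] by (cases "x \<in> ?\<Omega>") auto
      then show "set_integrable lborel ?\<Omega> (\<lambda>x. e (norm x))" using i1 by (simp only: set_integrable_def)
    qed
    also have "\<dots> = (LINT r:{a<..<b}|lborel. 2 * pi * radial_energy_density q (\<lambda>r. of_real (W r / r)) (\<lambda>r. of_real (w r)) r)"
    proof (rule set_lebesgue_integral_cong, simp, intro allI impI)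
      fix r assume "r \<in> {a<..<b}"
      then have r: "r > 0" using ab by simp
      have "circle_integral (\<lambda>x. e (norm x)) r = 2 * pi * e r"
        using r by (simp add: circle_integral_def norm_polar set_lebesgue_integral_def)
      moreover have "radial_energy_density q (\<lambda>r. of_real (W r / r)) (\<lambda>r. of_real (w r)) r = e r * r"
        by (simp only: radial_energy_density_def e_def norm_of_real power2_abs)
      ultimately show "r *\<^sub>R circle_integral (\<lambda>x. e (norm x)) r =
          2 * pi * radial_energy_density q (\<lambda>r. of_real (W r / r)) (\<lambda>r. of_real (w r)) r"
        by simp
    qed
    also have "\<dots> = 2 * pi * (w b * W b - w a * W a)" by (simp only: set_integral_mult_right E)
    finally show ?thesis .
  qed
  have fc: "fourier_coeff u q r = of_real (w r)" if r: "r > 0" for r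
  proof -
    have "circle_integral (\<lambda>x. u x * ang (- q) x) r = (LINT \<theta>:{0..2*pi}|lborel. complex_of_real (w r))"
      unfolding circle_integral_def
    proof (rule set_lebesgue_integral_cong)
      show "\<forall>\<theta>. \<theta> \<in> {0..2*pi} \<longrightarrow> u (polar r \<theta>) * ang (- q) (polar r \<theta>) = complex_of_real (w r)"
        using r by (simp add: u_def norm_polar ang_polar mult.assoc cis_mult)
    qed simp
    also have "\<dots> = 2 * pi * w r" by (simp add: set_lebesgue_integral_def scaleR_conv_of_real)
    finally show ?thesis by (simp add: fourier_coeff_eq[OF r])
  qed
  have cr: "cont_rep a b (fourier_coeff u q) r = of_real (w r)" if "r \<in> {a..b}" for r
  proof (rule cont_rep_eq[OF ab(2) _ that])
    have "continuous_on {a..b} (\<lambda>r. complex_of_real (w r))"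
      by (intro continuous_intros bessel_system_continuous_on(1)[OF w ab(1)])
    then show "is_cont_rep a b (fourier_coeff u q) (\<lambda>r. of_real (w r))"
      using fc ab by (auto simp: is_cont_rep_def)
  qed
  have "bdry_form a b q (fourier_coeff u q) = L * (H1_norm ?\<Omega> u)\<^sup>2"
  proof -
    have "bdry_form a b q (fourier_coeff u q) = 2 * pi * (sqrt (a\<^sup>2 + (of_int q)\<^sup>2) * (w a)\<^sup>2 + sqrt (b\<^sup>2 + (of_int q)\<^sup>2) * (w b)\<^sup>2)"
      using ab by (simp add: bdry_form_def cr)
    then show ?thesis unfolding B N by simp
  qed
  \<comment> \<open>The right-hand side is the partial sum over the single frequency q.\<close>
  then have "Lambda a b q * ennreal ((H1_norm ?\<Omega> u)\<^sup>2) = (\<Sum>q\<in>{q}. ennreal (bdry_form a b q (fourier_coeff u q)))"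
    by (simp add: L(2) ennreal_mult'[OF L(1)])
  also have "\<dots> \<le> Hhalf_norm_sq a b u"
    unfolding Hhalf_norm_sq_eq_SUP by (rule SUP_upper) simp
  finally have le: "Lambda a b q * ennreal ((H1_norm ?\<Omega> u)\<^sup>2) \<le> Hhalf_norm_sq a b u" .
  have "0 < (H1_norm ?\<Omega> u)\<^sup>2" unfolding N using flux by simp
  then have Npos: "0 < H1_norm ?\<Omega> u" using H1_norm_nonneg[of ?\<Omega> u] by (simp add: less_le)
  \<comment> \<open>A function vanishing almost everywhere has weak gradient zero, hence norm zero,
    but the norm is positive by the flux.\<close>
  have "\<not> ae_zero ?\<Omega> u"
  proof
    assume z: "ae_zero ?\<Omega> u"
    have "set_borel_measurable lborel ?\<Omega> u" using L2u by (simp add: L2_def)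
    note z0 = is_L2_weak_deriv_ae_zero[OF z this]
    have "AE x in lborel. x \<in> ?\<Omega> \<longrightarrow> weak_deriv ?\<Omega> i u x = 0" if "i \<in> Basis" for i
      using emeasure_annulus_finite by (intro weak_deriv_AE_eq z0[OF that]) auto
    note this[OF ax(1)] this[OF ax(2)]
    then have "AE x in lborel. indicator ?\<Omega> x *\<^sub>R ((cmod (weak_deriv ?\<Omega> (axis 1 1) u x))\<^sup>2
        + (cmod (weak_deriv ?\<Omega> (axis 2 1) u x))\<^sup>2 + (cmod (u x))\<^sup>2) = 0"
      using z unfolding ae_zero_def by eventually_elim (auto simp: indicator_def)
    then have "(H1_norm ?\<Omega> u)\<^sup>2 = 0"
      unfolding H1_norm_sq set_lebesgue_integral_def by (rule integral_eq_zero_AE)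
    then show False using Npos by simp
  qed
  then show thesis using that[OF H _ Npos le] by blast
qed

lemma trace_const_sq:
  assumes ab: "0 < a" "a < b"
  shows "(trace_const a b)\<^sup>2 = (SUP q. Lambda a b q)"
proof (rule antisym)
  let ?\<Omega> = "annulus a b"
  let ?S = "SUP q. Lambda a b q"
  show "(trace_const a b)\<^sup>2 \<le> ?S"
  proof (cases "?S = top")
    case True
    show ?thesis unfolding True by (rule top_greatest)
  next
    case False
    then obtain s where s: "s \<ge> 0" "?S = ennreal s" by (cases ?S) auto
    have "trace_const a b \<le> ennreal (sqrt s)"
      unfolding trace_const_def
    proof (rule SUP_least, clarify)
      fix u assume u: "H1 ?\<Omega> u"
      let ?N = "H1_norm ?\<Omega> u"
      have N: "0 \<le> ?N" by (rule H1_norm_nonneg)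
      have X: "Hhalf_norm_sq a b u \<le> ennreal (s * ?N\<^sup>2)"
        using trace_inequality[OF ab u] unfolding s(2) by (simp add: ennreal_mult'[OF s(1)])
      then obtain x where x: "x \<ge> 0" "Hhalf_norm_sq a b u = ennreal x"
        by (cases "Hhalf_norm_sq a b u") (auto simp: top_unique)
      have "x \<le> s * ?N\<^sup>2" using X x s N by (simp add: ennreal_le_iff)
      then have "sqrt x \<le> sqrt s * ?N" using N by (metis real_sqrt_le_iff real_sqrt_mult real_sqrt_pow2 real_sqrt_power abs_of_nonneg real_sqrt_abs)
      moreover have Hh: "Hhalf_norm a b u = ennreal (sqrt x)"
        using x by (simp add: Hhalf_norm_def ennreal_sqrt_def)
      ultimately show "Hhalf_norm a b u / ennreal ?N \<le> ennreal (sqrt s)"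
      \<comment> \<open>For norm zero the preceding inequality forces the trace norm to vanish too,
        and 0 / 0 is 0 in \<open>ennreal\<close>.\<close>
      proof (cases "?N = 0")
        case False
        then have Np: "?N > 0" using N by simp
        have "ennreal (sqrt x) / ennreal ?N = ennreal (sqrt x / ?N)" using x Np by (simp add: divide_ennreal)
        also have "\<dots> \<le> ennreal (sqrt s)"
          using \<open>sqrt x \<le> sqrt s * ?N\<close> Np by (intro ennreal_leI) (simp add: divide_le_eq)
        finally show ?thesis by (simp only: Hh)
      qed (use x in auto)
    qed
    then have "(trace_const a b)\<^sup>2 \<le> (ennreal (sqrt s))\<^sup>2" by (rule power_mono_ennreal)
    also have "\<dots> = ?S" using s by (simp add: ennreal_power)
    finally show ?thesis .
  qed
  show "?S \<le> (trace_const a b)\<^sup>2"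
  proof (rule SUP_least)
    fix q :: int
    obtain u where u: "H1 ?\<Omega> u" "\<not> ae_zero ?\<Omega> u" "0 < H1_norm ?\<Omega> u"
      and le: "Lambda a b q * ennreal ((H1_norm ?\<Omega> u)\<^sup>2) \<le> Hhalf_norm_sq a b u"
      by (rule trace_extremal[OF ab])
    let ?N = "H1_norm ?\<Omega> u"
    obtain L where L: "0 \<le> L" "Lambda a b q = ennreal L" by (rule Lambda_characterization[OF ab, of q])
    have quot: "Hhalf_norm a b u / ennreal ?N \<le> trace_const a b"
      unfolding trace_const_def by (rule SUP_upper) (use u in auto)
    have "Lambda a b q \<le> (Hhalf_norm a b u / ennreal ?N)\<^sup>2"
    proof (cases "Hhalf_norm_sq a b u")
      case (real x)
      have "ennreal (L * ?N\<^sup>2) \<le> ennreal x" using le unfolding L(2) real by (simp add: ennreal_mult'[OF L(1)])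
      then have x: "L * ?N\<^sup>2 \<le> x" using real L by (simp add: ennreal_le_iff)
      have "Hhalf_norm a b u / ennreal ?N = ennreal (sqrt x / ?N)"
        using real u(3) by (simp add: Hhalf_norm_def ennreal_sqrt_def divide_ennreal)
      then have "(Hhalf_norm a b u / ennreal ?N)\<^sup>2 = ennreal (x / ?N\<^sup>2)"
        using real u(3) by (simp add: ennreal_power power_divide)
      moreover have "L \<le> x / ?N\<^sup>2" using x u(3) by (simp add: le_divide_eq)
      ultimately show ?thesis by (simp add: L(2) ennreal_leI)
    next
      \<comment> \<open>An infinite trace norm over a positive finite norm makes the quotient
        infinite, so the bound is immediate.\<close>
      case top
      then show ?thesis using u(3)
        by (simp add: Hhalf_norm_def ennreal_sqrt_def ennreal_top_divide power2_eq_square ennreal_top_mult)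
    qed
    also have "\<dots> \<le> (trace_const a b)\<^sup>2" by (rule power_mono_ennreal[OF quot])
    finally show "Lambda a b q \<le> (trace_const a b)\<^sup>2" .
  qed
qed

theorem mainTheorem3:
  fixes Rin Rout :: real
  assumes "0 < Rin" and "Rin < Rout"
  shows "(trace_const Rin Rout)\<^sup>2 = (SUP q::int. Lambda Rin Rout q) \<and>
    (\<forall>q::int. \<exists>L::real. 0 \<le> L \<and> Lambda Rin Rout q = ennreal L \<and>
       det (bessel_matrix Rin Rout q L) = 0 \<and>
       (\<forall>L'::real. det (bessel_matrix Rin Rout q L') = 0 \<longrightarrow> L' \<le> L))"
proof (intro conjI allI)
  show "(trace_const Rin Rout)\<^sup>2 = (SUP q::int. Lambda Rin Rout q)"
    by (rule trace_const_sq[OF assms])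
  fix q :: int
  show "\<exists>L::real. 0 \<le> L \<and> Lambda Rin Rout q = ennreal L \<and>
       det (bessel_matrix Rin Rout q L) = 0 \<and>
       (\<forall>L'::real. det (bessel_matrix Rin Rout q L') = 0 \<longrightarrow> L' \<le> L)"
  proof (rule Lambda_characterization[OF assms, of q])
    fix L :: real
    assume "0 \<le> L" "Lambda Rin Rout q = ennreal L" "det (bessel_matrix Rin Rout q L) = 0"
      "\<And>L'. det (bessel_matrix Rin Rout q L') = 0 \<Longrightarrow> L' \<le> L"
    then show ?thesis by blast
  qed
qed

end
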